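(* Let $\mathcal T=(V,p)$ be a leafless directed tree with root $\omega$ and let $k\ge 1$. Assume that nonzero weights $\{\lambda_v\}_{v\in W}\subseteq\mathbb C\setminus\{0\}$ are given, where $W:=\{v\in V: p^k(v)\ne\omega\}$. For $v\in \mathrm{Chi}^{\langle k\rangle}(\omega)$ let $S_{\lambda_v^\to}$ denote the weighted shift on the rooted directed tree $\mathcal T_{(v\to)}$ with weights $\lambda_u$ for $u\in\mathrm{Des}(v)\setminus\{v\}$ and $0$ at the root $v$. Then the following conditions are equivalent: (a) there exist weights $\{\lambda_v\}_{v\in V\setminus W}$ such that the weighted shift $S_\lambda$ on $\mathcal T$ with weights $\lambda=\{\lambda_v\}_{v\in V}$ is proper, bounded and subnormal; (b) the set $\mathrm{Chi}^{\langle k\rangle}(\omega)$ is at most countable, the weighted shift $S_{\lambda_v^\to}$ is proper and admits subnormal $k$-step backward extension for every $v\in\mathrm{Chi}^{\langle k\rangle}(\omega)$, and $\sup\{\|S_{\lambda_v^\to}\|: v\in\mathrm{Chi}^{\langle k\rangle}(\omega)\}<\infty$.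
   Context: A directed forest is a pair $\mathcal T=(V,p)$ where $V$ is a nonempty set and $p:V\to V$ is a function such that $p^n(v)=v$ with $n\ge 1$ implies $p(v)=v$. Roots are the $v$ with $p(v)=v$. A directed tree is a directed forest such that for all $v,w\in V$ there are $m,n\ge0$ with $p^n(v)=p^m(w)$; it has at most one root, and is rooted if it has one. Leafless means $p(V)=V$. For $k\ge1$, $\mathrm{Chi}^{\langle k\rangle}(v)=\{u\in V:p^k(u)=v\ne p^{k-1}(u)\}$, $\mathrm{Chi}^{\langle 0\rangle}(v)=\{v\}$, $\mathrm{Des}(v)=\bigcup_{n\ge0}\mathrm{Chi}^{\langle n\rangle}(v)$. $\mathcal T_{(v\to)}$ is the rooted directed tree with vertex set $\mathrm{Des}(v)$, root $v$, and parent function equal to $p$ on $\mathrm{Des}(v)\setminus\{v\}$ and fixing $v$. A system of weights on $\mathcal T$ is $\lambda=\{\lambda_v\}_{v\in V}\subseteq\mathbb C$ with $\lambda_v=0$ for every root $v$. The weighted shift $S_\lambda$ on $\mathcal T$ is the operator in $\ell^2(V)$ given by $(S_\lambda f)(v)=\lambda_v f(p(v))$ (with maximal domain). It is proper if $\lambda_v=0$ only for roots $v$. A bounded operator on a complex Hilbert space is subnormal if it is the restriction of a normal operator (on a possibly larger Hilbert space) to an invariant subspace. Backward extension: for a rooted directed tree $\mathcal T=(V,p)$ with root $\omega=\omega_0$ and $k\ge0$, $\mathcal T_{\langle k\rangle}$ is the directed tree with vertex set $V\sqcup\{\omega_1,\dots,\omega_k\}$ (new distinct vertices) and parent function equal to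 $p$ on $V\setminus\{\omega_0\}$, sending $\omega_{j-1}\mapsto\omega_j$ for $j=1,\dots,k$ and $\omega_k\mapsto\omega_k$. A bounded weighted shift $S_\lambda$ on $\mathcal T$ admits subnormal $k$-step backward extension if it is subnormal and there exist nonzero weights $\lambda'_{\omega_0},\dots,\lambda'_{\omega_{k-1}}$ such that the weighted shift on $\mathcal T_{\langle k\rangle}$ with weights $\lambda'_v=\lambda_v$ for $v\in V\setminus\{\omega_0\}$, these $\lambda'_{\omega_j}$ ($0\le j\le k-1$), and $\lambda'_{\omega_k}=0$, is bounded and subnormal. (In particular, saying that a weighted shift admits such an extension includes that it is bounded.) *)

theory Defs
  imports "HOL-Analysis.Infinite_Sum" "HOL-Algebra.Module"
begin

section \<open>Complex Hilbert spaces with explicit carriers\<close>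

text \<open>
  The spaces \<open>\<ell>\<^sup>2(V)\<close> depend on a set \<open>V\<close>, and subnormality quantifies over Hilbert spaces inside
  a formula; so Hilbert spaces are records with an explicit carrier, built on the modules of
  HOL-Algebra. The fields for ring multiplication and ring unit that such a record inherits
  are never used.
\<close>

definition complex_ring :: "complex ring" where
  "complex_ring = \<lparr>carrier = UNIV, mult = (*), one = 1, zero = 0, add = (+)\<rparr>"

record 'h inner_space = "(complex, 'h) module" +
  cinner :: "'h \<Rightarrow> 'h \<Rightarrow> complex"

definition hnorm :: "'h inner_space \<Rightarrow> 'h \<Rightarrow> real" where
  "hnorm H x = sqrt (Re (cinner H x x))"

locale complex_hilbert_space = module complex_ring H for H :: "'h inner_space" (structure) +
  assumes cinner_add_left:
      "\<lbrakk>x \<in> carrier H; y \<in> carrier H; z \<in> carrier H\<rbrakk>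
        \<Longrightarrow> cinner H (x \<oplus> y) z = cinner H x z + cinner H y z"
    and cinner_smult_left:
      "\<lbrakk>x \<in> carrier H; y \<in> carrier H\<rbrakk> \<Longrightarrow> cinner H (c \<odot> x) y = c * cinner H x y"
    and cinner_commute:
      "\<lbrakk>x \<in> carrier H; y \<in> carrier H\<rbrakk> \<Longrightarrow> cinner H y x = cnj (cinner H x y)"
    and cinner_pos:
      "\<lbrakk>x \<in> carrier H; x \<noteq> \<zero>\<rbrakk> \<Longrightarrow> 0 < Re (cinner H x x)"
    and complete:
      "\<lbrakk>\<And>n. X n \<in> carrier H;
        \<And>e. 0 < e \<Longrightarrow> \<exists>M. \<forall>m\<ge>M. \<forall>n\<ge>M. hnorm H (X m \<ominus> X n) < e\<rbrakk>
        \<Longrightarrow> \<exists>l\<in>carrier H. (\<lambda>n::nat. hnorm H (X n \<ominus> l)) \<longlonglongrightarrow> 0"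

definition clinear_map :: "'h inner_space \<Rightarrow> 'k inner_space \<Rightarrow> ('h \<Rightarrow> 'k) \<Rightarrow> bool" where
  "clinear_map H K T \<longleftrightarrow> T \<in> carrier H \<rightarrow> carrier K
     \<and> (\<forall>x\<in>carrier H. \<forall>y\<in>carrier H. T (x \<oplus>\<^bsub>H\<^esub> y) = T x \<oplus>\<^bsub>K\<^esub> T y)
     \<and> (\<forall>c. \<forall>x\<in>carrier H. T (c \<odot>\<^bsub>H\<^esub> x) = c \<odot>\<^bsub>K\<^esub> T x)"

definition bounded_operator :: "'h inner_space \<Rightarrow> ('h \<Rightarrow> 'h) \<Rightarrow> bool" where
  "bounded_operator H T \<longleftrightarrow> clinear_map H H T
     \<and> (\<exists>C. \<forall>x\<in>carrier H. hnorm H (T x) \<le> C * hnorm H x)"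

text \<open>Meaningful for bounded operators only.\<close>

definition op_norm :: "'h inner_space \<Rightarrow> ('h \<Rightarrow> 'h) \<Rightarrow> real" where
  "op_norm H T = (SUP x\<in>{x \<in> carrier H. hnorm H x \<le> 1}. hnorm H (T x))"

definition adjoint_pair :: "'h inner_space \<Rightarrow> ('h \<Rightarrow> 'h) \<Rightarrow> ('h \<Rightarrow> 'h) \<Rightarrow> bool" where
  "adjoint_pair H T T' \<longleftrightarrow>
     (\<forall>x\<in>carrier H. \<forall>y\<in>carrier H. cinner H (T x) y = cinner H x (T' y))"

definition normal_operator :: "'h inner_space \<Rightarrow> ('h \<Rightarrow> 'h) \<Rightarrow> bool" where
  "normal_operator H N \<longleftrightarrow> bounded_operator H N
     \<and> (\<exists>N'. bounded_operator H N' \<and> adjoint_pair H N N'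
            \<and> (\<forall>x\<in>carrier H. N (N' x) = N' (N x)))"

definition isometric_embedding :: "'h inner_space \<Rightarrow> 'k inner_space \<Rightarrow> ('h \<Rightarrow> 'k) \<Rightarrow> bool" where
  "isometric_embedding H K J \<longleftrightarrow> clinear_map H K J
     \<and> (\<forall>x\<in>carrier H. \<forall>y\<in>carrier H. cinner K (J x) (J y) = cinner H x y)"

text \<open>
  The normal operator \<open>N\<close> on \<open>K\<close> leaves the copy \<open>J ` carrier H\<close> of \<open>H\<close> invariant and restricts
  to \<open>T\<close> there.
\<close>

definition normal_extension ::
  "'h inner_space \<Rightarrow> ('h \<Rightarrow> 'h) \<Rightarrow> 'k inner_space \<Rightarrow> ('k \<Rightarrow> 'k) \<Rightarrow> ('h \<Rightarrow> 'k) \<Rightarrow> bool" where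
  "normal_extension H T K N J \<longleftrightarrow> complex_hilbert_space K \<and> normal_operator K N
     \<and> isometric_embedding H K J \<and> (\<forall>x\<in>carrier H. N (J x) = J (T x))"

text \<open>
  A formula cannot quantify over types, so the type of the elements of the larger space has to be
  fixed. This is no restriction: lemma \<open>subnormalI\<close> below shows that a normal extension
  in a Hilbert space over any type whatsoever yields one over the type chosen here.
\<close>

definition subnormal :: "'h inner_space \<Rightarrow> ('h \<Rightarrow> 'h) \<Rightarrow> bool" where
  "subnormal H T \<longleftrightarrow> bounded_operator H T
     \<and> (\<exists>(K :: (nat \<Rightarrow> 'h \<Rightarrow> complex) inner_space) N J. normal_extension H T K N J)"

section \<open>The space \<open>\<ell>\<^sup>2(V)\<close>\<close>

text \<open>Functions on \<open>V\<close> are represented by functions on the whole type that vanish off \<open>V\<close>.\<close>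

definition ell2 :: "'v set \<Rightarrow> ('v \<Rightarrow> complex) inner_space" where
  "ell2 V = \<lparr>
     carrier = {f. (\<forall>v. v \<notin> V \<longrightarrow> f v = 0) \<and> (\<lambda>v. (cmod (f v))\<^sup>2) summable_on V},
     mult = undefined, one = undefined,
     zero = (\<lambda>v. 0),
     add = (\<lambda>f g v. f v + g v),
     smult = (\<lambda>c f v. c * f v),
     cinner = (\<lambda>f g. \<Sum>\<^sub>\<infinity>v\<in>V. f v * cnj (g v))\<rparr>"

section \<open>Directed trees\<close>

text \<open>The values of the parent function \<open>p\<close> outside of \<open>V\<close> are irrelevant.\<close>

definition directed_forest :: "'v set \<Rightarrow> ('v \<Rightarrow> 'v) \<Rightarrow> bool" where
  "directed_forest V p \<longleftrightarrow> V \<noteq> {} \<and> p \<in> V \<rightarrow> V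
     \<and> (\<forall>v\<in>V. \<forall>n\<ge>1. (p ^^ n) v = v \<longrightarrow> p v = v)"

definition is_root :: "'v set \<Rightarrow> ('v \<Rightarrow> 'v) \<Rightarrow> 'v \<Rightarrow> bool" where
  "is_root V p v \<longleftrightarrow> v \<in> V \<and> p v = v"

definition directed_tree :: "'v set \<Rightarrow> ('v \<Rightarrow> 'v) \<Rightarrow> bool" where
  "directed_tree V p \<longleftrightarrow> directed_forest V p
     \<and> (\<forall>v\<in>V. \<forall>w\<in>V. \<exists>m n. (p ^^ n) v = (p ^^ m) w)"

definition leafless :: "'v set \<Rightarrow> ('v \<Rightarrow> 'v) \<Rightarrow> bool" where
  "leafless V p \<longleftrightarrow> p ` V = V"

definition Chi :: "'v set \<Rightarrow> ('v \<Rightarrow> 'v) \<Rightarrow> nat \<Rightarrow> 'v \<Rightarrow> 'v set" where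
  "Chi V p k v =
     (if k = 0 then {v} else {u \<in> V. (p ^^ k) u = v \<and> v \<noteq> (p ^^ (k - 1)) u})"

definition Des :: "'v set \<Rightarrow> ('v \<Rightarrow> 'v) \<Rightarrow> 'v \<Rightarrow> 'v set" where
  "Des V p v = (\<Union>n. Chi V p n v)"

section \<open>Weighted shifts\<close>

definition is_weights :: "'v set \<Rightarrow> ('v \<Rightarrow> 'v) \<Rightarrow> ('v \<Rightarrow> complex) \<Rightarrow> bool" where
  "is_weights V p lam \<longleftrightarrow> (\<forall>v. is_root V p v \<longrightarrow> lam v = 0)"

definition proper_weights :: "'v set \<Rightarrow> ('v \<Rightarrow> 'v) \<Rightarrow> ('v \<Rightarrow> complex) \<Rightarrow> bool" where
  "proper_weights V p lam \<longleftrightarrow> (\<forall>v\<in>V. lam v = 0 \<longrightarrow> is_root V p v)"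

text \<open>
  The formula defining the shift. The maximal domain consists of the \<open>f\<close> in \<open>\<ell>\<^sup>2(V)\<close> whose image is
  again in \<open>\<ell>\<^sup>2(V)\<close>; hence \<^term>\<open>bounded_operator (ell2 V) (weighted_shift V p lam)\<close>
  says that the maximal domain is all of \<open>\<ell>\<^sup>2(V)\<close> and that the operator is bounded.
\<close>

definition weighted_shift ::
  "'v set \<Rightarrow> ('v \<Rightarrow> 'v) \<Rightarrow> ('v \<Rightarrow> complex) \<Rightarrow> ('v \<Rightarrow> complex) \<Rightarrow> 'v \<Rightarrow> complex" where
  "weighted_shift V p lam f = (\<lambda>v. if v \<in> V then lam v * f (p v) else 0)"

text \<open>
  The subtree with root \<open>v\<close> has vertex set \<^term>\<open>Des V p v\<close>.
\<close>

definition subtree_parent :: "('v \<Rightarrow> 'v) \<Rightarrow> 'v \<Rightarrow> 'v \<Rightarrow> 'v" where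
  "subtree_parent p v = p(v := v)"

definition subtree_weights :: "('v \<Rightarrow> complex) \<Rightarrow> 'v \<Rightarrow> 'v \<Rightarrow> complex" where
  "subtree_weights lam v = lam(v := 0)"

section \<open>Backward extensions\<close>

text \<open>
  In the extended tree \<^term>\<open>Inl v\<close> is the old vertex \<open>v\<close>, and \<^term>\<open>Inr j\<close> for \<open>1 \<le> j \<le> k\<close> is the new
  vertex \<open>\<omega>\<^sub>j\<close>; \<open>\<omega>\<^sub>0\<close> is \<^term>\<open>Inl \<omega>\<close>. The new weight at \<open>\<omega>\<^sub>j\<close>, \<open>0 \<le> j \<le> k\<close>, is \<open>\<mu> j\<close>.
\<close>

definition backward_verts :: "nat \<Rightarrow> 'v set \<Rightarrow> ('v + nat) set" where
  "backward_verts k V = Inl ` V \<union> Inr ` {1..k}"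

definition backward_parent :: "nat \<Rightarrow> ('v \<Rightarrow> 'v) \<Rightarrow> 'v \<Rightarrow> 'v + nat \<Rightarrow> 'v + nat" where
  "backward_parent k p \<omega> x = (case x of
     Inl v \<Rightarrow> if v \<noteq> \<omega> then Inl (p v) else if k = 0 then Inl \<omega> else Inr 1
   | Inr j \<Rightarrow> if j < k then Inr (j + 1) else Inr j)"

definition backward_weights ::
  "'v \<Rightarrow> ('v \<Rightarrow> complex) \<Rightarrow> (nat \<Rightarrow> complex) \<Rightarrow> 'v + nat \<Rightarrow> complex" where
  "backward_weights \<omega> lam \<mu> x = (case x of
     Inl v \<Rightarrow> if v \<noteq> \<omega> then lam v else \<mu> 0
   | Inr j \<Rightarrow> \<mu> j)"

text \<open>Boundedness is part of \<^const>\<open>subnormal\<close>.\<close>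

definition admits_subnormal_backward_extension ::
  "nat \<Rightarrow> 'v set \<Rightarrow> ('v \<Rightarrow> 'v) \<Rightarrow> 'v \<Rightarrow> ('v \<Rightarrow> complex) \<Rightarrow> bool" where
  "admits_subnormal_backward_extension k V p \<omega> lam \<longleftrightarrow>
     subnormal (ell2 V) (weighted_shift V p lam) \<and>
     (\<exists>\<mu>. (\<forall>j<k. \<mu> j \<noteq> 0) \<and> \<mu> k = 0 \<and>
        subnormal (ell2 (backward_verts k V))
          (weighted_shift (backward_verts k V) (backward_parent k p \<omega>) (backward_weights \<omega> lam \<mu>)))"

section \<open>Independence of subnormality from the type of the larger space\<close>

context complex_hilbert_space begin

lemma ring_UNIV [simp]: "carrier complex_ring = UNIV"
  by (simp add: complex_ring_def)

lemma smult_in [simp, intro]: "x \<in> carrier H \<Longrightarrow> c \<odot> x \<in> carrier H"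
  by (rule smult_closed) auto

lemma cinner_add_right:
  "\<lbrakk>x \<in> carrier H; y \<in> carrier H; z \<in> carrier H\<rbrakk>
    \<Longrightarrow> cinner H z (x \<oplus> y) = cinner H z x + cinner H z y"
  by (metis cinner_add_left cinner_commute complex_cnj_add M.add.m_closed)

lemma cinner_smult_right:
  "\<lbrakk>x \<in> carrier H; y \<in> carrier H\<rbrakk> \<Longrightarrow> cinner H y (c \<odot> x) = cnj c * cinner H y x"
  by (metis cinner_smult_left cinner_commute complex_cnj_mult smult_in)

lemma cinner_zero_left: "x \<in> carrier H \<Longrightarrow> cinner H \<zero> x = 0"
  using cinner_add_left[of \<zero> \<zero> x] by simp

lemma cinner_minus_left:
  assumes "x \<in> carrier H" "y \<in> carrier H" "z \<in> carrier H"
  shows "cinner H (x \<ominus> y) z = cinner H x z - cinner H y z"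
proof -
  have "cinner H (x \<ominus> y \<oplus> y) z = cinner H (x \<ominus> y) z + cinner H y z"
    by (rule cinner_add_left) (use assms in auto)
  moreover have "x \<ominus> y \<oplus> y = x"
    using assms by (simp add: a_minus_def M.a_assoc M.l_neg)
  ultimately show ?thesis by simp
qed

lemma cinner_nonneg: "x \<in> carrier H \<Longrightarrow> 0 \<le> Re (cinner H x x)"
  using cinner_pos[of x] cinner_zero_left[of x] by (cases "x = \<zero>") auto

lemma cinner_eq_Re: "x \<in> carrier H \<Longrightarrow> cinner H x x = of_real (Re (cinner H x x))"
  using cinner_commute[of x x] by (auto simp: complex_eq_iff)

lemma cauchy_schwarz:
  assumes x: "x \<in> carrier H" and y: "y \<in> carrier H"
  shows "cmod (cinner H x y) \<le> hnorm H x * hnorm H y"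
proof (cases "y = \<zero>")
  case True
  then show ?thesis
    using x cinner_commute[of \<zero> x] cinner_zero_left[of x] cinner_zero_left[of \<zero>]
    by (simp add: hnorm_def)
next
  case False
  define a where "a = Re (cinner H x x)"
  define b where "b = Re (cinner H y y)"
  define c where "c = cinner H x y"
  have b: "b > 0" using False y cinner_pos b_def by auto
  have xx: "cinner H x x = of_real a" and yy: "cinner H y y = of_real b"
    using cinner_eq_Re x y by (auto simp: a_def b_def)
  have yx: "cinner H y x = cnj c" unfolding c_def by (rule cinner_commute[OF x y])
  define t where "t = - (c / of_real b)"
  have "cinner H (x \<oplus> t \<odot> y) (x \<oplus> t \<odot> y)
      = of_real a + cnj t * c + t * cnj c + t * cnj t * of_real b"
    using x y by (simp add: cinner_add_left cinner_add_right cinner_smult_left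
        cinner_smult_right xx yy yx c_def[symmetric] algebra_simps)
  also have "\<dots> = of_real a - c * cnj c / of_real b"
    using b by (simp add: t_def field_simps)
  also have "\<dots> = of_real (a - (cmod c)\<^sup>2 / b)"
    by (simp only: complex_norm_square[symmetric] of_real_diff of_real_divide)
  finally have "0 \<le> a - (cmod c)\<^sup>2 / b"
    using cinner_nonneg[of "x \<oplus> t \<odot> y"] x y by simp
  then have "(cmod c)\<^sup>2 \<le> a * b"
    using b by (simp add: field_simps)
  then have "cmod c \<le> sqrt (a * b)"
    by (rule real_le_rsqrt)
  then show ?thesis
    by (simp add: hnorm_def a_def b_def c_def real_sqrt_mult)
qed

end


context complex_hilbert_space begin

lemma minus_eqI:
  "\<lbrakk>x \<in> carrier H; y \<in> carrier H; d \<in> carrier H; d \<oplus> y = x\<rbrakk> \<Longrightarrow> x \<ominus> y = d"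
  by (metis M.a_assoc M.minus_closed M.r_neg M.r_zero M.a_inv_closed a_minus_def)

lemma minus_add_cancel: "\<lbrakk>x \<in> carrier H; y \<in> carrier H\<rbrakk> \<Longrightarrow> x \<ominus> y \<oplus> y = x"
  by (simp add: a_minus_def M.a_assoc M.l_neg)

lemma minus_as_smult: "\<lbrakk>x \<in> carrier H; y \<in> carrier H\<rbrakk> \<Longrightarrow> x \<ominus> y = x \<oplus> (- 1) \<odot> y"
proof (rule minus_eqI)
  assume xy: "x \<in> carrier H" "y \<in> carrier H"
  have "(- 1) \<odot> y \<oplus> y = ((- 1) + 1) \<odot> y"
    using smult_l_distr[of "-1" 1 y] smult_one[of y] xy by (simp add: complex_ring_def)
  also have "\<dots> = \<zero>"
    using smult_l_null[of y] xy by (simp add: complex_ring_def)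
  finally show "x \<oplus> (- 1) \<odot> y \<oplus> y = x"
    using xy by (simp add: M.a_assoc)
qed auto

end

lemma cring_complex_ring: "cring complex_ring"
proof (rule cringI)
  show "abelian_group complex_ring"
    by (rule abelian_groupI)
       (auto simp: complex_ring_def algebra_simps intro: exI[of _ "- x" for x] add.left_inverse)
  show "comm_monoid complex_ring"
    by (rule comm_monoidI) (auto simp: complex_ring_def)
qed (auto simp: complex_ring_def algebra_simps)

lemma hilbert_subspace:
  assumes K: "complex_hilbert_space K" and sub: "S \<subseteq> carrier K" and zero: "\<zero>\<^bsub>K\<^esub> \<in> S"
    and add: "\<And>x y. x \<in> S \<Longrightarrow> y \<in> S \<Longrightarrow> x \<oplus>\<^bsub>K\<^esub> y \<in> S"
    and smult: "\<And>c x. x \<in> S \<Longrightarrow> c \<odot>\<^bsub>K\<^esub> x \<in> S"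
    and closed: "\<And>X l. \<lbrakk>\<And>n::nat. X n \<in> S; l \<in> carrier K;
                   (\<lambda>n. hnorm K (X n \<ominus>\<^bsub>K\<^esub> l)) \<longlonglongrightarrow> 0\<rbrakk> \<Longrightarrow> l \<in> S"
  shows "complex_hilbert_space (K\<lparr>carrier := S\<rparr>)"
proof -
  interpret K: complex_hilbert_space K by (rule K)
  let ?L = "K\<lparr>carrier := S\<rparr>"
  have SK: "x \<in> S \<Longrightarrow> x \<in> carrier K" for x using sub by auto
  have neg: "\<exists>y\<in>S. y \<oplus>\<^bsub>K\<^esub> x = \<zero>\<^bsub>K\<^esub>" if "x \<in> S" for x
  proof
    show "(- 1) \<odot>\<^bsub>K\<^esub> x \<in> S" using that smult by auto
    show "(- 1) \<odot>\<^bsub>K\<^esub> x \<oplus>\<^bsub>K\<^esub> x = \<zero>\<^bsub>K\<^esub>"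
      using K.minus_as_smult[of x x] SK[OF that]
      by (metis K.M.a_comm K.M.r_neg K.smult_in a_minus_def)
  qed
  then have neg': "\<exists>y\<in>S. x \<oplus>\<^bsub>K\<^esub> y = \<zero>\<^bsub>K\<^esub>" if "x \<in> S" for x
    using that K.M.a_comm SK by metis
  have ag: "abelian_group ?L"
    by (rule abelian_groupI) (auto simp: add zero SK K.M.a_ac neg')
  have mod: "module complex_ring ?L"
    using K.smult_l_distr K.smult_r_distr K.smult_assoc1 K.smult_one
    by (intro moduleI cring_complex_ring ag) (auto simp: smult SK)
  interpret L: module complex_ring ?L by (rule mod)
  have minus: "x \<ominus>\<^bsub>?L\<^esub> y = x \<ominus>\<^bsub>K\<^esub> y" if "x \<in> S" "y \<in> S" for x y
  proof (rule K.minus_eqI[symmetric])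
    have *: "x \<ominus>\<^bsub>?L\<^esub> y \<in> carrier ?L" using that by (intro L.M.minus_closed) auto
    then show "x \<ominus>\<^bsub>?L\<^esub> y \<in> carrier K" using SK by auto
    have "x \<ominus>\<^bsub>?L\<^esub> y \<oplus>\<^bsub>?L\<^esub> y = x"
      using that L.M.a_assoc[of x "\<ominus>\<^bsub>?L\<^esub> y" y] L.M.l_neg[of y] L.M.a_inv_closed[of y]
        L.M.r_zero[of x]
      unfolding a_minus_def by simp
    then show "x \<ominus>\<^bsub>?L\<^esub> y \<oplus>\<^bsub>K\<^esub> y = x" by simp
  qed (use that SK in auto)
  have norm: "hnorm ?L = hnorm K" by (auto simp: hnorm_def)
  show ?thesis
  proof (rule complex_hilbert_space.intro[OF mod], unfold_locales)
    fix X :: "nat \<Rightarrow> 'a"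
    assume X: "\<And>n. X n \<in> carrier ?L"
      and cau: "\<And>e. 0 < e \<Longrightarrow> \<exists>M. \<forall>m\<ge>M. \<forall>n\<ge>M. hnorm ?L (X m \<ominus>\<^bsub>?L\<^esub> X n) < e"
    have "\<exists>l\<in>carrier K. (\<lambda>n. hnorm K (X n \<ominus>\<^bsub>K\<^esub> l)) \<longlonglongrightarrow> 0"
      by (rule K.complete) (use X cau minus norm SK in auto)
    then obtain l where l: "l \<in> carrier K" "(\<lambda>n. hnorm K (X n \<ominus>\<^bsub>K\<^esub> l)) \<longlonglongrightarrow> 0" by auto
    moreover have "l \<in> S" using closed[of X l] X l by auto
    ultimately show "\<exists>l\<in>carrier ?L. (\<lambda>n. hnorm ?L (X n \<ominus>\<^bsub>?L\<^esub> l)) \<longlonglongrightarrow> 0"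
      using X minus norm by auto
  qed (auto simp: SK K.cinner_add_left K.cinner_smult_left K.cinner_pos intro: K.cinner_commute)
qed

definition transport :: "('k \<Rightarrow> 'u) \<Rightarrow> 'k inner_space \<Rightarrow> 'u inner_space" where
  "transport F K = (let G = inv_into (carrier K) F in \<lparr>
     carrier = F ` carrier K,
     mult = undefined, one = undefined,
     zero = F \<zero>\<^bsub>K\<^esub>,
     add = (\<lambda>x y. F (G x \<oplus>\<^bsub>K\<^esub> G y)),
     smult = (\<lambda>c x. F (c \<odot>\<^bsub>K\<^esub> G x)),
     cinner = (\<lambda>x y. cinner K (G x) (G y))\<rparr>)"

context
  fixes K :: "'k inner_space" and F :: "'k \<Rightarrow> 'u"
  assumes K: "complex_hilbert_space K" and inj: "inj_on F (carrier K)"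
begin

interpretation K: complex_hilbert_space K by (rule K)

lemma transport_simps:
  "carrier (transport F K) = F ` carrier K"
  "\<zero>\<^bsub>transport F K\<^esub> = F \<zero>\<^bsub>K\<^esub>"
  "\<lbrakk>x \<in> carrier K; y \<in> carrier K\<rbrakk> \<Longrightarrow> F x \<oplus>\<^bsub>transport F K\<^esub> F y = F (x \<oplus>\<^bsub>K\<^esub> y)"
  "x \<in> carrier K \<Longrightarrow> c \<odot>\<^bsub>transport F K\<^esub> F x = F (c \<odot>\<^bsub>K\<^esub> x)"
  "\<lbrakk>x \<in> carrier K; y \<in> carrier K\<rbrakk> \<Longrightarrow> cinner (transport F K) (F x) (F y) = cinner K x y"
  "x \<in> carrier K \<Longrightarrow> hnorm (transport F K) (F x) = hnorm K x"
  using inj by (auto simp: transport_def Let_def hnorm_def)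

lemma hilbert_transport: "complex_hilbert_space (transport F K)"
proof -
  let ?L = "transport F K"
  note [simp] = transport_simps
  have neg: "\<exists>y\<in>carrier K. F (x \<oplus>\<^bsub>K\<^esub> y) = F \<zero>\<^bsub>K\<^esub>" if "x \<in> carrier K" for x
    using that K.M.r_neg[of x] K.M.a_inv_closed[of x] by metis
  have pos: "0 < Re (cinner K x x)" if "x \<in> carrier K" "F x \<noteq> F \<zero>\<^bsub>K\<^esub>" for x
    using that K.cinner_pos[of x] by auto
  have ag: "abelian_group ?L"
    by (rule abelian_groupI) (auto simp: K.M.a_ac neg)
  have mod: "module complex_ring ?L"
    using K.smult_l_distr K.smult_r_distr K.smult_assoc1 K.smult_one
    by (intro moduleI cring_complex_ring ag) auto
  interpret L: module complex_ring ?L by (rule mod)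
  have minus: "F x \<ominus>\<^bsub>?L\<^esub> F y = F (x \<ominus>\<^bsub>K\<^esub> y)" if xy: "x \<in> carrier K" "y \<in> carrier K" for x y
  proof -
    have *: "F x \<in> carrier ?L" "F y \<in> carrier ?L" using xy by auto
    have "F x \<ominus>\<^bsub>?L\<^esub> F y = (F (x \<ominus>\<^bsub>K\<^esub> y) \<oplus>\<^bsub>?L\<^esub> F y) \<ominus>\<^bsub>?L\<^esub> F y"
      using xy K.minus_add_cancel[OF xy] by simp
    also have "\<dots> = F (x \<ominus>\<^bsub>K\<^esub> y)"
      unfolding a_minus_def[of ?L]
      using *(2) xy L.M.a_assoc[of "F (x \<ominus>\<^bsub>K\<^esub> y)" "F y" "\<ominus>\<^bsub>?L\<^esub> F y"] L.M.r_neg[of "F y"]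
        L.M.a_inv_closed[of "F y"] L.M.r_zero[of "F (x \<ominus>\<^bsub>K\<^esub> y)"]
        K.M.minus_closed[OF xy] by (metis imageI transport_simps(1))
    finally show ?thesis .
  qed
  show ?thesis
  proof (rule complex_hilbert_space.intro[OF mod], unfold_locales)
    fix X :: "nat \<Rightarrow> 'u"
    assume X: "\<And>n. X n \<in> carrier ?L"
      and cau: "\<And>e. 0 < e \<Longrightarrow> \<exists>M. \<forall>m\<ge>M. \<forall>n\<ge>M. hnorm ?L (X m \<ominus>\<^bsub>?L\<^esub> X n) < e"
    have "\<forall>n. \<exists>y\<in>carrier K. X n = F y" using X by auto
    then obtain Y where Y: "\<And>n. Y n \<in> carrier K" "\<And>n. X n = F (Y n)" by metis
    have "\<exists>l\<in>carrier K. (\<lambda>n. hnorm K (Y n \<ominus>\<^bsub>K\<^esub> l)) \<longlonglongrightarrow> 0"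
      by (rule K.complete) (use Y cau minus in auto)
    then show "\<exists>l\<in>carrier ?L. (\<lambda>n. hnorm ?L (X n \<ominus>\<^bsub>?L\<^esub> l)) \<longlonglongrightarrow> 0"
      using Y minus by auto
  qed (auto simp: K.cinner_add_left K.cinner_smult_left pos intro: K.cinner_commute)
qed

lemma bounded_operator_transport:
  assumes B: "bounded_operator K B"
  shows "bounded_operator (transport F K) (\<lambda>x. F (B (inv_into (carrier K) F x)))"
proof -
  obtain C where C: "\<And>x. x \<in> carrier K \<Longrightarrow> hnorm K (B x) \<le> C * hnorm K x"
    using B by (auto simp: bounded_operator_def)
  have lin: "clinear_map K K B" using B by (auto simp: bounded_operator_def)
  have BK: "x \<in> carrier K \<Longrightarrow> B x \<in> carrier K" for x using lin by (auto simp: clinear_map_def)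
  show ?thesis
    unfolding bounded_operator_def
  proof
    show "clinear_map (transport F K) (transport F K) (\<lambda>x. F (B (inv_into (carrier K) F x)))"
      using lin inj BK by (auto simp: clinear_map_def transport_simps)
    show "\<exists>C. \<forall>x\<in>carrier (transport F K).
            hnorm (transport F K) (F (B (inv_into (carrier K) F x))) \<le> C * hnorm (transport F K) x"
      using C inj BK by (auto simp: transport_simps)
  qed
qed

lemma normal_extension_transport:
  assumes ext: "normal_extension H T K N J"
  shows "normal_extension H T (transport F K) (\<lambda>x. F (N (inv_into (carrier K) F x))) (\<lambda>h. F (J h))"
proof -
  from ext have N: "bounded_operator K N"
    and J: "clinear_map H K J" "\<And>x y. \<lbrakk>x \<in> carrier H; y \<in> carrier H\<rbrakk> \<Longrightarrow> cinner K (J x) (J y) = cinner H x y"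
    and NJ: "\<And>x. x \<in> carrier H \<Longrightarrow> N (J x) = J (T x)"
    by (auto simp: normal_extension_def normal_operator_def isometric_embedding_def)
  from ext obtain N' where N': "bounded_operator K N'" "adjoint_pair K N N'"
      "\<And>x. x \<in> carrier K \<Longrightarrow> N (N' x) = N' (N x)"
    by (auto simp: normal_extension_def normal_operator_def)
  have in1: "x \<in> carrier K \<Longrightarrow> N x \<in> carrier K" and in2: "x \<in> carrier K \<Longrightarrow> N' x \<in> carrier K" for x
    using N N' by (auto simp: bounded_operator_def clinear_map_def)
  have in3: "x \<in> carrier H \<Longrightarrow> J x \<in> carrier K" for x using J by (auto simp: clinear_map_def)
  let ?N' = "\<lambda>x. F (N' (inv_into (carrier K) F x))"
  have "normal_operator (transport F K) (\<lambda>x. F (N (inv_into (carrier K) F x)))"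
    unfolding normal_operator_def
  proof (intro conjI exI[of _ ?N'] bounded_operator_transport N N'(1))
    show "adjoint_pair (transport F K) (\<lambda>x. F (N (inv_into (carrier K) F x))) ?N'"
      using N'(2) inj in1 in2 by (auto simp: adjoint_pair_def transport_simps)
  qed (use N'(3) inj in1 in2 in \<open>auto simp: transport_simps\<close>)
  moreover have "isometric_embedding H (transport F K) (\<lambda>h. F (J h))"
    using J in3 by (auto simp: isometric_embedding_def clinear_map_def transport_simps)
  ultimately show ?thesis
    using hilbert_transport NJ in3 inj by (auto simp: normal_extension_def)
qed

end

lemma normal_extension_reducing:
  assumes ext: "normal_extension H T K N J"
    and L: "complex_hilbert_space (K\<lparr>carrier := S\<rparr>)" and sub: "S \<subseteq> carrier K"
    and NS: "\<And>x. x \<in> S \<Longrightarrow> N x \<in> S"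
    and adj: "bounded_operator K N'" "adjoint_pair K N N'"
      "\<And>x. x \<in> carrier K \<Longrightarrow> N (N' x) = N' (N x)" "\<And>x. x \<in> S \<Longrightarrow> N' x \<in> S"
    and JS: "\<And>x. x \<in> carrier H \<Longrightarrow> J x \<in> S"
  shows "normal_extension H T (K\<lparr>carrier := S\<rparr>) N J"
proof -
  let ?L = "K\<lparr>carrier := S\<rparr>"
  have bd: "bounded_operator ?L B" if B: "bounded_operator K B" and BS: "\<And>x. x \<in> S \<Longrightarrow> B x \<in> S" for B
  proof -
    obtain C where "\<And>x. x \<in> carrier K \<Longrightarrow> hnorm K (B x) \<le> C * hnorm K x"
      using B by (auto simp: bounded_operator_def)
    then have "\<forall>x\<in>S. hnorm ?L (B x) \<le> C * hnorm ?L x" using sub by (auto simp: hnorm_def)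
    moreover have "clinear_map ?L ?L B"
      using B BS sub by (auto simp: bounded_operator_def clinear_map_def subset_iff)
    ultimately show ?thesis by (auto simp: bounded_operator_def)
  qed
  have N: "bounded_operator K N"
    using ext by (auto simp: normal_extension_def normal_operator_def)
  have "adjoint_pair ?L N N'"
    using adj(2) sub by (auto simp: adjoint_pair_def subset_iff)
  then have "normal_operator ?L N"
    unfolding normal_operator_def using bd[OF N NS] bd[OF adj(1,4)] adj(3) sub by auto
  moreover have "isometric_embedding H ?L J"
    using ext JS by (auto simp: normal_extension_def isometric_embedding_def clinear_map_def)
  ultimately show ?thesis using L ext by (auto simp: normal_extension_def)
qed

lemma subnormalI:
  fixes K :: "'k inner_space" and H :: "'h inner_space"
  assumes T: "bounded_operator H T" and ext: "normal_extension H T K N J"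
  shows "subnormal H T"
proof -
  from ext have K: "complex_hilbert_space K" and N: "bounded_operator K N"
    and J: "\<And>x. x \<in> carrier H \<Longrightarrow> J x \<in> carrier K"
    and NJ: "\<And>x. x \<in> carrier H \<Longrightarrow> N (J x) = J (T x)"
    by (auto simp: normal_extension_def normal_operator_def isometric_embedding_def clinear_map_def)
  from ext obtain N' where N': "bounded_operator K N'" and adj: "adjoint_pair K N N'"
      and comm: "\<And>x. x \<in> carrier K \<Longrightarrow> N (N' x) = N' (N x)"
    by (auto simp: normal_extension_def normal_operator_def)
  interpret K: complex_hilbert_space K by (rule K)
  have NK: "x \<in> carrier K \<Longrightarrow> N x \<in> carrier K" and N'K: "x \<in> carrier K \<Longrightarrow> N' x \<in> carrier K" for x
    using N N' by (auto simp: bounded_operator_def clinear_map_def)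
  have TH: "x \<in> carrier H \<Longrightarrow> T x \<in> carrier H" for x
    using T by (auto simp: bounded_operator_def clinear_map_def)
  have pow: "x \<in> carrier K \<Longrightarrow> (N ^^ n) x \<in> carrier K" for n x
    by (induction n) (auto intro: NK)
  have pow_comm: "x \<in> carrier K \<Longrightarrow> (N ^^ n) (N' x) = N' ((N ^^ n) x)" for n x
    by (induction n) (auto simp: comm pow)
  have adj1: "cinner K (N x) y = cinner K x (N' y)" if "x \<in> carrier K" "y \<in> carrier K" for x y
    using adj that by (auto simp: adjoint_pair_def)
  have adj2: "cinner K (N' x) y = cinner K x (N y)" if "x \<in> carrier K" "y \<in> carrier K" for x y
    using adj1[OF that(2,1)] that NK N'K K.cinner_commute by metis
  have N_add: "\<And>x y. \<lbrakk>x \<in> carrier K; y \<in> carrier K\<rbrakk> \<Longrightarrow> N (x \<oplus>\<^bsub>K\<^esub> y) = N x \<oplus>\<^bsub>K\<^esub> N y"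
    and N_smult: "\<And>c x. x \<in> carrier K \<Longrightarrow> N (c \<odot>\<^bsub>K\<^esub> x) = c \<odot>\<^bsub>K\<^esub> N x"
    using N unfolding bounded_operator_def clinear_map_def by blast+
  have pow_add: "(N ^^ n) (x \<oplus>\<^bsub>K\<^esub> y) = (N ^^ n) x \<oplus>\<^bsub>K\<^esub> (N ^^ n) y"
    if "x \<in> carrier K" "y \<in> carrier K" for n x y
    by (induction n) (use that in \<open>simp_all add: N_add pow\<close>)
  have pow_smult: "(N ^^ n) (c \<odot>\<^bsub>K\<^esub> x) = c \<odot>\<^bsub>K\<^esub> (N ^^ n) x" if "x \<in> carrier K" for n c x
    by (induction n) (use that in \<open>simp_all add: N_smult pow\<close>)
  have pow_minus: "(N ^^ n) (x \<ominus>\<^bsub>K\<^esub> y) = (N ^^ n) x \<ominus>\<^bsub>K\<^esub> (N ^^ n) y"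
    if "x \<in> carrier K" "y \<in> carrier K" for n x y
    using that by (simp add: K.minus_as_smult pow pow_add pow_smult)

  define Z where "Z = {z \<in> carrier K. \<forall>n. \<forall>h\<in>carrier H. cinner K ((N ^^ n) z) (J h) = 0}"
  define S where "S = {x \<in> carrier K. \<forall>z\<in>Z. cinner K x z = 0}"
  have ZK: "z \<in> Z \<Longrightarrow> z \<in> carrier K" and SK: "z \<in> S \<Longrightarrow> z \<in> carrier K" for z
    by (auto simp: Z_def S_def)
  have ZN: "N z \<in> Z" if "z \<in> Z" for z
    using that NK by (auto simp: Z_def simp del: funpow.simps simp flip: funpow_Suc_right[THEN fun_cong, unfolded o_def])
  have ZN': "N' z \<in> Z" if "z \<in> Z" for z
    using that N'K by (auto simp: Z_def pow_comm adj2 pow J NJ TH)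
  have SN: "N x \<in> S" if "x \<in> S" for x
    using that NK ZN' ZK by (auto simp: S_def adj1)
  have SN': "N' x \<in> S" if "x \<in> S" for x
    using that N'K ZN ZK by (auto simp: S_def adj2)
  have SJ: "J h \<in> S" if h: "h \<in> carrier H" for h
  proof -
    have "cinner K (J h) z = 0" if z: "z \<in> Z" for z
    proof -
      have "cinner K ((N ^^ 0) z) (J h) = 0" using z h unfolding Z_def by blast
      then show ?thesis using K.cinner_commute[of z "J h"] z ZK J h by simp
    qed
    then show ?thesis using J h by (auto simp: S_def)
  qed
  have S_closed: "l \<in> S"
    if X: "\<And>n::nat. X n \<in> S" and l: "l \<in> carrier K" "(\<lambda>n. hnorm K (X n \<ominus>\<^bsub>K\<^esub> l)) \<longlonglongrightarrow> 0" for X l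
  proof -
    have "cinner K l z = 0" if z: "z \<in> Z" for z
    proof -
      have le: "cmod (cinner K l z) \<le> hnorm K (X n \<ominus>\<^bsub>K\<^esub> l) * hnorm K z" for n
      proof -
        have Xn: "X n \<in> carrier K" "cinner K (X n) z = 0"
          using X[of n] z by (auto simp: S_def)
        have "cinner K (X n \<ominus>\<^bsub>K\<^esub> l) z = - cinner K l z"
          using K.cinner_minus_left[OF Xn(1) l(1) ZK[OF z]] Xn(2) by simp
        then show ?thesis
          using K.cauchy_schwarz[OF K.M.minus_closed[OF Xn(1) l(1)] ZK[OF z]] by simp
      qed
      have "(\<lambda>n. hnorm K (X n \<ominus>\<^bsub>K\<^esub> l) * hnorm K z) \<longlonglongrightarrow> 0"
        using tendsto_mult_right[OF l(2), of "hnorm K z"] by simp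
      then have "cmod (cinner K l z) \<le> 0"
        by (rule LIMSEQ_le_const) (use le in blast)
      then show ?thesis by simp
    qed
    then show ?thesis using l by (auto simp: S_def)
  qed
  have L: "complex_hilbert_space (K\<lparr>carrier := S\<rparr>)"
  proof (rule hilbert_subspace[OF K])
    show "\<zero>\<^bsub>K\<^esub> \<in> S" by (auto simp: S_def K.cinner_zero_left ZK)
  qed (fact S_closed | force simp: S_def ZK K.cinner_add_left K.cinner_smult_left)+
  have ext': "normal_extension H T (K\<lparr>carrier := S\<rparr>) N J"
    by (rule normal_extension_reducing[OF ext L _ SN N' adj comm SN' SJ]) (auto simp: SK)

  define F where "F x = (\<lambda>n h. if h \<in> carrier H then cinner K ((N ^^ n) x) (J h) else 0)" for x
  have "inj_on F S"
  proof (rule inj_onI)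
    fix x y assume x: "x \<in> S" and y: "y \<in> S" and eq: "F x = F y"
    let ?d = "x \<ominus>\<^bsub>K\<^esub> y"
    have "cinner K ((N ^^ n) x) (J h) = cinner K ((N ^^ n) y) (J h)" if "h \<in> carrier H" for n h
      using fun_cong[OF fun_cong[OF eq, of n], of h] that by (simp add: F_def)
    then have "?d \<in> Z"
      using x y SK pow J by (auto simp: Z_def pow_minus K.cinner_minus_left)
    moreover have "?d \<in> S"
      using x y ZK by (auto simp: S_def K.cinner_minus_left)
    ultimately have "cinner K ?d ?d = 0" by (auto simp: S_def)
    then have "?d = \<zero>\<^bsub>K\<^esub>" using K.cinner_pos[of ?d] x y SK by fastforce
    then show "x = y" using K.minus_add_cancel[of x y] x y SK by simp
  qed
  then have "normal_extension H T (transport F (K\<lparr>carrier := S\<rparr>))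
      (\<lambda>x. F (N (inv_into S F x))) (\<lambda>h. F (J h))"
    using normal_extension_transport[OF L _ ext', of F] by simp
  then show ?thesis using T unfolding subnormal_def by blast
qed

end

theory Submission
  imports Defs "HOL-Analysis.Elementary_Normed_Spaces" "HOL-Library.FuncSet"
begin

text \<open>
  No spectral measures are needed; one works with normal extensions directly.

  (a) to (b): let \<open>N\<close> be a normal extension of \<open>S\<^sub>\<lambda>\<close> and let \<open>v\<close> have depth \<open>k\<close>. The vectors \<open>N*\<^sup>i f\<close>, where
  \<open>f\<close> in \<open>\<ell>\<^sup>2(Des v)\<close> is supported on one level of the tree, span a graded reducing subspace. It is
  orthogonal to everything generated by a branch that does not meet \<open>Des v\<close>. Hence the
  projections \<open>x\<^sub>i\<close> of the basis vectors at \<open>p\<^sup>i v\<close> satisfy \<open>N x\<^sub>i\<^sub>+\<^sub>1 = \<lambda> x\<^sub>i\<close>, with the weight \<open>\<lambda>\<close> at \<open>p\<^sup>i v\<close>, and they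
  are mutually orthogonal because their degrees differ. So \<open>N\<close> also extends a \<open>k\<close>-step backward
  extension of the branch at \<open>v\<close>.

  (b) to (a): on the subspace of all \<open>x\<close> with \<open>\<parallel>N\<^sup>n x\<parallel> = O(M\<^sup>n)\<close> a normal operator \<open>N\<close> is bounded by \<open>M\<close>, so
  the normal extensions of all backward extensions can be taken uniformly bounded. Their direct
  sum extends the shift on the whole tree once each vertex of depth less than \<open>k\<close> is represented
  by a suitable combination of the new vertices of all branches through it.
\<close>

section \<open>Complex Hilbert spaces\<close>

text \<open>A normal extension comes with no decomposition by depth: \<open>K\<close> may be larger
  than what \<open>ell2 V\<close> generates. Degrees exist nevertheless. By normality the inner
  product of \<open>N'^i (J f)\<close> and \<open>N'^j (J g)\<close> equals that of
  \<open>N^j (J f)\<close> and \<open>N^i (J g)\<close>, and for \<open>f\<close>, \<open>g\<close>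
  on single levels this vanishes unless level minus number of adjoint steps agrees. In the reducing
  subspace of a branch the degree may thus fall below the depth \<open>k\<close> of its top, and
  there the new vectors are found, in place of negative powers of \<open>N\<close>. Projection is
  needed because \<open>N\<close> sends the basis vector at an ancestor to all its children at once;
  the siblings are orthogonal to the relevant piece and drop out.

  In the converse the branches carry unrelated new weights, so the new vectors over a common
  ancestor must be combined. The positive scalars \<beta> are free: they only have to make all sums
  converge, which is where countability enters. The given norms control the branches alone; the new
  vertices inherit the growth rate since at most \<open>k\<close> applications of \<open>N\<close>
  lead from them into the branch.\<close>

context complex_hilbert_space begin

lemma cinner_minus_right:
  "\<lbrakk>x \<in> carrier H; y \<in> carrier H; z \<in> carrier H\<rbrakk>
    \<Longrightarrow> cinner H z (x \<ominus> y) = cinner H z x - cinner H z y"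
  by (metis cinner_minus_left cinner_commute complex_cnj_diff M.minus_closed)

lemma cinner_zero_right: "x \<in> carrier H \<Longrightarrow> cinner H x \<zero> = 0"
  using cinner_commute[of \<zero> x] cinner_zero_left[of x] by simp

lemmas cinner_simps = cinner_add_left cinner_add_right cinner_minus_left cinner_minus_right
  cinner_smult_left cinner_smult_right cinner_zero_left cinner_zero_right

lemma hnorm_nonneg: "x \<in> carrier H \<Longrightarrow> 0 \<le> hnorm H x"
  by (simp add: hnorm_def cinner_nonneg)

lemma hnorm_square: "x \<in> carrier H \<Longrightarrow> (hnorm H x)\<^sup>2 = Re (cinner H x x)"
  by (simp add: hnorm_def cinner_nonneg)

lemma cinner_self: "x \<in> carrier H \<Longrightarrow> cinner H x x = of_real ((hnorm H x)\<^sup>2)"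
  by (simp only: hnorm_square) (rule cinner_eq_Re)

lemma hnorm_zero: "hnorm H \<zero> = 0"
  by (simp add: hnorm_def cinner_zero_left)

lemma hnorm_pos: "x \<in> carrier H \<Longrightarrow> x \<noteq> \<zero> \<Longrightarrow> 0 < hnorm H x"
  using cinner_pos[of x] by (auto simp: hnorm_def)

lemma hnorm_eq_0_iff: "x \<in> carrier H \<Longrightarrow> hnorm H x = 0 \<longleftrightarrow> x = \<zero>"
  using hnorm_zero hnorm_pos by fastforce

lemma minus_eq_zero_iff: "\<lbrakk>x \<in> carrier H; y \<in> carrier H\<rbrakk> \<Longrightarrow> x \<ominus> y = \<zero> \<longleftrightarrow> x = y"
  by (metis M.l_zero minus_add_cancel M.r_neg a_minus_def)

text \<open>Testing against an arbitrary \<open>z\<close> turns a vector identity into one between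
  complex numbers, which \<open>cinner_simps\<close> settles. Most vector identities below are
  checked in this way.\<close>

lemma eqI_inner:
  assumes x: "x \<in> carrier H" and y: "y \<in> carrier H"
    and eq: "\<And>z. z \<in> carrier H \<Longrightarrow> cinner H x z = cinner H y z"
  shows "x = y"
proof -
  have "cinner H (x \<ominus> y) (x \<ominus> y) = 0"
    using x y eq[of "x \<ominus> y"] by (simp add: cinner_minus_left)
  then have "hnorm H (x \<ominus> y) = 0" by (simp add: hnorm_def)
  then show ?thesis using x y by (simp add: hnorm_eq_0_iff minus_eq_zero_iff)
qed

lemma hnorm_smult: "x \<in> carrier H \<Longrightarrow> hnorm H (c \<odot> x) = cmod c * hnorm H x"
proof -
  assume x: "x \<in> carrier H"
  have "cinner H (c \<odot> x) (c \<odot> x) = (c * cnj c) * cinner H x x"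
    using x by (simp add: cinner_simps)
  also have "\<dots> = of_real ((cmod c)\<^sup>2 * (hnorm H x)\<^sup>2)"
    using x by (simp add: cinner_self flip: complex_norm_square)
  finally show ?thesis
    using x by (simp add: hnorm_def[of H "c \<odot> x"] real_sqrt_mult hnorm_nonneg)
qed

lemma hnorm_triangle:
  assumes x: "x \<in> carrier H" and y: "y \<in> carrier H"
  shows "hnorm H (x \<oplus> y) \<le> hnorm H x + hnorm H y"
proof (rule power2_le_imp_le)
  have "Re (cinner H x y) \<le> hnorm H x * hnorm H y"
    using cauchy_schwarz[OF x y] complex_Re_le_cmod order_trans by blast
  moreover have "Re (cinner H y x) = Re (cinner H x y)"
    using cinner_commute[OF x y] by simp
  ultimately show "(hnorm H (x \<oplus> y))\<^sup>2 \<le> (hnorm H x + hnorm H y)\<^sup>2"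
    using x y by (simp add: hnorm_square cinner_simps power2_sum)
  show "0 \<le> hnorm H x + hnorm H y" using x y by (simp add: hnorm_nonneg)
qed

lemma hnorm_minus_commute:
  "\<lbrakk>x \<in> carrier H; y \<in> carrier H\<rbrakk> \<Longrightarrow> hnorm H (x \<ominus> y) = hnorm H (y \<ominus> x)"
  by (simp add: hnorm_def cinner_simps)

lemma hnorm_triangle_minus:
  assumes "x \<in> carrier H" "y \<in> carrier H" "z \<in> carrier H"
  shows "hnorm H (x \<ominus> z) \<le> hnorm H (x \<ominus> y) + hnorm H (y \<ominus> z)"
proof -
  have "x \<ominus> z = (x \<ominus> y) \<oplus> (y \<ominus> z)"
    by (rule eqI_inner) (use assms in \<open>auto simp: cinner_simps\<close>)
  then show ?thesis using assms by (simp add: hnorm_triangle)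
qed

lemma hnorm_le_minus:
  assumes "x \<in> carrier H" "y \<in> carrier H"
  shows "hnorm H x \<le> hnorm H (x \<ominus> y) + hnorm H y"
  using hnorm_triangle[of "x \<ominus> y" y] assms by (simp add: minus_add_cancel)

lemma tendsto_cinner_left:
  assumes X: "\<And>n. X n \<in> carrier H" and l: "l \<in> carrier H"
    and lim: "(\<lambda>n. hnorm H (X n \<ominus> l)) \<longlonglongrightarrow> 0" and y: "y \<in> carrier H"
  shows "(\<lambda>n. cinner H (X n) y) \<longlonglongrightarrow> cinner H l y"
proof -
  have "(\<lambda>n. hnorm H (X n \<ominus> l) * hnorm H y) \<longlonglongrightarrow> 0"
    using tendsto_mult_left_zero[OF lim] .
  then have "(\<lambda>n. cinner H (X n) y - cinner H l y) \<longlonglongrightarrow> 0"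
    by (rule Lim_null_comparison[rotated])
       (use X l y cauchy_schwarz[of "X _ \<ominus> l" y] in \<open>auto simp: cinner_minus_left\<close>)
  then show ?thesis by (simp add: LIM_zero_iff)
qed

lemma cinner_minus_smult:
  assumes "a \<in> carrier H" "y \<in> carrier H"
  shows "cinner H (a \<ominus> t \<odot> y) (a \<ominus> t \<odot> y) =
    cinner H a a - cnj t * cinner H a y - t * cinner H y a + t * cnj t * cinner H y y"
  using assms by (simp add: cinner_simps algebra_simps)

definition orthocomp :: "'h set \<Rightarrow> 'h set" where
  "orthocomp G = {z \<in> carrier H. \<forall>g\<in>G. cinner H z g = 0}"

text \<open>The component in \<open>orthocomp G\<close> is the point of this subspace closest to \<open>x\<close>.\<close>

lemma orthogonal_decomposition:
  assumes G: "G \<subseteq> carrier H" and x: "x \<in> carrier H"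
  shows "\<exists>z\<in>orthocomp G. \<exists>m\<in>orthocomp (orthocomp G). x = z \<oplus> m"
proof -
  define Z where "Z = orthocomp G"
  have ZH: "z \<in> carrier H" if "z \<in> Z" for z using that by (simp add: Z_def orthocomp_def)
  have Z0: "\<zero> \<in> Z" using G by (auto simp: Z_def orthocomp_def cinner_zero_left)
  have Zadd: "u \<oplus> c \<odot> v \<in> Z" if "u \<in> Z" "v \<in> Z" for u v c
    using that G by (auto simp: Z_def orthocomp_def cinner_simps subset_iff)
  define D where "D = (\<lambda>y. (hnorm H (x \<ominus> y))\<^sup>2) ` Z"
  define d where "d = Inf D"
  have bdd: "bdd_below D" unfolding D_def by (rule bdd_belowI2[where m=0]) simp
  have d_le: "d \<le> (hnorm H (x \<ominus> y))\<^sup>2" if "y \<in> Z" for y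
    unfolding d_def by (rule cInf_lower) (use that bdd in \<open>auto simp: D_def\<close>)
  have ex: "\<exists>y\<in>Z. (hnorm H (x \<ominus> y))\<^sup>2 < d + 1 / (real n + 1)" for n
  proof -
    have "\<exists>a\<in>D. a < d + 1 / (real n + 1)"
      unfolding d_def using Z0 bdd cInf_less_iff[of D "Inf D + 1 / (real n + 1)"] by (auto simp: D_def)
    then show ?thesis by (auto simp: D_def)
  qed
  then obtain Y where Y: "\<And>n. Y n \<in> Z" "\<And>n. (hnorm H (x \<ominus> Y n))\<^sup>2 < d + 1 / (real n + 1)"
    by metis
  have diff: "(hnorm H (Y m \<ominus> Y n))\<^sup>2 \<le> 2 * (1 / (real m + 1)) + 2 * (1 / (real n + 1))" for m n
  proof -
    let ?w = "(1/2) \<odot> Y m \<oplus> (1/2) \<odot> Y n"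
    have "\<zero> \<oplus> (1/2) \<odot> Y m = (1/2) \<odot> Y m" using ZH[OF Y(1)] by simp
    then have w: "?w \<in> Z" using Zadd[OF Zadd[OF Z0 Y(1)] Y(1), of "1/2" m "1/2" n] by simp
    \<comment> \<open>Parallelogram law for \<open>x \<ominus> Y m\<close> and
      \<open>x \<ominus> Y n\<close>. Their midpoint is \<open>x \<ominus> ?w\<close> with
      \<open>?w\<close> in \<open>Z\<close>, so its squared norm is at least \<open>d\<close>, and
      only the excesses over \<open>d\<close> remain.\<close>
    have "(hnorm H (Y m \<ominus> Y n))\<^sup>2 = 2 * (hnorm H (x \<ominus> Y m))\<^sup>2 + 2 * (hnorm H (x \<ominus> Y n))\<^sup>2
        - 4 * (hnorm H (x \<ominus> ?w))\<^sup>2"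
      using x ZH[OF Y(1)] ZH[OF w] cinner_commute[of x "Y m"] cinner_commute[of x "Y n"]
      by (simp add: hnorm_square cinner_simps algebra_simps)
    then show ?thesis using d_le[OF w] Y(2)[of m] Y(2)[of n] by linarith
  qed
  have "\<exists>l\<in>carrier H. (\<lambda>n. hnorm H (Y n \<ominus> l)) \<longlonglongrightarrow> 0"
  proof (rule complete)
    show "Y n \<in> carrier H" for n using Y(1) ZH by blast
    fix e :: real assume e: "0 < e"
    obtain M where M: "1 / (real M + 1) < e\<^sup>2 / 4"
      using reals_Archimedean[of "e\<^sup>2 / 4"] e by (auto simp: field_simps)
    have "hnorm H (Y m \<ominus> Y n) < e" if "m \<ge> M" "n \<ge> M" for m n
    proof -
      have "1 / (real m + 1) \<le> 1 / (real M + 1)" "1 / (real n + 1) \<le> 1 / (real M + 1)"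
        using that by (auto simp: frac_le)
      then have "(hnorm H (Y m \<ominus> Y n))\<^sup>2 < e\<^sup>2" using diff[of m n] M by linarith
      then show ?thesis using e power2_less_imp_less by fastforce
    qed
    then show "\<exists>M. \<forall>m\<ge>M. \<forall>n\<ge>M. hnorm H (Y m \<ominus> Y n) < e" by blast
  qed
  then obtain z where z: "z \<in> carrier H" "(\<lambda>n. hnorm H (Y n \<ominus> z)) \<longlonglongrightarrow> 0" by auto
  have zZ: "z \<in> Z"
  proof -
    have "cinner H z g = 0" if "g \<in> G" for g
    proof -
      have "(\<lambda>n. cinner H (Y n) g) \<longlonglongrightarrow> cinner H z g"
        by (rule tendsto_cinner_left) (use Y(1) ZH z that G in auto)
      moreover have "cinner H (Y n) g = 0" for n using Y(1)[of n] that by (simp add: Z_def orthocomp_def)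
      ultimately show ?thesis by (simp add: LIMSEQ_const_iff)
    qed
    then show ?thesis using z by (simp add: Z_def orthocomp_def)
  qed
  have zd: "(hnorm H (x \<ominus> z))\<^sup>2 \<le> d"
  proof -
    have "hnorm H (x \<ominus> z) \<le> sqrt (d + 1 / (real n + 1)) + hnorm H (Y n \<ominus> z)" for n
    proof -
      have "hnorm H (x \<ominus> Y n) \<le> sqrt (d + 1 / (real n + 1))"
        using Y(2)[of n] by (intro real_le_rsqrt) simp
      then show ?thesis
        using hnorm_triangle_minus[of x "Y n" z] x z ZH[OF Y(1)] by fastforce
    qed
    moreover have "(\<lambda>n. sqrt (d + 1 / (real n + 1)) + hnorm H (Y n \<ominus> z)) \<longlonglongrightarrow> sqrt (d + 0) + 0"
    proof (intro tendsto_intros z(2))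
      show "(\<lambda>n. 1 / (real n + 1)) \<longlonglongrightarrow> 0"
        using LIMSEQ_inverse_real_of_nat by (simp add: inverse_eq_divide add.commute)
    qed
    ultimately have "hnorm H (x \<ominus> z) \<le> sqrt (d + 0) + 0"
      by (intro LIMSEQ_le_const) auto
    then have "hnorm H (x \<ominus> z) \<le> sqrt d" by simp
    moreover have "0 \<le> d" unfolding d_def by (rule cInf_greatest) (use Z0 in \<open>auto simp: D_def\<close>)
    ultimately show ?thesis
      using hnorm_nonneg[of "x \<ominus> z"] x z power_mono[of "hnorm H (x \<ominus> z)" "sqrt d" 2] by simp
  qed
  have orth: "cinner H (x \<ominus> z) y = 0" if y: "y \<in> Z" for y
  proof (cases "y = \<zero>")
    case True then show ?thesis using x z by (simp add: cinner_zero_right)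
  next
    case False
    define c where "c = cinner H (x \<ominus> z) y"
    define b where "b = (hnorm H y)\<^sup>2"
    have b: "b > 0" using hnorm_pos[OF ZH[OF y] False] by (simp add: b_def)
    have yH: "y \<in> carrier H" using y ZH by blast
    \<comment> \<open>Moving \<open>z\<close> along \<open>y\<close> by the coefficient of the
      projection of \<open>x \<ominus> z\<close> lowers the squared distance by |c|^2 / b, which
      minimality of \<open>z\<close> forbids unless \<open>c = 0\<close>.\<close>
    let ?u = "z \<oplus> (c / of_real b) \<odot> y"
    have u: "?u \<in> Z" by (rule Zadd[OF zZ y])
    have yx: "cinner H y (x \<ominus> z) = cnj c" unfolding c_def by (rule cinner_commute) (use x z yH in auto)
    have eq: "x \<ominus> ?u = (x \<ominus> z) \<ominus> (c / of_real b) \<odot> y"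
      by (rule eqI_inner) (use x z yH in \<open>auto simp: cinner_simps\<close>)
    have "cinner H (x \<ominus> ?u) (x \<ominus> ?u) = cinner H (x \<ominus> z) (x \<ominus> z)
        - cnj (c / of_real b) * c - (c / of_real b) * cnj c
        + (c / of_real b) * cnj (c / of_real b) * of_real b"
      unfolding eq using x z yH
      by (subst cinner_minus_smult) (auto simp: yx b_def cinner_self simp flip: c_def)
    also have "\<dots> = cinner H (x \<ominus> z) (x \<ominus> z) - of_real ((cmod c)\<^sup>2 / b)"
      using b by (simp add: field_simps flip: complex_norm_square)
    finally have "(hnorm H (x \<ominus> ?u))\<^sup>2 = (hnorm H (x \<ominus> z))\<^sup>2 - (cmod c)\<^sup>2 / b"
      using x z ZH[OF u] by (simp add: hnorm_square)
    then have "(cmod c)\<^sup>2 / b \<le> 0" using d_le[OF u] zd by linarith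
    then show ?thesis using b c_def by (simp add: divide_le_0_iff)
  qed
  have "x \<ominus> z \<in> orthocomp (orthocomp G)"
    using orth x z by (simp add: orthocomp_def Z_def[unfolded orthocomp_def, symmetric])
  moreover have "x = z \<oplus> (x \<ominus> z)"
    by (rule eqI_inner) (use x z in \<open>auto simp: cinner_simps\<close>)
  ultimately show ?thesis using zZ unfolding Z_def by blast
qed

end

section \<open>Normal operators\<close>

lemma clinear_mapD:
  assumes "clinear_map H K T"
  shows "x \<in> carrier H \<Longrightarrow> T x \<in> carrier K"
    and "x \<in> carrier H \<Longrightarrow> y \<in> carrier H \<Longrightarrow> T (x \<oplus>\<^bsub>H\<^esub> y) = T x \<oplus>\<^bsub>K\<^esub> T y"
    and "x \<in> carrier H \<Longrightarrow> T (c \<odot>\<^bsub>H\<^esub> x) = c \<odot>\<^bsub>K\<^esub> T x"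
  using assms by (auto simp: clinear_map_def)

text \<open>Log-convexity makes the ratios of consecutive terms nondecreasing. If the first ratio
  \<open>r\<close> exceeded \<open>M\<close>, then \<open>a n\<close> would be at least
  \<open>a 0 * r ^ n\<close> and outgrow \<open>C * M ^ n\<close>.\<close>

lemma log_convex_growth:
  fixes a :: "nat \<Rightarrow> real"
  assumes nonneg: "\<And>n. 0 \<le> a n" and conv: "\<And>n. (a (Suc n))\<^sup>2 \<le> a n * a (Suc (Suc n))"
    and le: "\<And>n. a n \<le> C * M ^ n" and M: "0 < M"
  shows "a 1 \<le> M * a 0"
proof (rule ccontr)
  assume "\<not> ?thesis"
  then have gt: "a 1 > M * a 0" by simp
  have a0: "a 0 > 0"
  proof (rule ccontr)
    assume "\<not> 0 < a 0"
    then have "a 0 = 0" using nonneg[of 0] by simp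
    then have "a 1 = 0" using conv[of 0] by simp
    then show False using gt \<open>a 0 = 0\<close> by simp
  qed
  define r where "r = a 1 / a 0"
  have r: "r > M" using gt a0 by (simp add: r_def field_simps)
  have step: "a n > 0 \<and> a (Suc n) \<ge> r * a n" for n
  proof (induction n)
    case 0 show ?case using a0 by (simp add: r_def)
  next
    case (Suc n)
    have pos: "a (Suc n) > 0" using Suc r M by (smt (verit) mult_pos_pos)
    have "a n * (r * a (Suc n)) \<le> a (Suc n) * a (Suc n)"
      using Suc pos by (simp add: mult.left_commute mult.commute[of r] mult_right_mono)
    also have "\<dots> \<le> a n * a (Suc (Suc n))" using conv[of n] by (simp add: power2_eq_square)
    finally have "r * a (Suc n) \<le> a (Suc (Suc n))" using Suc by simp
    then show ?case using pos by simp
  qed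
  have ge: "a n \<ge> a 0 * r ^ n" for n
  proof (induction n)
    case (Suc n)
    have "a 0 * r ^ Suc n \<le> r * a n" using Suc r M by (simp add: mult.left_commute)
    then show ?case using step[of n] by linarith
  qed simp
  have bd: "(r / M) ^ n \<le> C / a 0" for n
  proof -
    have "a 0 * r ^ n \<le> C * M ^ n" using ge[of n] le[of n] by linarith
    then show ?thesis using a0 M by (simp add: field_simps power_divide)
  qed
  obtain n where "C / a 0 < (r / M) ^ n" using real_arch_pow[of "r / M" "C / a 0"] r M by auto
  then show False using bd[of n] by simp
qed

text \<open>\<open>normal_operator\<close> hides the adjoint behind an existential; a named witness
  \<open>N'\<close> lets adjointness and commutation serve as rewrite rules.\<close>

locale normal_pair = complex_hilbert_space K for K :: "'k inner_space" (structure) +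
  fixes N N' :: "'k \<Rightarrow> 'k"
  assumes bounded_N: "bounded_operator K N" and bounded_N': "bounded_operator K N'"
    and adjoint: "adjoint_pair K N N'"
    and commute: "x \<in> carrier K \<Longrightarrow> N (N' x) = N' (N x)"
begin

lemma linear_N: "clinear_map K K N" and linear_N': "clinear_map K K N'"
  using bounded_N bounded_N' by (auto simp: bounded_operator_def)

lemmas N_in [simp] = clinear_mapD(1)[OF linear_N]
lemmas N_add = clinear_mapD(2)[OF linear_N]
lemmas N_smult = clinear_mapD(3)[OF linear_N]
lemmas N'_in [simp] = clinear_mapD(1)[OF linear_N']

lemma pow_in [simp]: "x \<in> carrier K \<Longrightarrow> (N ^^ n) x \<in> carrier K"
  by (induction n) auto

lemma pow_add: "x \<in> carrier K \<Longrightarrow> y \<in> carrier K \<Longrightarrow> (N ^^ n) (x \<oplus> y) = (N ^^ n) x \<oplus> (N ^^ n) y"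
  by (induction n) (auto simp: N_add)

lemma pow_smult: "x \<in> carrier K \<Longrightarrow> (N ^^ n) (c \<odot> x) = c \<odot> (N ^^ n) x"
  by (induction n) (auto simp: N_smult)

lemma pow_minus: "x \<in> carrier K \<Longrightarrow> y \<in> carrier K \<Longrightarrow> (N ^^ n) (x \<ominus> y) = (N ^^ n) x \<ominus> (N ^^ n) y"
  by (simp add: minus_as_smult pow_add pow_smult)

lemma pow_zero: "(N ^^ n) \<zero> = \<zero>"
  using pow_minus[of \<zero> \<zero> n] minus_eq_zero_iff[of "(N ^^ n) \<zero>" "(N ^^ n) \<zero>"]
    minus_eq_zero_iff[of \<zero> \<zero>] by simp

lemma pow_commute: "x \<in> carrier K \<Longrightarrow> (N ^^ n) (N' x) = N' ((N ^^ n) x)"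
  by (induction n) (auto simp: commute)

lemma cinner_N: "x \<in> carrier K \<Longrightarrow> y \<in> carrier K \<Longrightarrow> cinner K (N x) y = cinner K x (N' y)"
  using adjoint by (auto simp: adjoint_pair_def)

lemma cinner_N': "x \<in> carrier K \<Longrightarrow> y \<in> carrier K \<Longrightarrow> cinner K (N' x) y = cinner K x (N y)"
  using cinner_N[of y x] cinner_commute[of "N y" x] cinner_commute[of y "N' x"] by simp

lemma hnorm_N': "x \<in> carrier K \<Longrightarrow> hnorm K (N' x) = hnorm K (N x)"
  by (simp add: hnorm_def cinner_N' cinner_N commute)

text \<open>The left side is the inner product of \<open>N' (N x)\<close> with \<open>x\<close>.
  Cauchy-Schwarz applies, and by normality \<open>N' (N x)\<close> has the same norm as
  \<open>N (N x)\<close>.\<close>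

lemma hnorm_log_convex:
  assumes x: "x \<in> carrier K"
  shows "(hnorm K (N x))\<^sup>2 \<le> hnorm K x * hnorm K (N (N x))"
proof -
  have "(hnorm K (N x))\<^sup>2 = Re (cinner K (N' (N x)) x)" using x by (simp add: hnorm_square cinner_N')
  also have "\<dots> \<le> hnorm K (N' (N x)) * hnorm K x"
    using x cauchy_schwarz[of "N' (N x)" x] complex_Re_le_cmod order_trans N_in N'_in by blast
  finally show ?thesis using x by (simp add: hnorm_N' mult.commute)
qed

lemma hnorm_pow_le: "\<exists>B\<ge>0. \<forall>x\<in>carrier K. hnorm K ((N ^^ n) x) \<le> B * hnorm K x"
proof (induction n)
  case 0 show ?case by (auto intro: exI[of _ 1])
next
  case (Suc n)
  then obtain B where B: "B \<ge> 0" "\<And>x. x \<in> carrier K \<Longrightarrow> hnorm K ((N ^^ n) x) \<le> B * hnorm K x" by blast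
  obtain D where D: "\<And>x. x \<in> carrier K \<Longrightarrow> hnorm K (N x) \<le> D * hnorm K x"
    using bounded_N by (auto simp: bounded_operator_def)
  have "hnorm K ((N ^^ Suc n) x) \<le> (\<bar>D\<bar> * B) * hnorm K x" if x: "x \<in> carrier K" for x
  proof -
    have "hnorm K ((N ^^ Suc n) x) \<le> D * hnorm K ((N ^^ n) x)" using x D[of "(N ^^ n) x"] by simp
    also have "\<dots> \<le> \<bar>D\<bar> * hnorm K ((N ^^ n) x)" using x hnorm_nonneg by (simp add: mult_right_mono)
    also have "\<dots> \<le> \<bar>D\<bar> * (B * hnorm K x)" using x B by (intro mult_left_mono) auto
    finally show ?thesis by (simp add: mult.assoc)
  qed
  then show ?case using B(1) by (intro exI[of _ "\<bar>D\<bar> * B"]) auto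
qed

text \<open>For \<open>M > 0\<close>, in the language of the spectral theorem, the range of the
  spectral projection of \<open>N\<close> for the closed disc of radius \<open>M\<close>, described
  by growth alone. The constant \<open>C\<close> may depend on \<open>x\<close>.\<close>

definition moderate :: "real \<Rightarrow> 'k set" where
  "moderate M = {x \<in> carrier K. \<exists>C. \<forall>n. hnorm K ((N ^^ n) x) \<le> C * M ^ n}"

text \<open>Shifting the exponent by one changes only the constant. The implication from
  \<open>N x\<close> to \<open>x\<close> matters most: a vector that some power of \<open>N\<close>
  sends into the subspace already lies there.\<close>

lemma moderate_N_iff:
  assumes M: "0 < M" and x: "x \<in> carrier K"
  shows "N x \<in> moderate M \<longleftrightarrow> x \<in> moderate M"
proof
  assume "x \<in> moderate M"
  then obtain C where C: "\<And>n. hnorm K ((N ^^ n) x) \<le> C * M ^ n" by (auto simp: moderate_def)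
  have "hnorm K ((N ^^ n) (N x)) \<le> (C * M) * M ^ n" for n
    using C[of "Suc n"] by (simp add: funpow_swap1 mult_ac)
  then show "N x \<in> moderate M" using x by (auto simp: moderate_def)
next
  assume "N x \<in> moderate M"
  then obtain C where C: "\<And>n. hnorm K ((N ^^ n) (N x)) \<le> C * M ^ n" by (auto simp: moderate_def)
  \<comment> \<open>The first summand serves \<open>n \<ge> 1\<close>; the second serves exponent 0,
    on which the bound for \<open>N x\<close> is silent.\<close>
  have "hnorm K ((N ^^ n) x) \<le> (\<bar>C\<bar> / M + hnorm K x) * M ^ n" for n
  proof (cases n)
    case 0 then show ?thesis using M by simp
  next
    case (Suc m)
    have "hnorm K ((N ^^ n) x) \<le> C * M ^ m" using C[of m] Suc by (simp add: funpow_swap1)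
    also have "\<dots> \<le> \<bar>C\<bar> * M ^ m" using M by (simp add: mult_right_mono)
    also have "\<dots> = \<bar>C\<bar> / M * M ^ n" using M Suc by simp
    also have "\<dots> \<le> (\<bar>C\<bar> / M + hnorm K x) * M ^ n"
      using M x hnorm_nonneg by (intro mult_right_mono) auto
    finally show ?thesis .
  qed
  then show "x \<in> moderate M" using x by (auto simp: moderate_def)
qed

lemma moderate_hnorm_N_le:
  assumes M: "0 < M" and x: "x \<in> moderate M"
  shows "hnorm K (N x) \<le> M * hnorm K x"
proof -
  have xK: "x \<in> carrier K" using x by (simp add: moderate_def)
  obtain C where "\<And>n. hnorm K ((N ^^ n) x) \<le> C * M ^ n" using x by (auto simp: moderate_def)
  then show ?thesis
    using log_convex_growth[of "\<lambda>n. hnorm K ((N ^^ n) x)" C M] hnorm_log_convex[of "(N ^^ n) x" for n] xK M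
    by (auto simp: hnorm_nonneg)
qed

lemma moderate_hnorm_pow_le:
  assumes M: "0 < M" and x: "x \<in> moderate M"
  shows "hnorm K ((N ^^ n) x) \<le> M ^ n * hnorm K x"
proof -
  have xK: "x \<in> carrier K" using x by (simp add: moderate_def)
  have "(N ^^ n) x \<in> moderate M \<and> hnorm K ((N ^^ n) x) \<le> M ^ n * hnorm K x"
  proof (induction n)
    case (Suc n)
    then have "hnorm K ((N ^^ Suc n) x) \<le> M * hnorm K ((N ^^ n) x)"
      using moderate_hnorm_N_le[OF M] by simp
    also have "\<dots> \<le> M * (M ^ n * hnorm K x)" using Suc M by simp
    finally show ?case using Suc moderate_N_iff[OF M] xK by (simp add: mult.assoc)
  qed (use x in simp)
  then show ?thesis ..
qed

text \<open>The constants in \<open>moderate\<close> could grow along a sequence.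
  \<open>moderate_hnorm_pow_le\<close> replaces each by the norm of its vector, and these norms stay
  bounded near the limit.\<close>

lemma moderate_closed:
  assumes M: "0 < M" and X: "\<And>i::nat. X i \<in> moderate M" and l: "l \<in> carrier K"
    and lim: "(\<lambda>i. hnorm K (X i \<ominus> l)) \<longlonglongrightarrow> 0"
  shows "l \<in> moderate M"
proof -
  have XK: "X i \<in> carrier K" for i using X by (simp add: moderate_def)
  have "hnorm K ((N ^^ n) l) \<le> hnorm K l * M ^ n" for n
  proof -
    obtain B where B: "B \<ge> 0" "\<And>x. x \<in> carrier K \<Longrightarrow> hnorm K ((N ^^ n) x) \<le> B * hnorm K x"
      using hnorm_pow_le by blast
    have bd: "hnorm K ((N ^^ n) l) \<le> B * hnorm K (X i \<ominus> l) + M ^ n * (hnorm K (X i \<ominus> l) + hnorm K l)" for i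
    proof -
      have "hnorm K ((N ^^ n) l) \<le> hnorm K ((N ^^ n) (l \<ominus> X i)) + hnorm K ((N ^^ n) (X i))"
        using hnorm_le_minus[of "(N ^^ n) l" "(N ^^ n) (X i)"] l XK by (simp add: pow_minus)
      moreover have "hnorm K ((N ^^ n) (l \<ominus> X i)) \<le> B * hnorm K (X i \<ominus> l)"
        using B(2)[of "l \<ominus> X i"] l XK hnorm_minus_commute[of l "X i"] by simp
      moreover have "hnorm K ((N ^^ n) (X i)) \<le> M ^ n * hnorm K (X i)"
        by (rule moderate_hnorm_pow_le[OF M X])
      moreover have "M ^ n * hnorm K (X i) \<le> M ^ n * (hnorm K (X i \<ominus> l) + hnorm K l)"
        using hnorm_le_minus[of "X i" l] l XK M by (intro mult_left_mono) auto
      ultimately show ?thesis by linarith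
    qed
    have "(\<lambda>i. B * hnorm K (X i \<ominus> l) + M ^ n * (hnorm K (X i \<ominus> l) + hnorm K l))
        \<longlonglongrightarrow> B * 0 + M ^ n * (0 + hnorm K l)"
      by (intro tendsto_intros lim)
    then have "hnorm K ((N ^^ n) l) \<le> B * 0 + M ^ n * (0 + hnorm K l)"
      by (rule LIMSEQ_le_const) (use bd in blast)
    then show ?thesis by (simp add: mult.commute)
  qed
  then show ?thesis using l by (auto simp: moderate_def)
qed

text \<open>\<open>N'\<close> commutes with the powers of \<open>N\<close>, so it multiplies the
  growth constant by at most a bound for \<open>N'\<close>.\<close>

lemma moderate_N': 
  assumes M: "0 < M" and x: "x \<in> moderate M" shows "N' x \<in> moderate M"
proof -
  have xK: "x \<in> carrier K" using x by (simp add: moderate_def)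
  obtain B where B: "\<And>x. x \<in> carrier K \<Longrightarrow> hnorm K (N' x) \<le> B * hnorm K x"
    using bounded_N' by (auto simp: bounded_operator_def)
  have "hnorm K ((N ^^ n) (N' x)) \<le> (\<bar>B\<bar> * hnorm K x) * M ^ n" for n
  proof -
    have "hnorm K ((N ^^ n) (N' x)) \<le> B * hnorm K ((N ^^ n) x)"
      using B[of "(N ^^ n) x"] xK by (simp add: pow_commute)
    also have "\<dots> \<le> \<bar>B\<bar> * hnorm K ((N ^^ n) x)" using xK hnorm_nonneg by (simp add: mult_right_mono)
    also have "\<dots> \<le> \<bar>B\<bar> * (M ^ n * hnorm K x)"
      using moderate_hnorm_pow_le[OF M x] by (simp add: mult_left_mono)
    finally show ?thesis by (simp add: mult_ac)
  qed
  then show ?thesis using xK by (auto simp: moderate_def)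
qed

lemma hilbert_moderate:
  assumes M: "0 < M" shows "complex_hilbert_space (K\<lparr>carrier := moderate M\<rparr>)"
proof (rule hilbert_subspace)
  show "complex_hilbert_space K" by unfold_locales
  show "moderate M \<subseteq> carrier K" by (auto simp: moderate_def)
  show "\<zero> \<in> moderate M" by (auto simp: moderate_def pow_zero hnorm_zero intro: exI[of _ 0])
  show "x \<oplus> y \<in> moderate M" if xy: "x \<in> moderate M" "y \<in> moderate M" for x y
  proof -
    have K: "x \<in> carrier K" "y \<in> carrier K" using xy by (auto simp: moderate_def)
    have "hnorm K ((N ^^ n) (x \<oplus> y)) \<le> (hnorm K x + hnorm K y) * M ^ n" for n
      using hnorm_triangle[of "(N ^^ n) x" "(N ^^ n) y"] moderate_hnorm_pow_le[OF M xy(1), of n]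
        moderate_hnorm_pow_le[OF M xy(2), of n] K by (simp add: pow_add algebra_simps)
    then show ?thesis using K by (auto simp: moderate_def)
  qed
  show "c \<odot> x \<in> moderate M" if x: "x \<in> moderate M" for c x
  proof -
    have K: "x \<in> carrier K" using x by (auto simp: moderate_def)
    have "hnorm K ((N ^^ n) (c \<odot> x)) \<le> (cmod c * hnorm K x) * M ^ n" for n
      using mult_left_mono[OF moderate_hnorm_pow_le[OF M x, of n], of "cmod c"] K
      by (simp add: pow_smult hnorm_smult mult_ac)
    then show ?thesis using K by (auto simp: moderate_def)
  qed
qed (fact moderate_closed[OF M])

end

lemma normal_extension_pair:
  assumes "normal_extension H T K N J"
  obtains N' where "normal_pair K N N'"
  using assms unfolding normal_extension_def normal_operator_def normal_pair_def normal_pair_axioms_def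
  by blast

text \<open>
  The subspace of all vectors on which the powers of \<open>N\<close> grow at most like those of \<open>M\<close> reduces \<open>N\<close>,
  and logarithmic convexity of \<open>n \<mapsto> \<parallel>N\<^sup>n x\<parallel>\<close> bounds \<open>N\<close> by \<open>M\<close> there.
\<close>

lemma normal_extension_bound:
  assumes ext: "normal_extension H T K N J" and M: "0 < M"
    and growth: "\<And>h. h \<in> carrier H \<Longrightarrow> \<exists>C. \<forall>n. hnorm K ((N ^^ n) (J h)) \<le> C * M ^ n"
  obtains L where "normal_extension H T (L :: 'k inner_space) N J"
    and "\<And>x. x \<in> carrier L \<Longrightarrow> hnorm L (N x) \<le> M * hnorm L x"
proof -
  obtain N' where "normal_pair K N N'" using ext by (rule normal_extension_pair)
  then interpret normal_pair K N N' .
  let ?L = "K\<lparr>carrier := moderate M\<rparr>"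
  have JK: "J h \<in> carrier K" if "h \<in> carrier H" for h
    using ext that by (auto simp: normal_extension_def isometric_embedding_def clinear_map_def)
  have "normal_extension H T ?L N J"
  proof (rule normal_extension_reducing[OF ext hilbert_moderate[OF M] _ _ bounded_N' adjoint commute moderate_N'[OF M]])
    show "moderate M \<subseteq> carrier K" by (auto simp: moderate_def)
    show "N x \<in> moderate M" if "x \<in> moderate M" for x
      using moderate_N_iff[OF M, of x] that by (simp add: moderate_def)
    show "J x \<in> moderate M" if "x \<in> carrier H" for x
      using growth[OF that] JK[OF that] by (simp add: moderate_def)
  qed
  moreover have "hnorm ?L (N x) \<le> M * hnorm ?L x" if "x \<in> carrier ?L" for x
    using moderate_hnorm_N_le[OF M] that by (simp add: hnorm_def)
  ultimately show ?thesis by (rule that)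
qed

section \<open>Direct sums\<close>

lemma summable_on_real_comparison:
  fixes f g :: "'i \<Rightarrow> real"
  shows "g summable_on I \<Longrightarrow> (\<And>i. i \<in> I \<Longrightarrow> 0 \<le> f i) \<Longrightarrow> (\<And>i. i \<in> I \<Longrightarrow> f i \<le> g i) \<Longrightarrow> f summable_on I"
  using abs_summable_on_comparison_test'[of g I f] summable_on_iff_abs_summable_on_real by fastforce

text \<open>The extensional product is used so that vectors agreeing on \<open>I\<close> are equal,
  as the module laws and definiteness require.\<close>

definition hilbert_sum :: "'i set \<Rightarrow> ('i \<Rightarrow> 'k inner_space) \<Rightarrow> ('i \<Rightarrow> 'k) inner_space" where
  "hilbert_sum I K = \<lparr>
     carrier = {x \<in> \<Pi>\<^sub>E i\<in>I. carrier (K i). (\<lambda>i. (hnorm (K i) (x i))\<^sup>2) summable_on I},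
     mult = undefined, one = undefined,
     zero = (\<lambda>i\<in>I. \<zero>\<^bsub>K i\<^esub>),
     add = (\<lambda>x y. \<lambda>i\<in>I. x i \<oplus>\<^bsub>K i\<^esub> y i),
     smult = (\<lambda>c x. \<lambda>i\<in>I. c \<odot>\<^bsub>K i\<^esub> x i),
     cinner = (\<lambda>x y. \<Sum>\<^sub>\<infinity>i\<in>I. cinner (K i) (x i) (y i))\<rparr>"

lemma (in complex_hilbert_space) hnorm_add_square_le:
  assumes "x \<in> carrier H" "y \<in> carrier H"
  shows "(hnorm H (x \<oplus> y))\<^sup>2 \<le> 2 * (hnorm H x)\<^sup>2 + 2 * (hnorm H y)\<^sup>2"
proof -
  have "(hnorm H (x \<oplus> y))\<^sup>2 \<le> (hnorm H x + hnorm H y)\<^sup>2"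
    using assms by (intro power_mono hnorm_triangle hnorm_nonneg) auto
  also have "\<dots> \<le> 2 * (hnorm H x)\<^sup>2 + 2 * (hnorm H y)\<^sup>2"
    using sum_squares_bound[of "hnorm H x" "hnorm H y"] by (simp add: power2_sum)
  finally show ?thesis .
qed

lemma (in complex_hilbert_space) cmod_cinner_le:
  assumes "x \<in> carrier H" "y \<in> carrier H"
  shows "cmod (cinner H x y) \<le> (hnorm H x)\<^sup>2 + (hnorm H y)\<^sup>2"
proof -
  have "0 \<le> hnorm H x * hnorm H y" by (simp add: hnorm_nonneg assms)
  then have "hnorm H x * hnorm H y \<le> (hnorm H x)\<^sup>2 + (hnorm H y)\<^sup>2"
    using sum_squares_bound[of "hnorm H x" "hnorm H y"] by linarith
  then show ?thesis using cauchy_schwarz[OF assms] by linarith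
qed

lemma (in complex_hilbert_space) tendsto_hnorm_minus:
  assumes X: "\<And>n. X n \<in> carrier H" and l: "l \<in> carrier H" and a: "a \<in> carrier H"
    and lim: "(\<lambda>n. hnorm H (X n \<ominus> l)) \<longlonglongrightarrow> 0"
  shows "(\<lambda>n. hnorm H (a \<ominus> X n)) \<longlonglongrightarrow> hnorm H (a \<ominus> l)"
proof -
  have "\<bar>hnorm H (a \<ominus> X n) - hnorm H (a \<ominus> l)\<bar> \<le> hnorm H (X n \<ominus> l)" for n
    using hnorm_triangle_minus[of a "X n" l] hnorm_triangle_minus[of a l "X n"]
      hnorm_minus_commute[of l "X n"] X l a by (simp add: abs_le_iff)
  then have "(\<lambda>n. hnorm H (a \<ominus> X n) - hnorm H (a \<ominus> l)) \<longlonglongrightarrow> 0"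
    by (intro Lim_null_comparison[OF _ lim]) simp
  then show ?thesis by (simp add: LIM_zero_iff)
qed

locale hilbert_family =
  fixes I :: "'i set" and K :: "'i \<Rightarrow> 'k inner_space"
  assumes hilbert: "i \<in> I \<Longrightarrow> complex_hilbert_space (K i)"
begin

abbreviation S where "S \<equiv> hilbert_sum I K"

lemma mod: "i \<in> I \<Longrightarrow> module complex_ring (K i)"
  using hilbert by (simp add: complex_hilbert_space_def)

lemma ag: "i \<in> I \<Longrightarrow> abelian_group (K i)"
  using mod by (simp add: module_def)

lemma am: "i \<in> I \<Longrightarrow> abelian_monoid (K i)"
  using ag by (simp add: abelian_group_def)

lemma carrier_iff:
  "x \<in> carrier S \<longleftrightarrow> x \<in> extensional I \<and> (\<forall>i\<in>I. x i \<in> carrier (K i))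
     \<and> (\<lambda>i. (hnorm (K i) (x i))\<^sup>2) summable_on I"
  by (auto simp: hilbert_sum_def PiE_iff)

lemma in_carrier: "x \<in> carrier S \<Longrightarrow> i \<in> I \<Longrightarrow> x i \<in> carrier (K i)"
  by (simp add: carrier_iff)

lemma summable: "x \<in> carrier S \<Longrightarrow> (\<lambda>i. (hnorm (K i) (x i))\<^sup>2) summable_on I"
  by (simp add: carrier_iff)

lemma sum_sel:
  "\<zero>\<^bsub>S\<^esub> = (\<lambda>i\<in>I. \<zero>\<^bsub>K i\<^esub>)" "x \<oplus>\<^bsub>S\<^esub> y = (\<lambda>i\<in>I. x i \<oplus>\<^bsub>K i\<^esub> y i)"
  "c \<odot>\<^bsub>S\<^esub> x = (\<lambda>i\<in>I. c \<odot>\<^bsub>K i\<^esub> x i)"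
  "cinner S x y = (\<Sum>\<^sub>\<infinity>i\<in>I. cinner (K i) (x i) (y i))"
  by (simp_all add: hilbert_sum_def)

lemma carrierI:
  assumes "x \<in> extensional I" "\<And>i. i \<in> I \<Longrightarrow> x i \<in> carrier (K i)" "g summable_on I"
    "\<And>i. i \<in> I \<Longrightarrow> (hnorm (K i) (x i))\<^sup>2 \<le> g i"
  shows "x \<in> carrier S"
  using assms by (auto simp: carrier_iff intro: summable_on_real_comparison)

lemma zero_closed: "\<zero>\<^bsub>S\<^esub> \<in> carrier S"
  by (rule carrierI[where g="\<lambda>_. 0"])
     (auto simp: sum_sel abelian_monoid.zero_closed[OF am] complex_hilbert_space.hnorm_zero[OF hilbert])

lemma add_closed: "x \<in> carrier S \<Longrightarrow> y \<in> carrier S \<Longrightarrow> x \<oplus>\<^bsub>S\<^esub> y \<in> carrier S"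
  by (rule carrierI[where g="\<lambda>i. 2 * (hnorm (K i) (x i))\<^sup>2 + 2 * (hnorm (K i) (y i))\<^sup>2"])
     (auto simp: sum_sel in_carrier abelian_monoid.a_closed[OF am] summable
       intro!: summable_on_add summable_on_cmult_right complex_hilbert_space.hnorm_add_square_le[OF hilbert])

lemma smult_closed: "x \<in> carrier S \<Longrightarrow> c \<odot>\<^bsub>S\<^esub> x \<in> carrier S"
  by (rule carrierI[where g="\<lambda>i. (cmod c)\<^sup>2 * (hnorm (K i) (x i))\<^sup>2"])
     (auto simp: sum_sel in_carrier complex_hilbert_space.smult_in[OF hilbert] summable
       complex_hilbert_space.hnorm_smult[OF hilbert] power_mult_distrib intro!: summable_on_cmult_right)

lemma extI:
  "x \<in> carrier S \<Longrightarrow> y \<in> carrier S \<Longrightarrow> (\<And>i. i \<in> I \<Longrightarrow> x i = y i) \<Longrightarrow> x = y"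
  by (rule extensionalityI) (auto simp: carrier_iff)

lemmas closed = zero_closed add_closed smult_closed

lemma neg:
  assumes x: "x \<in> carrier S" shows "(- 1) \<odot>\<^bsub>S\<^esub> x \<oplus>\<^bsub>S\<^esub> x = \<zero>\<^bsub>S\<^esub>"
proof (rule extI)
  fix i assume i: "i \<in> I"
  interpret K: complex_hilbert_space "K i" by (rule hilbert[OF i])
  have "x i \<ominus>\<^bsub>K i\<^esub> x i = x i \<oplus>\<^bsub>K i\<^esub> (- 1) \<odot>\<^bsub>K i\<^esub> x i"
    using x i by (intro K.minus_as_smult) (auto simp: in_carrier)
  then show "((- 1) \<odot>\<^bsub>S\<^esub> x \<oplus>\<^bsub>S\<^esub> x) i = \<zero>\<^bsub>S\<^esub> i"
    using x i K.minus_eq_zero_iff[of "x i" "x i"] by (simp add: sum_sel in_carrier K.M.a_comm)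
qed (use x in \<open>auto intro: closed\<close>)

lemma abelian_group_sum: "abelian_group S"
proof (rule abelian_groupI)
  show "\<exists>y\<in>carrier S. y \<oplus>\<^bsub>S\<^esub> x = \<zero>\<^bsub>S\<^esub>" if "x \<in> carrier S" for x
    using neg[OF that] smult_closed[OF that] by blast
  show "x \<oplus>\<^bsub>S\<^esub> y \<oplus>\<^bsub>S\<^esub> z = x \<oplus>\<^bsub>S\<^esub> (y \<oplus>\<^bsub>S\<^esub> z)"
    if "x \<in> carrier S" "y \<in> carrier S" "z \<in> carrier S" for x y z
    by (rule extI, simp_all only: closed that)
       (simp add: sum_sel in_carrier that abelian_monoid.a_assoc[OF am] abelian_monoid.a_closed[OF am])
  show "x \<oplus>\<^bsub>S\<^esub> y = y \<oplus>\<^bsub>S\<^esub> x"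
    if "x \<in> carrier S" "y \<in> carrier S" for x y
    by (rule extI, simp_all only: closed that)
       (simp add: sum_sel in_carrier that abelian_monoid.a_comm[OF am])
  show "\<zero>\<^bsub>S\<^esub> \<oplus>\<^bsub>S\<^esub> x = x"
    if "x \<in> carrier S" for x
    by (rule extI, simp_all only: closed that)
       (simp add: sum_sel in_carrier that abelian_monoid.l_zero[OF am])
qed (auto intro: closed)

lemma module_sum: "module complex_ring S"
proof (rule moduleI)
  show "cring complex_ring" by (rule cring_complex_ring)
  show "abelian_group S" by (rule abelian_group_sum)
  show "c \<odot>\<^bsub>S\<^esub> x \<in> carrier S" if "x \<in> carrier S" for c x using that by (rule smult_closed)
  show "(a \<oplus>\<^bsub>complex_ring\<^esub> b) \<odot>\<^bsub>S\<^esub> x = a \<odot>\<^bsub>S\<^esub> x \<oplus>\<^bsub>S\<^esub> b \<odot>\<^bsub>S\<^esub> x"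
    if "a \<in> carrier complex_ring" "b \<in> carrier complex_ring" "x \<in> carrier S" for a b x
    by (rule extI, simp_all only: closed that)
       (simp add: sum_sel in_carrier that module.smult_l_distr[OF mod])
  show "a \<odot>\<^bsub>S\<^esub> (x \<oplus>\<^bsub>S\<^esub> y) = a \<odot>\<^bsub>S\<^esub> x \<oplus>\<^bsub>S\<^esub> a \<odot>\<^bsub>S\<^esub> y"
    if "a \<in> carrier complex_ring" "x \<in> carrier S" "y \<in> carrier S" for a x y
    by (rule extI, simp_all only: closed that)
       (simp add: sum_sel in_carrier that module.smult_r_distr[OF mod])
  show "(a \<otimes>\<^bsub>complex_ring\<^esub> b) \<odot>\<^bsub>S\<^esub> x = a \<odot>\<^bsub>S\<^esub> (b \<odot>\<^bsub>S\<^esub> x)"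
    if "a \<in> carrier complex_ring" "b \<in> carrier complex_ring" "x \<in> carrier S" for a b x
    by (rule extI, simp_all only: closed that)
       (simp add: sum_sel in_carrier that module.smult_assoc1[OF mod])
  show "\<one>\<^bsub>complex_ring\<^esub> \<odot>\<^bsub>S\<^esub> x = x"
    if "x \<in> carrier S" for x
    by (rule extI, simp_all only: closed that)
       (simp add: sum_sel in_carrier that module.smult_one[OF mod])
qed

lemma minus_sel:
  assumes x: "x \<in> carrier S" and y: "y \<in> carrier S" and i: "i \<in> I"
  shows "(x \<ominus>\<^bsub>S\<^esub> y) i = x i \<ominus>\<^bsub>K i\<^esub> y i"
proof -
  interpret S: module complex_ring S by (rule module_sum)
  interpret K: complex_hilbert_space "K i" by (rule hilbert[OF i])
  have "\<ominus>\<^bsub>S\<^esub> y = (- 1) \<odot>\<^bsub>S\<^esub> y"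
    by (rule S.M.minus_equality[OF neg]) (use y in \<open>auto intro: smult_closed\<close>)
  then show ?thesis
    using x y i by (simp add: a_minus_def[of S] sum_sel K.minus_as_smult in_carrier)
qed

lemma abs_summable_cinner:
  assumes x: "x \<in> carrier S" and y: "y \<in> carrier S"
  shows "(\<lambda>i. cinner (K i) (x i) (y i)) abs_summable_on I"
  by (rule abs_summable_on_comparison_test'[OF summable_on_add[OF summable[OF x] summable[OF y]]])
     (use x y in \<open>auto intro: complex_hilbert_space.cmod_cinner_le[OF hilbert] in_carrier\<close>)

lemmas summable_cinner = abs_summable_summable[OF abs_summable_cinner]

lemma cinner_self_sum:
  assumes x: "x \<in> carrier S"
  shows "cinner S x x = of_real (\<Sum>\<^sub>\<infinity>i\<in>I. (hnorm (K i) (x i))\<^sup>2)"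
proof -
  have "cinner S x x = (\<Sum>\<^sub>\<infinity>i\<in>I. of_real ((hnorm (K i) (x i))\<^sup>2))"
    unfolding sum_sel by (rule infsum_cong)
      (use x in \<open>auto simp: complex_hilbert_space.cinner_self[OF hilbert] in_carrier\<close>)
  also have "\<dots> = of_real (\<Sum>\<^sub>\<infinity>i\<in>I. (hnorm (K i) (x i))\<^sup>2)"
    by (rule infsumI has_sum_of_real has_sum_infsum summable x)+
  finally show ?thesis .
qed

lemma hnorm_sum_square:
  assumes x: "x \<in> carrier S" shows "(hnorm S x)\<^sup>2 = (\<Sum>\<^sub>\<infinity>i\<in>I. (hnorm (K i) (x i))\<^sup>2)"
  unfolding hnorm_def[of S] cinner_self_sum[OF x]
  by (simp add: infsum_nonneg)

lemma finite_sum_le: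
  assumes x: "x \<in> carrier S" and F: "finite F" "F \<subseteq> I"
  shows "(\<Sum>i\<in>F. (hnorm (K i) (x i))\<^sup>2) \<le> (hnorm S x)\<^sup>2"
  unfolding hnorm_sum_square[OF x] by (rule finite_sum_le_infsum[OF summable[OF x] F]) simp

lemma hnorm_sum_nonneg: "x \<in> carrier S \<Longrightarrow> 0 \<le> hnorm S x"
  unfolding hnorm_def by (simp add: cinner_self_sum infsum_nonneg)

lemma hilbert_sum_complete:
  fixes X :: "nat \<Rightarrow> 'i \<Rightarrow> 'k"
  assumes X: "\<And>n. X n \<in> carrier S"
    and cauchy: "\<And>e. 0 < e \<Longrightarrow> \<exists>M. \<forall>m\<ge>M. \<forall>n\<ge>M. hnorm S (X m \<ominus>\<^bsub>S\<^esub> X n) < e"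
  shows "\<exists>l\<in>carrier S. (\<lambda>n. hnorm S (X n \<ominus>\<^bsub>S\<^esub> l)) \<longlonglongrightarrow> 0"
proof -
  interpret S: module complex_ring S by (rule module_sum)
  have XK: "X n i \<in> carrier (K i)" if "i \<in> I" for n i using X that by (rule in_carrier)
  have Xm: "X m \<ominus>\<^bsub>S\<^esub> X n \<in> carrier S" for m n using X by (intro S.M.minus_closed)
  have "\<exists>l\<in>carrier (K i). (\<lambda>n. hnorm (K i) (X n i \<ominus>\<^bsub>K i\<^esub> l)) \<longlonglongrightarrow> 0" if i: "i \<in> I" for i
  proof (rule complex_hilbert_space.complete[OF hilbert[OF i]])
    fix e :: real assume "0 < e"
    then obtain M where M: "\<And>m n. m \<ge> M \<Longrightarrow> n \<ge> M \<Longrightarrow> hnorm S (X m \<ominus>\<^bsub>S\<^esub> X n) < e" using cauchy by blast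
    have "hnorm (K i) (X m i \<ominus>\<^bsub>K i\<^esub> X n i) \<le> hnorm S (X m \<ominus>\<^bsub>S\<^esub> X n)" for m n
    proof (rule power2_le_imp_le)
      show "(hnorm (K i) (X m i \<ominus>\<^bsub>K i\<^esub> X n i))\<^sup>2 \<le> (hnorm S (X m \<ominus>\<^bsub>S\<^esub> X n))\<^sup>2"
        using finite_sum_le[OF Xm, of "{i}" m n] i minus_sel[OF X X i] by simp
    qed (rule hnorm_sum_nonneg[OF Xm])
    then show "\<exists>M. \<forall>m\<ge>M. \<forall>n\<ge>M. hnorm (K i) (X m i \<ominus>\<^bsub>K i\<^esub> X n i) < e"
      using M by (meson le_less_trans)
  qed (use XK i in auto)
  then obtain l0 where l0: "\<And>i. i \<in> I \<Longrightarrow> l0 i \<in> carrier (K i)"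
    "\<And>i. i \<in> I \<Longrightarrow> (\<lambda>n. hnorm (K i) (X n i \<ominus>\<^bsub>K i\<^esub> l0 i)) \<longlonglongrightarrow> 0" by metis
  define l where "l = restrict l0 I"
  have l: "l i \<in> carrier (K i)" "(\<lambda>n. hnorm (K i) (X n i \<ominus>\<^bsub>K i\<^esub> l i)) \<longlonglongrightarrow> 0" if "i \<in> I" for i
    using l0[OF that] that by (simp_all add: l_def)
  \<comment> \<open>The Cauchy bound is restricted to finitely many coordinates before
    \<open>n\<close> tends to infinity, because the coordinatewise limits come with no uniformity in
    \<open>i\<close>.\<close>
  have partial: "(\<Sum>i\<in>F. (hnorm (K i) (X m i \<ominus>\<^bsub>K i\<^esub> l i))\<^sup>2) \<le> e\<^sup>2"
    if M: "\<And>m n. m \<ge> M \<Longrightarrow> n \<ge> M \<Longrightarrow> hnorm S (X m \<ominus>\<^bsub>S\<^esub> X n) < e" and m: "m \<ge> M"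
      and F: "finite F" "F \<subseteq> I" for e M m F
  proof (rule LIMSEQ_le_const2)
    show "(\<lambda>n. \<Sum>i\<in>F. (hnorm (K i) (X m i \<ominus>\<^bsub>K i\<^esub> X n i))\<^sup>2)
        \<longlonglongrightarrow> (\<Sum>i\<in>F. (hnorm (K i) (X m i \<ominus>\<^bsub>K i\<^esub> l i))\<^sup>2)"
    proof (intro tendsto_intros)
      fix i assume "i \<in> F"
      then have "i \<in> I" using F by auto
      then show "(\<lambda>n. hnorm (K i) (X m i \<ominus>\<^bsub>K i\<^esub> X n i)) \<longlonglongrightarrow> hnorm (K i) (X m i \<ominus>\<^bsub>K i\<^esub> l i)"
        using l XK by (intro complex_hilbert_space.tendsto_hnorm_minus[OF hilbert]) auto
    qed
    have "(\<Sum>i\<in>F. (hnorm (K i) (X m i \<ominus>\<^bsub>K i\<^esub> X n i))\<^sup>2) \<le> e\<^sup>2" if n: "n \<ge> M" for n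
    proof -
      have "(\<Sum>i\<in>F. (hnorm (K i) (X m i \<ominus>\<^bsub>K i\<^esub> X n i))\<^sup>2)
          = (\<Sum>i\<in>F. (hnorm (K i) ((X m \<ominus>\<^bsub>S\<^esub> X n) i))\<^sup>2)"
        using F by (intro sum.cong) (auto simp: minus_sel[OF X X])
      also have "\<dots> \<le> (hnorm S (X m \<ominus>\<^bsub>S\<^esub> X n))\<^sup>2" by (rule finite_sum_le[OF Xm F])
      also have "\<dots> \<le> e\<^sup>2" using M[OF m n] hnorm_sum_nonneg[OF Xm] by (intro power_mono) auto
      finally show ?thesis .
    qed
    then show "\<exists>N. \<forall>n\<ge>N. (\<Sum>i\<in>F. (hnorm (K i) (X m i \<ominus>\<^bsub>K i\<^esub> X n i))\<^sup>2) \<le> e\<^sup>2" by blast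
  qed
  have diff: "(\<lambda>i\<in>I. X m i \<ominus>\<^bsub>K i\<^esub> l i) \<in> carrier S \<and> (hnorm S (\<lambda>i\<in>I. X m i \<ominus>\<^bsub>K i\<^esub> l i))\<^sup>2 \<le> e\<^sup>2"
    if M: "\<And>m n. m \<ge> M \<Longrightarrow> n \<ge> M \<Longrightarrow> hnorm S (X m \<ominus>\<^bsub>S\<^esub> X n) < e" and m: "m \<ge> M" for e M m
  proof -
    let ?d = "\<lambda>i\<in>I. X m i \<ominus>\<^bsub>K i\<^esub> l i"
    have le: "(\<Sum>i\<in>F. (hnorm (K i) (?d i))\<^sup>2) \<le> e\<^sup>2" if F: "finite F" "F \<subseteq> I" for F
    proof -
      have "(\<Sum>i\<in>F. (hnorm (K i) (?d i))\<^sup>2) = (\<Sum>i\<in>F. (hnorm (K i) (X m i \<ominus>\<^bsub>K i\<^esub> l i))\<^sup>2)"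
        using F by (intro sum.cong) auto
      then show ?thesis using partial[OF M m F] by simp
    qed
    have "(\<lambda>i. (hnorm (K i) (?d i))\<^sup>2) summable_on I"
    proof (rule nonneg_bdd_above_summable_on)
      show "bdd_above (sum (\<lambda>i. (hnorm (K i) (?d i))\<^sup>2) ` {F. F \<subseteq> I \<and> finite F})"
        by (rule bdd_aboveI2[where M="e\<^sup>2"]) (use le in blast)
    qed simp
    moreover have "?d i \<in> carrier (K i)" if "i \<in> I" for i
      using that XK l abelian_group.minus_closed[OF ag] by simp
    ultimately have c: "?d \<in> carrier S" by (simp add: carrier_iff)
    moreover have "(hnorm S ?d)\<^sup>2 \<le> e\<^sup>2"
      unfolding hnorm_sum_square[OF c] by (rule infsum_le_finite_sums[OF summable[OF c] le])
    ultimately show ?thesis by blast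
  qed
  have lS: "l \<in> carrier S"
  proof -
    obtain M where M: "\<And>m n. m \<ge> M \<Longrightarrow> n \<ge> M \<Longrightarrow> hnorm S (X m \<ominus>\<^bsub>S\<^esub> X n) < 1"
      using cauchy[of 1] by auto
    let ?d = "\<lambda>i\<in>I. X M i \<ominus>\<^bsub>K i\<^esub> l i"
    have d: "?d \<in> carrier S" using diff[OF M order_refl] by blast
    \<comment> \<open>The limit differs from \<open>X M\<close> by a square-summable family, and
      this puts it into the sum.\<close>
    have "l = X M \<ominus>\<^bsub>S\<^esub> ?d"
    proof (rule extensionalityI[of _ I])
      show "l \<in> extensional I" by (simp add: l_def)
      show "X M \<ominus>\<^bsub>S\<^esub> ?d \<in> extensional I" using S.M.minus_closed[OF X d] by (simp add: carrier_iff)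
      fix i assume i: "i \<in> I"
      interpret K: complex_hilbert_space "K i" by (rule hilbert[OF i])
      have "l i = X M i \<ominus>\<^bsub>K i\<^esub> (X M i \<ominus>\<^bsub>K i\<^esub> l i)"
        by (rule K.eqI_inner) (use XK l i in \<open>auto simp: K.cinner_simps\<close>)
      then show "l i = (X M \<ominus>\<^bsub>S\<^esub> ?d) i" using i by (simp add: minus_sel[OF X d])
    qed
    then show ?thesis using S.M.minus_closed[OF X[of M] d] by metis
  qed
  have "\<exists>M. \<forall>m\<ge>M. hnorm S (X m \<ominus>\<^bsub>S\<^esub> l) < e" if e: "0 < e" for e
  proof -
    obtain M where M: "\<And>m n. m \<ge> M \<Longrightarrow> n \<ge> M \<Longrightarrow> hnorm S (X m \<ominus>\<^bsub>S\<^esub> X n) < e / 2"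
      using cauchy[of "e / 2"] e by auto
    have "hnorm S (X m \<ominus>\<^bsub>S\<^esub> l) < e" if m: "m \<ge> M" for m
    proof -
      have d: "X m \<ominus>\<^bsub>S\<^esub> l \<in> carrier S" by (rule S.M.minus_closed[OF X lS])
      have "X m \<ominus>\<^bsub>S\<^esub> l = (\<lambda>i\<in>I. X m i \<ominus>\<^bsub>K i\<^esub> l i)"
        by (rule extensionalityI[of _ I]) (use d in \<open>auto simp: carrier_iff minus_sel[OF X lS]\<close>)
      then have "(hnorm S (X m \<ominus>\<^bsub>S\<^esub> l))\<^sup>2 \<le> (e / 2)\<^sup>2" using diff[OF M m] by simp
      then have "hnorm S (X m \<ominus>\<^bsub>S\<^esub> l) \<le> e / 2"
        by (rule power2_le_imp_le) (use e in simp)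
      then show ?thesis using e by linarith
    qed
    then show ?thesis by blast
  qed
  then have "(\<lambda>n. hnorm S (X n \<ominus>\<^bsub>S\<^esub> l)) \<longlonglongrightarrow> 0"
    unfolding LIMSEQ_iff using hnorm_sum_nonneg[OF S.M.minus_closed[OF X lS]] by simp
  then show ?thesis using lS by blast
qed

lemma complex_hilbert_space_sum: "complex_hilbert_space S"
proof (rule complex_hilbert_space.intro[OF module_sum], unfold_locales)
  fix x y z c assume x: "x \<in> carrier S" and y: "y \<in> carrier S"
  show "cinner S (c \<odot>\<^bsub>S\<^esub> x) y = c * cinner S x y"
  proof -
    have "cinner S (c \<odot>\<^bsub>S\<^esub> x) y = (\<Sum>\<^sub>\<infinity>i\<in>I. c * cinner (K i) (x i) (y i))"
      unfolding sum_sel by (rule infsum_cong)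
        (use x y in \<open>auto simp: in_carrier complex_hilbert_space.cinner_smult_left[OF hilbert]\<close>)
    then show ?thesis by (simp add: sum_sel infsum_cmult_right')
  qed
  show "cinner S y x = cnj (cinner S x y)"
  proof -
    have "cinner S y x = (\<Sum>\<^sub>\<infinity>i\<in>I. cnj (cinner (K i) (x i) (y i)))"
      unfolding sum_sel by (rule infsum_cong)
        (use x y in \<open>auto simp: in_carrier intro: complex_hilbert_space.cinner_commute[OF hilbert]\<close>)
    then show ?thesis by (simp add: sum_sel infsum_cnj)
  qed
  assume z: "z \<in> carrier S"
  show "cinner S (x \<oplus>\<^bsub>S\<^esub> y) z = cinner S x z + cinner S y z"
  proof -
    have "cinner S (x \<oplus>\<^bsub>S\<^esub> y) z = (\<Sum>\<^sub>\<infinity>i\<in>I. cinner (K i) (x i) (z i) + cinner (K i) (y i) (z i))"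
      unfolding sum_sel by (rule infsum_cong)
        (use x y z in \<open>auto simp: in_carrier complex_hilbert_space.cinner_add_left[OF hilbert]\<close>)
    then show ?thesis using x y z by (simp add: sum_sel infsum_add summable_cinner)
  qed
next
  fix x assume x: "x \<in> carrier S" and nz: "x \<noteq> \<zero>\<^bsub>S\<^esub>"
  obtain i where i: "i \<in> I" "x i \<noteq> \<zero>\<^bsub>K i\<^esub>"
    using extI[OF x zero_closed] nz by (auto simp: sum_sel)
  have "0 < hnorm (K i) (x i)"
    using complex_hilbert_space.hnorm_pos[OF hilbert[OF i(1)]] i x by (simp add: in_carrier)
  then have "0 < (hnorm S x)\<^sup>2" using finite_sum_le[OF x, of "{i}"] i zero_less_power[of "hnorm (K i) (x i)" 2]
    by (auto intro: less_le_trans simp del: zero_less_power2)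
  then show "0 < Re (cinner S x x)" by (simp add: hnorm_sum_square[OF x] cinner_self_sum[OF x])
next
  fix X :: "nat \<Rightarrow> 'i \<Rightarrow> 'k"
  assume "\<And>n. X n \<in> carrier S" "\<And>e. 0 < e \<Longrightarrow> \<exists>M. \<forall>m\<ge>M. \<forall>n\<ge>M. hnorm S (X m \<ominus>\<^bsub>S\<^esub> X n) < e"
  then show "\<exists>l\<in>carrier S. (\<lambda>n. hnorm S (X n \<ominus>\<^bsub>S\<^esub> l)) \<longlonglongrightarrow> 0"
    by (rule hilbert_sum_complete)
qed

lemma bounded_operator_sum:
  assumes B: "\<And>i. i \<in> I \<Longrightarrow> clinear_map (K i) (K i) (B i)"
    and le: "\<And>i x. i \<in> I \<Longrightarrow> x \<in> carrier (K i) \<Longrightarrow> hnorm (K i) (B i x) \<le> M * hnorm (K i) x"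
  shows "bounded_operator S (\<lambda>x. \<lambda>i\<in>I. B i (x i))"
proof -
  have sq: "(hnorm (K i) (B i (x i)))\<^sup>2 \<le> M\<^sup>2 * (hnorm (K i) (x i))\<^sup>2" if "i \<in> I" "x \<in> carrier S" for i x
    using power_mono[OF le[OF that(1) in_carrier[OF that(2,1)]], of 2]
      complex_hilbert_space.hnorm_nonneg[OF hilbert[OF that(1)]] clinear_mapD(1)[OF B[OF that(1)]]
      in_carrier[OF that(2,1)] by (simp add: power_mult_distrib)
  have closed_B: "(\<lambda>i\<in>I. B i (x i)) \<in> carrier S" if x: "x \<in> carrier S" for x
    by (rule carrierI[OF _ _ summable_on_cmult_right[OF summable[OF x]]])
       (use x sq B in \<open>auto intro: clinear_mapD(1) in_carrier\<close>)
  have "clinear_map S S (\<lambda>x. \<lambda>i\<in>I. B i (x i))"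
    unfolding clinear_map_def
    by (intro conjI funcsetI ballI allI closed_B)
       (auto simp: sum_sel in_carrier clinear_mapD[OF B] intro!: restrict_ext)
  moreover have "hnorm S (\<lambda>i\<in>I. B i (x i)) \<le> \<bar>M\<bar> * hnorm S x" if x: "x \<in> carrier S" for x
  proof (rule power2_le_imp_le)
    have "(hnorm S (\<lambda>i\<in>I. B i (x i)))\<^sup>2 \<le> (\<Sum>\<^sub>\<infinity>i\<in>I. M\<^sup>2 * (hnorm (K i) (x i))\<^sup>2)"
      unfolding hnorm_sum_square[OF closed_B[OF x]]
      by (rule infsum_mono[OF summable[OF closed_B[OF x]] summable_on_cmult_right[OF summable[OF x]]])
         (use sq x in auto)
    also have "\<dots> = (\<bar>M\<bar> * hnorm S x)\<^sup>2"
      by (simp add: power_mult_distrib hnorm_sum_square[OF x] infsum_cmult_right')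
    finally show "(hnorm S (\<lambda>i\<in>I. B i (x i)))\<^sup>2 \<le> (\<bar>M\<bar> * hnorm S x)\<^sup>2" .
  qed (use hnorm_sum_nonneg[OF x] in simp)
  ultimately show ?thesis by (auto simp: bounded_operator_def)
qed

end

text \<open>The map sending \<open>h\<close> to the family of all \<open>G i h\<close> is an
  isometry that intertwines \<open>T\<close> with the direct sum of the \<open>B i\<close>. It need
  not be onto, so \<open>T\<close> itself need not split. The common bound \<open>M\<close> makes
  the direct sum of the \<open>N i\<close> a bounded operator.\<close>

lemma subnormal_by_components:
  fixes G :: "'i \<Rightarrow> 'h \<Rightarrow> 'g" and K :: "'i \<Rightarrow> 'k inner_space"
  assumes T: "bounded_operator H T"
    and ext: "\<And>i. i \<in> I \<Longrightarrow> normal_extension (E i) (B i) (K i) (N i) (J i)"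
    and le: "\<And>i x. i \<in> I \<Longrightarrow> x \<in> carrier (K i) \<Longrightarrow> hnorm (K i) (N i x) \<le> M * hnorm (K i) x"
    and G: "\<And>i. i \<in> I \<Longrightarrow> clinear_map H (E i) (G i)"
    and components: "\<And>h. h \<in> carrier H \<Longrightarrow> (\<lambda>i. (hnorm (E i) (G i h))\<^sup>2) summable_on I"
    and inner: "\<And>h h'. h \<in> carrier H \<Longrightarrow> h' \<in> carrier H \<Longrightarrow>
      (\<Sum>\<^sub>\<infinity>i\<in>I. cinner (E i) (G i h) (G i h')) = cinner H h h'"
    and intertwine: "\<And>i h. i \<in> I \<Longrightarrow> h \<in> carrier H \<Longrightarrow> B i (G i h) = G i (T h)"
  shows "subnormal H T"
proof -
  interpret hilbert_family I K
    by (rule hilbert_family.intro) (use ext in \<open>simp add: normal_extension_def\<close>)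
  have "\<exists>N'. normal_pair (K i) (N i) N'" if "i \<in> I" for i
    using ext[OF that] by (rule normal_extension_pair) blast
  then obtain N' where pair: "\<And>i. i \<in> I \<Longrightarrow> normal_pair (K i) (N i) (N' i)" by metis
  let ?N = "\<lambda>x. \<lambda>i\<in>I. N i (x i)" and ?N' = "\<lambda>x. \<lambda>i\<in>I. N' i (x i)"
  have N: "bounded_operator S ?N"
    by (rule bounded_operator_sum[where B=N and M=M, OF normal_pair.linear_N[OF pair] le])
  have N': "bounded_operator S ?N'"
    by (rule bounded_operator_sum[where B=N' and M=M, OF normal_pair.linear_N'[OF pair]])
       (use le in \<open>simp_all add: normal_pair.hnorm_N'[OF pair]\<close>)
  have "adjoint_pair S ?N ?N'"
    unfolding adjoint_pair_def sum_sel
    by (intro ballI infsum_cong) (auto simp: normal_pair.cinner_N[OF pair] in_carrier)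
  moreover have "?N (?N' x) = ?N' (?N x)" if "x \<in> carrier S" for x
    using that by (auto simp: in_carrier normal_pair.commute[OF pair] intro!: restrict_ext)
  ultimately have normal: "normal_operator S ?N"
    unfolding normal_operator_def using N N' by blast
  let ?J = "\<lambda>h. \<lambda>i\<in>I. J i (G i h)"
  have Jlin: "clinear_map (E i) (K i) (J i)"
    and Jiso: "\<And>x y. x \<in> carrier (E i) \<Longrightarrow> y \<in> carrier (E i) \<Longrightarrow> cinner (K i) (J i x) (J i y) = cinner (E i) x y"
    and NJ: "\<And>x. x \<in> carrier (E i) \<Longrightarrow> N i (J i x) = J i (B i x)" if "i \<in> I" for i
    using ext[OF that] by (auto simp: normal_extension_def isometric_embedding_def)
  have GE: "G i h \<in> carrier (E i)" if "i \<in> I" "h \<in> carrier H" for i h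
    using clinear_mapD(1)[OF G] that by blast
  have Jin: "?J h \<in> carrier S" if h: "h \<in> carrier H" for h
    by (rule carrierI[OF _ _ components[OF h]])
       (use h in \<open>auto simp: GE clinear_mapD(1)[OF Jlin] hnorm_def Jiso\<close>)
  have "clinear_map H S ?J"
    unfolding clinear_map_def
    by (intro conjI funcsetI ballI allI Jin)
       (auto simp: sum_sel GE clinear_mapD[OF G] clinear_mapD[OF Jlin] intro!: restrict_ext)
  moreover have "cinner S (?J x) (?J y) = cinner H x y" if "x \<in> carrier H" "y \<in> carrier H" for x y
  proof -
    have "cinner S (?J x) (?J y) = (\<Sum>\<^sub>\<infinity>i\<in>I. cinner (E i) (G i x) (G i y))"
      unfolding sum_sel by (rule infsum_cong) (use that in \<open>auto simp: GE Jiso\<close>)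
    then show ?thesis using inner that by simp
  qed
  ultimately have "isometric_embedding H S ?J" by (simp add: isometric_embedding_def)
  moreover have "?N (?J h) = ?J (T h)" if "h \<in> carrier H" for h
    using that by (auto simp: NJ GE intertwine intro!: restrict_ext)
  ultimately have "normal_extension H T S ?N ?J"
    using complex_hilbert_space_sum normal by (simp add: normal_extension_def)
  then show ?thesis by (rule subnormalI[OF T])
qed

section \<open>Weighted shifts on rooted trees\<close>

lemma ell2_sel:
  "\<zero>\<^bsub>ell2 V\<^esub> = (\<lambda>v. 0)" "f \<oplus>\<^bsub>ell2 V\<^esub> g = (\<lambda>v. f v + g v)"
  "c \<odot>\<^bsub>ell2 V\<^esub> f = (\<lambda>v. c * f v)"
  "cinner (ell2 V) f g = (\<Sum>\<^sub>\<infinity>v\<in>V. f v * cnj (g v))"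
  by (simp_all add: ell2_def)

lemma ell2_carrier_iff:
  "f \<in> carrier (ell2 V) \<longleftrightarrow> (\<forall>v. v \<notin> V \<longrightarrow> f v = 0) \<and> (\<lambda>v. (cmod (f v))\<^sup>2) summable_on V"
  by (simp add: ell2_def)

lemma ell2_comparison:
  assumes "g summable_on V" "\<And>v. v \<notin> V \<Longrightarrow> f v = 0" "\<And>v. v \<in> V \<Longrightarrow> (cmod (f v))\<^sup>2 \<le> g v"
  shows "f \<in> carrier (ell2 V)"
  using assms by (auto simp: ell2_carrier_iff intro: summable_on_real_comparison)

lemma ell2_zero_outside: "f \<in> carrier (ell2 V) \<Longrightarrow> v \<notin> V \<Longrightarrow> f v = 0"
  by (simp add: ell2_carrier_iff)

lemma ell2_summable: "f \<in> carrier (ell2 V) \<Longrightarrow> (\<lambda>v. (cmod (f v))\<^sup>2) summable_on V"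
  by (simp add: ell2_carrier_iff)

lemma ell2_zero_in: "(\<lambda>v. 0) \<in> carrier (ell2 V)"
  by (simp add: ell2_carrier_iff)

lemma ell2_smult_in: "f \<in> carrier (ell2 V) \<Longrightarrow> (\<lambda>v. c * f v) \<in> carrier (ell2 V)"
  by (auto simp: ell2_carrier_iff norm_mult power_mult_distrib intro: summable_on_cmult_right)

lemma cmod_add_square_le: "(cmod (a + b))\<^sup>2 \<le> 2 * (cmod a)\<^sup>2 + 2 * (cmod b)\<^sup>2"
proof -
  have "(cmod (a + b))\<^sup>2 \<le> (cmod a + cmod b)\<^sup>2"
    by (intro power_mono norm_triangle_ineq) simp
  also have "\<dots> \<le> 2 * (cmod a)\<^sup>2 + 2 * (cmod b)\<^sup>2"
    using sum_squares_bound[of "cmod a" "cmod b"] by (simp add: power2_sum)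
  finally show ?thesis .
qed

lemma ell2_add_in:
  "f \<in> carrier (ell2 V) \<Longrightarrow> g \<in> carrier (ell2 V) \<Longrightarrow> (\<lambda>v. f v + g v) \<in> carrier (ell2 V)"
  by (rule ell2_comparison[where g="\<lambda>v. 2 * (cmod (f v))\<^sup>2 + 2 * (cmod (g v))\<^sup>2"])
     (auto simp: ell2_carrier_iff cmod_add_square_le intro!: summable_on_add summable_on_cmult_right)

lemma ell2_restrict_in:
  "f \<in> carrier (ell2 V) \<Longrightarrow> (\<lambda>v. if v \<in> A then f v else 0) \<in> carrier (ell2 V)"
  by (rule ell2_comparison[OF ell2_summable]) (auto simp: ell2_carrier_iff)

definition ket :: "'v \<Rightarrow> 'v \<Rightarrow> complex" where
  "ket u = (\<lambda>v. if v = u then 1 else 0)"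

lemma ket_in: "u \<in> V \<Longrightarrow> ket u \<in> carrier (ell2 V)"
proof -
  assume u: "u \<in> V"
  have "(\<lambda>v. (cmod (ket u v))\<^sup>2) summable_on {u}" by simp
  then have "(\<lambda>v. (cmod (ket u v))\<^sup>2) summable_on V"
    by (rule summable_on_cong_neutral[THEN iffD1, rotated 3]) (use u in \<open>auto simp: ket_def\<close>)
  then show ?thesis using u by (auto simp: ell2_carrier_iff ket_def)
qed

lemma hnorm_ell2_square:
  "f \<in> carrier (ell2 V) \<Longrightarrow> (hnorm (ell2 V) f)\<^sup>2 = (\<Sum>\<^sub>\<infinity>v\<in>V. (cmod (f v))\<^sup>2)"
  and hnorm_ell2_nonneg: "f \<in> carrier (ell2 V) \<Longrightarrow> 0 \<le> hnorm (ell2 V) f"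
  and cinner_ell2_self: "f \<in> carrier (ell2 V) \<Longrightarrow> cinner (ell2 V) f f = of_real (\<Sum>\<^sub>\<infinity>v\<in>V. (cmod (f v))\<^sup>2)"
proof -
  assume f: "f \<in> carrier (ell2 V)"
  have "cinner (ell2 V) f f = (\<Sum>\<^sub>\<infinity>v\<in>V. of_real ((cmod (f v))\<^sup>2))"
    by (simp add: ell2_sel flip: complex_norm_square)
  also have "\<dots> = of_real (\<Sum>\<^sub>\<infinity>v\<in>V. (cmod (f v))\<^sup>2)"
    by (rule infsumI has_sum_of_real has_sum_infsum ell2_summable f)+
  finally show *: "cinner (ell2 V) f f = of_real (\<Sum>\<^sub>\<infinity>v\<in>V. (cmod (f v))\<^sup>2)" .
  show "(hnorm (ell2 V) f)\<^sup>2 = (\<Sum>\<^sub>\<infinity>v\<in>V. (cmod (f v))\<^sup>2)" "0 \<le> hnorm (ell2 V) f"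
    by (simp_all add: hnorm_def * infsum_nonneg)
qed

lemma ell2_abs_summable:
  assumes f: "f \<in> carrier (ell2 V)" and g: "g \<in> carrier (ell2 V)"
  shows "(\<lambda>v. f v * cnj (g v)) abs_summable_on V"
proof (rule abs_summable_on_comparison_test'[OF summable_on_add[OF ell2_summable[OF f] ell2_summable[OF g]]])
  fix v
  have "2 * (cmod (f v) * cmod (g v)) \<le> (cmod (f v))\<^sup>2 + (cmod (g v))\<^sup>2"
    using sum_squares_bound[of "cmod (f v)" "cmod (g v)"] by simp
  moreover have "0 \<le> cmod (f v) * cmod (g v)" by simp
  ultimately have "cmod (f v) * cmod (g v) \<le> (cmod (f v))\<^sup>2 + (cmod (g v))\<^sup>2" by linarith
  then show "cmod (f v * cnj (g v)) \<le> (cmod (f v))\<^sup>2 + (cmod (g v))\<^sup>2"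
    by (simp add: norm_mult)
qed

lemma hnorm_ell2_smult: "hnorm (ell2 V) (\<lambda>v. c * f v) = cmod c * hnorm (ell2 V) f"
proof -
  have "cinner (ell2 V) (\<lambda>v. c * f v) (\<lambda>v. c * f v) = (\<Sum>\<^sub>\<infinity>v\<in>V. (c * cnj c) * (f v * cnj (f v)))"
    by (simp add: ell2_sel mult_ac)
  also have "\<dots> = of_real ((cmod c)\<^sup>2) * cinner (ell2 V) f f"
    by (simp add: ell2_sel infsum_cmult_right' flip: complex_norm_square)
  finally show ?thesis by (simp add: hnorm_def real_sqrt_mult del: of_real_power)
qed

lemma ell2_subset:
  assumes D: "D \<subseteq> V"
  shows "f \<in> carrier (ell2 D) \<longleftrightarrow> f \<in> carrier (ell2 V) \<and> (\<forall>v. v \<notin> D \<longrightarrow> f v = 0)"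
proof -
  have "(\<lambda>v. (cmod (f v))\<^sup>2) summable_on D \<longleftrightarrow> (\<lambda>v. (cmod (f v))\<^sup>2) summable_on V"
    if "\<forall>v. v \<notin> D \<longrightarrow> f v = 0"
    by (rule summable_on_cong_neutral) (use that D in auto)
  then show ?thesis using D by (auto simp: ell2_carrier_iff)
qed

lemma cinner_ell2_subset:
  assumes D: "D \<subseteq> V" and f: "f \<in> carrier (ell2 D)"
  shows "cinner (ell2 D) f g = cinner (ell2 V) f g"
  unfolding ell2_sel by (rule infsum_cong_neutral) (use D f in \<open>auto simp: ell2_zero_outside\<close>)

lemma hnorm_ell2_subset: "D \<subseteq> V \<Longrightarrow> f \<in> carrier (ell2 D) \<Longrightarrow> hnorm (ell2 D) f = hnorm (ell2 V) f"
  by (simp add: hnorm_def cinner_ell2_subset)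

lemma cinner_ell2_disjoint: "(\<And>v. f v = 0 \<or> g v = 0) \<Longrightarrow> cinner (ell2 V) f g = 0"
  unfolding ell2_sel by (rule infsum_0) auto

text \<open>Scaling \<open>f\<close> to norm 1 reduces this to the definition; boundedness of
  \<open>T\<close> is what makes the supremum an upper bound.\<close>

lemma hnorm_le_op_norm:
  assumes T: "bounded_operator (ell2 V) T" and f: "f \<in> carrier (ell2 V)"
  shows "hnorm (ell2 V) (T f) \<le> op_norm (ell2 V) T * hnorm (ell2 V) f"
proof -
  obtain C where C: "\<And>x. x \<in> carrier (ell2 V) \<Longrightarrow> hnorm (ell2 V) (T x) \<le> C * hnorm (ell2 V) x"
    and lin: "clinear_map (ell2 V) (ell2 V) T" using T by (auto simp: bounded_operator_def)
  note Tin = clinear_mapD(1)[OF lin]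
  let ?n = "hnorm (ell2 V) f"
  show ?thesis
  proof (cases "?n = 0")
    case True then show ?thesis using C[OF f] by simp
  next
    case False
    then have pos: "?n > 0" using hnorm_ell2_nonneg[OF f] by simp
    let ?g = "\<lambda>v. of_real (1 / ?n) * f v"
    have g: "?g \<in> carrier (ell2 V)" by (rule ell2_smult_in[OF f])
    have ng: "hnorm (ell2 V) ?g = 1" using pos unfolding hnorm_ell2_smult by (simp add: norm_divide)
    have "T ?g = (\<lambda>v. of_real (1 / ?n) * T f v)"
      using clinear_mapD(3)[OF lin f, of "of_real (1 / ?n)"] by (simp add: ell2_sel)
    then have Tg: "hnorm (ell2 V) (T ?g) = hnorm (ell2 V) (T f) / ?n"
      using pos by (simp only: hnorm_ell2_smult) (simp add: norm_divide)
    have "bdd_above ((\<lambda>x. hnorm (ell2 V) (T x)) ` {x \<in> carrier (ell2 V). hnorm (ell2 V) x \<le> 1})"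
    proof (rule bdd_aboveI2)
      fix x assume x: "x \<in> {x \<in> carrier (ell2 V). hnorm (ell2 V) x \<le> 1}"
      then have "hnorm (ell2 V) (T x) \<le> C * hnorm (ell2 V) x" using C by simp
      also have "\<dots> \<le> \<bar>C\<bar> * 1"
        using x hnorm_ell2_nonneg[of x V] by (intro mult_mono) auto
      finally show "hnorm (ell2 V) (T x) \<le> \<bar>C\<bar> * 1" .
    qed
    then have "hnorm (ell2 V) (T ?g) \<le> op_norm (ell2 V) T"
      unfolding op_norm_def using g ng by (intro cSUP_upper) auto
    then show ?thesis unfolding Tg using pos by (simp add: pos_divide_le_eq)
  qed
qed

lemma op_norm_ell2_le:
  assumes C: "0 \<le> C" and le: "\<And>f. f \<in> carrier (ell2 V) \<Longrightarrow> hnorm (ell2 V) (T f) \<le> C * hnorm (ell2 V) f"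
  shows "op_norm (ell2 V) T \<le> C"
  unfolding op_norm_def
proof (rule cSUP_least)
  have "hnorm (ell2 V) (\<lambda>v. 0) \<le> 1" by (simp add: hnorm_def ell2_sel)
  then show "{x \<in> carrier (ell2 V). hnorm (ell2 V) x \<le> 1} \<noteq> {}" using ell2_zero_in by blast
  fix f assume f: "f \<in> {x \<in> carrier (ell2 V). hnorm (ell2 V) x \<le> 1}"
  then have "hnorm (ell2 V) (T f) \<le> C * hnorm (ell2 V) f" using le by simp
  also have "\<dots> \<le> C * 1" using f C by (intro mult_left_mono) auto
  finally show "hnorm (ell2 V) (T f) \<le> C" by simp
qed

section \<open>Depth and descendants in a rooted tree\<close>

locale rooted_tree =
  fixes V :: "'v set" and p :: "'v \<Rightarrow> 'v" and \<omega> :: 'v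
  assumes tree: "directed_tree V p" and root: "is_root V p \<omega>"
begin

lemma p_in [simp]: "v \<in> V \<Longrightarrow> p v \<in> V"
  using tree by (auto simp: directed_tree_def directed_forest_def)

lemma parent_pow_in [simp]: "v \<in> V \<Longrightarrow> (p ^^ n) v \<in> V"
  by (induction n) auto

lemma root_in [simp]: "\<omega> \<in> V" and p_root [simp]: "p \<omega> = \<omega>"
  using root by (auto simp: is_root_def)

lemma parent_pow_root [simp]: "(p ^^ n) \<omega> = \<omega>"
  by (induction n) auto

definition depth :: "'v \<Rightarrow> nat" where
  "depth v = (LEAST n. (p ^^ n) v = \<omega>)"

text \<open>The tree property for \<open>v\<close> and \<open>\<omega>\<close> yields a path from
  \<open>v\<close> to the root, which \<open>p\<close> fixes; once reached, the root is never
  left.\<close>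

lemma pow_eq_root_iff:
  assumes v: "v \<in> V" shows "(p ^^ n) v = \<omega> \<longleftrightarrow> depth v \<le> n"
proof
  show "(p ^^ n) v = \<omega> \<Longrightarrow> depth v \<le> n" unfolding depth_def by (rule Least_le)
  obtain m m' where "(p ^^ m) v = (p ^^ m') \<omega>"
    using tree v root_in unfolding directed_tree_def by blast
  then have "(p ^^ depth v) v = \<omega>" unfolding depth_def by (intro LeastI) auto
  moreover assume "depth v \<le> n"
  then have "(p ^^ n) v = (p ^^ (n - depth v)) ((p ^^ depth v) v)"
    by (simp flip: funpow_add[THEN fun_cong, unfolded o_def])
  ultimately show "(p ^^ n) v = \<omega>" by simp
qed

lemma depth_pow: assumes v: "v \<in> V" shows "depth ((p ^^ n) v) = depth v - n"
proof -
  have "depth ((p ^^ n) v) \<le> m \<longleftrightarrow> depth v - n \<le> m" for m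
    using pow_eq_root_iff[of "(p ^^ n) v" m] pow_eq_root_iff[OF v, of "m + n"] v
    by (auto simp: funpow_add)
  then show ?thesis by (meson le_antisym order_refl)
qed

lemma depth_p: "v \<in> V \<Longrightarrow> depth (p v) = depth v - 1"
  using depth_pow[of v 1] by simp

lemma depth_0_iff: "v \<in> V \<Longrightarrow> depth v = 0 \<longleftrightarrow> v = \<omega>"
  using pow_eq_root_iff[of v 0] by auto

lemma depth_root [simp]: "depth \<omega> = 0"
  using depth_0_iff by simp

lemma is_root_iff: "is_root V p v \<longleftrightarrow> v = \<omega>"
proof
  assume v: "is_root V p v"
  then have "(p ^^ n) v = v" for n by (induction n) (auto simp: is_root_def)
  then show "v = \<omega>" using v pow_eq_root_iff[of v "depth v"] by (auto simp: is_root_def)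
qed (use root in simp)

lemma Chi_root:
  assumes "k \<ge> 1" shows "Chi V p k \<omega> = {u \<in> V. depth u = k}"
proof -
  have "(p ^^ k) u = \<omega> \<and> \<omega> \<noteq> (p ^^ (k - 1)) u \<longleftrightarrow> depth u = k" if "u \<in> V" for u
    using pow_eq_root_iff[OF that, of k] pow_eq_root_iff[OF that, of "k - 1"] assms by auto
  then show ?thesis using assms by (auto simp: Chi_def)
qed

text \<open>Depth leaves only one possible number \<open>n\<close> of generations between
  \<open>u\<close> and \<open>v\<close>. The inequality in \<open>Chi\<close> rules out counts
  beyond \<open>depth u\<close>, for then both iterates would be the root.\<close>

lemma mem_Des_iff:
  assumes v: "v \<in> V"
  shows "u \<in> Des V p v \<longleftrightarrow> u \<in> V \<and> depth v \<le> depth u \<and> (p ^^ (depth u - depth v)) u = v"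
proof
  assume "u \<in> Des V p v"
  then obtain n where n: "u \<in> Chi V p n v" by (auto simp: Des_def)
  show "u \<in> V \<and> depth v \<le> depth u \<and> (p ^^ (depth u - depth v)) u = v"
  proof (cases n)
    case 0 then show ?thesis using n v by (simp add: Chi_def)
  next
    case (Suc m)
    then have u: "u \<in> V" "(p ^^ n) u = v" "v \<noteq> (p ^^ m) u" using n by (auto simp: Chi_def)
    have "n \<le> depth u"
    proof (rule ccontr)
      assume "\<not> n \<le> depth u"
      then have "v = \<omega>" "(p ^^ m) u = \<omega>"
        using u pow_eq_root_iff[OF u(1), of n] pow_eq_root_iff[OF u(1), of m] Suc by auto
      then show False using u by simp
    qed
    moreover have "depth v = depth u - n" using depth_pow[OF u(1)] u(2) by blast
    ultimately show ?thesis using u by simp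
  qed
next
  assume u: "u \<in> V \<and> depth v \<le> depth u \<and> (p ^^ (depth u - depth v)) u = v"
  define n where "n = depth u - depth v"
  have n: "u \<in> V" "(p ^^ n) u = v" "depth v + n = depth u" using u by (simp_all add: n_def)
  have "u \<in> Chi V p n v"
  proof (cases n)
    case 0 then show ?thesis using n(2) by (simp add: Chi_def)
  next
    case (Suc m)
    then have "depth ((p ^^ m) u) \<noteq> depth v" using n depth_pow[of u m] by simp
    then show ?thesis using n Suc by (auto simp: Chi_def)
  qed
  then show "u \<in> Des V p v" unfolding Des_def by blast
qed

lemma Des_subset: "v \<in> V \<Longrightarrow> Des V p v \<subseteq> V"
  by (auto simp: mem_Des_iff)

lemma Des_self: "v \<in> V \<Longrightarrow> v \<in> Des V p v"
  by (simp add: mem_Des_iff)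

lemma depth_Des: "v \<in> V \<Longrightarrow> u \<in> Des V p v \<Longrightarrow> u \<noteq> v \<Longrightarrow> depth v < depth u"
  by (cases "depth u = depth v") (auto simp: mem_Des_iff)

lemma p_mem_Des_iff:
  assumes v: "v \<in> V" "v \<noteq> \<omega>" and u: "u \<in> V" "u \<noteq> v"
  shows "p u \<in> Des V p v \<longleftrightarrow> u \<in> Des V p v"
proof (cases "depth v < depth u")
  case True
  then have eq: "depth u - depth v = Suc (depth u - 1 - depth v)" by simp
  have "(p ^^ (depth u - depth v)) u = (p ^^ (depth u - 1 - depth v)) (p u)"
    unfolding eq by (simp add: funpow_swap1)
  then show ?thesis using v u True by (auto simp: mem_Des_iff depth_p)
next
  case False
  have "depth v \<noteq> 0" using v depth_0_iff by simp
  then have "p u \<notin> Des V p v" using False v u by (auto simp: mem_Des_iff depth_p)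
  moreover have "u \<notin> Des V p v" using False depth_Des v u by blast
  ultimately show ?thesis by simp
qed

text \<open>The shift on a branch is the shift on the whole tree restricted to functions on the
  branch: at \<open>v\<close> both sides vanish because \<open>p v\<close> lies outside. Only
  weights deeper than \<open>v\<close> enter, so the two systems of weights may differ
  elsewhere.\<close>

lemma weighted_shift_subtree:
  assumes v: "v \<in> V" "v \<noteq> \<omega>" and f: "\<And>u. u \<notin> Des V p v \<Longrightarrow> f u = 0"
    and agree: "\<And>u. u \<in> V \<Longrightarrow> depth v < depth u \<Longrightarrow> lam' u = lam u"
  shows "weighted_shift (Des V p v) (subtree_parent p v) (subtree_weights lam v) f
    = weighted_shift V p lam' f"
proof
  fix u
  have pv: "p v \<notin> Des V p v"
    using v depth_0_iff[of v] by (auto simp: mem_Des_iff depth_p)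
  show "weighted_shift (Des V p v) (subtree_parent p v) (subtree_weights lam v) f u
      = weighted_shift V p lam' f u"
  proof (cases "u \<in> Des V p v \<and> u \<noteq> v")
    case True
    then show ?thesis using agree[of u] depth_Des[of v u] Des_subset[of v] v
      by (auto simp: weighted_shift_def subtree_parent_def subtree_weights_def)
  next
    case False
    then have "u \<in> V \<Longrightarrow> f (p u) = 0" using p_mem_Des_iff[OF v, of u] f pv by (cases "u = v") auto
    then show ?thesis using False
      by (auto simp: weighted_shift_def subtree_parent_def subtree_weights_def)
  qed
qed

lemma proper_weights_iff: "proper_weights V p lam \<longleftrightarrow> (\<forall>v\<in>V. v \<noteq> \<omega> \<longrightarrow> lam v \<noteq> 0)"
  by (auto simp: proper_weights_def is_root_iff)

lemma is_weights_iff: "is_weights V p lam \<longleftrightarrow> lam \<omega> = 0"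
  by (auto simp: is_weights_def is_root_iff)

text \<open>The \<open>n\<close>-th power at \<open>u\<close> sees only the value at
  \<open>(p ^^ n) u\<close>. The bound \<open>n \<le> depth u\<close> holds because a longer path
  passes through the zero weight at the root.\<close>

lemma weighted_shift_pow_support:
  assumes lam: "lam \<omega> = 0" and f: "\<And>u. u \<notin> V \<Longrightarrow> f u = 0"
    and nz: "(weighted_shift V p lam ^^ n) f u \<noteq> 0"
  shows "u \<in> V \<and> n \<le> depth u \<and> f ((p ^^ n) u) \<noteq> 0"
  using nz
proof (induction n arbitrary: u)
  case 0 then show ?case using f by auto
next
  case (Suc n)
  then have u: "u \<in> V" "lam u \<noteq> 0" "(weighted_shift V p lam ^^ n) f (p u) \<noteq> 0"
    by (auto simp: weighted_shift_def[of V p lam "(weighted_shift V p lam ^^ n) f"] split: if_splits)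
  then have "depth u \<noteq> 0" using lam depth_0_iff by auto
  then show ?case using Suc.IH[OF u(3)] u(1) by (auto simp: depth_p funpow_swap1)
qed

end

section \<open>Graded pieces of a normal extension\<close>

lemma (in complex_hilbert_space) orthocomp_in: "x \<in> orthocomp G \<Longrightarrow> x \<in> carrier H"
  by (simp add: orthocomp_def)

lemma (in complex_hilbert_space) orthocomp_add:
  "G \<subseteq> carrier H \<Longrightarrow> x \<in> orthocomp G \<Longrightarrow> y \<in> orthocomp G \<Longrightarrow> x \<oplus> y \<in> orthocomp G"
  by (auto simp: orthocomp_def cinner_simps subset_iff)

lemma (in complex_hilbert_space) orthocomp_minus:
  "G \<subseteq> carrier H \<Longrightarrow> x \<in> orthocomp G \<Longrightarrow> y \<in> orthocomp G \<Longrightarrow> x \<ominus> y \<in> orthocomp G"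
  by (auto simp: orthocomp_def cinner_simps subset_iff)

lemma (in complex_hilbert_space) orthocomp_smult:
  "G \<subseteq> carrier H \<Longrightarrow> x \<in> orthocomp G \<Longrightarrow> c \<odot> x \<in> orthocomp G"
  by (auto simp: orthocomp_def cinner_simps subset_iff)

context normal_pair begin

lemma pow'_in [simp]: "x \<in> carrier K \<Longrightarrow> (N' ^^ n) x \<in> carrier K"
  by (induction n) auto

lemma cinner_pow:
  "x \<in> carrier K \<Longrightarrow> y \<in> carrier K \<Longrightarrow> cinner K ((N ^^ n) x) y = cinner K x ((N' ^^ n) y)"
  by (induction n arbitrary: y) (simp_all add: cinner_N funpow_swap1[of N'])

end

text \<open>The only properties of a branch that the grading needs. \<open>F m\<close> stands for
  the images of functions on level \<open>m\<close>; these sets need not be subspaces.\<close>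

locale graded_normal = normal_pair K N N' for K :: "'k inner_space" (structure) and N N' +
  fixes F :: "nat \<Rightarrow> 'k set"
  assumes F_in: "y \<in> F m \<Longrightarrow> y \<in> carrier K"
    and F_N: "y \<in> F m \<Longrightarrow> N y \<in> F (Suc m)"
    and F_orth: "y \<in> F m \<Longrightarrow> y' \<in> F m' \<Longrightarrow> m \<noteq> m' \<Longrightarrow> cinner K y y' = 0"
begin

text \<open>The orthogonal complement of all \<open>(N' ^^ i) y\<close> with \<open>y\<close> in
  \<open>F (d + i)\<close>, vectors of degree \<open>d\<close> since \<open>N'\<close> lowers the
  degree by one. The complement of \<open>copiece d\<close>, called \<open>piece d\<close>, is then
  their closed span.\<close>

definition copiece :: "nat \<Rightarrow> 'k set" where
  "copiece d = {z \<in> carrier K. \<forall>i. \<forall>y\<in>F (d + i). cinner K ((N ^^ i) z) y = 0}"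

definition piece :: "nat \<Rightarrow> 'k set" where
  "piece d = orthocomp (copiece d)"

lemma copiece_in: "z \<in> copiece d \<Longrightarrow> z \<in> carrier K"
  by (simp add: copiece_def)

lemma copiece_orthocomp: "copiece d = orthocomp (\<Union>i. (N' ^^ i) ` F (d + i))"
  by (auto simp: copiece_def orthocomp_def cinner_pow F_in)

lemma generators_in: "(\<Union>i. (N' ^^ i) ` F (d + i)) \<subseteq> carrier K"
  using F_in by auto

lemma copiece_sub: "copiece d \<subseteq> carrier K"
  using copiece_in by blast

lemmas copiece_add = orthocomp_add[OF generators_in, folded copiece_orthocomp]
lemmas copiece_smult = orthocomp_smult[OF generators_in, folded copiece_orthocomp]
lemmas copiece_minus = orthocomp_minus[OF generators_in, folded copiece_orthocomp]
lemmas piece_smult = orthocomp_smult[OF copiece_sub, folded piece_def]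
lemmas piece_minus = orthocomp_minus[OF copiece_sub, folded piece_def]
lemmas piece_in = orthocomp_in[of _ "copiece d" for d, folded piece_def]
lemmas piece_decomposition = orthogonal_decomposition[OF generators_in, folded copiece_orthocomp, folded piece_def]

lemma piece_orth_copiece: "x \<in> piece d \<Longrightarrow> z \<in> copiece d \<Longrightarrow> cinner K x z = 0"
  by (simp add: piece_def orthocomp_def)

lemma F_piece: "y \<in> F d \<Longrightarrow> y \<in> piece d"
proof -
  assume y: "y \<in> F d"
  have "cinner K y z = 0" if z: "z \<in> copiece d" for z
  proof -
    have "cinner K ((N ^^ 0) z) y = 0" using z y unfolding copiece_def by fastforce
    then show ?thesis using cinner_commute[of z y] F_in[OF y] copiece_in[OF z] by simp
  qed
  then show ?thesis using F_in[OF y] by (simp add: piece_def orthocomp_def)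
qed

lemma N_copiece: "z \<in> copiece d \<Longrightarrow> N z \<in> copiece (Suc d)"
proof -
  assume z: "z \<in> copiece d"
  have "cinner K ((N ^^ i) (N z)) y = 0" if y: "y \<in> F (Suc d + i)" for i y
  proof -
    have "cinner K ((N ^^ Suc i) z) y = 0" using z y unfolding copiece_def by fastforce
    then show ?thesis by (simp add: funpow_swap1)
  qed
  then show ?thesis using copiece_in[OF z] by (simp add: copiece_def)
qed

text \<open>Moved to the other side, \<open>N'\<close> becomes \<open>N\<close> acting on
  \<open>F\<close>, where it raises the level. By duality \<open>N\<close> maps
  \<open>piece d\<close> into \<open>piece (Suc d)\<close>.\<close>

lemma N'_copiece: "z \<in> copiece (Suc d) \<Longrightarrow> N' z \<in> copiece d"
proof -
  assume z: "z \<in> copiece (Suc d)"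
  have "cinner K ((N ^^ i) (N' z)) y = 0" if y: "y \<in> F (d + i)" for i y
  proof -
    have "N y \<in> F (Suc d + i)" using F_N[OF y] by simp
    then have "cinner K ((N ^^ i) z) (N y) = 0" using z unfolding copiece_def by blast
    then show ?thesis using copiece_in[OF z] F_in[OF y] by (simp add: pow_commute cinner_N')
  qed
  then show ?thesis using copiece_in[OF z] by (simp add: copiece_def)
qed

lemma N_piece:
  assumes x: "x \<in> piece d" shows "N x \<in> piece (Suc d)"
proof -
  have "cinner K (N x) z = 0" if z: "z \<in> copiece (Suc d)" for z
    using piece_orth_copiece[OF x N'_copiece[OF z]] piece_in[OF x] copiece_in[OF z] by (simp add: cinner_N)
  then show ?thesis using piece_in[OF x] by (simp add: piece_def orthocomp_def)
qed

lemma N_pow_piece: "x \<in> piece d \<Longrightarrow> (N ^^ n) x \<in> piece (d + n)"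
  by (induction n) (auto intro: N_piece)

lemma N_pow_F: "y \<in> F d \<Longrightarrow> (N ^^ n) y \<in> F (d + n)"
  by (induction n) (auto intro: F_N)

lemma F_copiece:
  assumes y: "y \<in> F d" and ne: "d \<noteq> d'" shows "y \<in> copiece d'"
proof -
  have "cinner K ((N ^^ i) y) y' = 0" if y': "y' \<in> F (d' + i)" for i y'
    by (rule F_orth[OF N_pow_F[OF y] y']) (use ne in simp)
  then show ?thesis using F_in[OF y] by (simp add: copiece_def)
qed

text \<open>Powers of \<open>N\<close> keep \<open>x'\<close> in pieces of degree
  \<open>d' + i\<close>, while \<open>F (d + i)\<close> lies in the corresponding copiece because
  the degrees differ. Hence \<open>x'\<close> lies in \<open>copiece d\<close>, to which
  \<open>x\<close> is orthogonal.\<close>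

lemma pieces_orth:
  assumes x: "x \<in> piece d" and x': "x' \<in> piece d'" and ne: "d \<noteq> d'"
  shows "cinner K x x' = 0"
proof -
  have "cinner K ((N ^^ i) x') y = 0" if y: "y \<in> F (d + i)" for i y
    by (rule piece_orth_copiece[OF N_pow_piece[OF x'] F_copiece[OF y]]) (use ne in simp)
  then have "x' \<in> copiece d" using piece_in[OF x'] by (simp add: copiece_def)
  then show ?thesis by (rule piece_orth_copiece[OF x])
qed

text \<open>
  \<open>N\<close> raises the degree by one and commutes with the projections onto the pieces. Hence projecting
  a chain that \<open>N\<close> descends up to errors orthogonal to the pieces gives an exact chain.
\<close>

lemma descending_chain:
  fixes e r :: "nat \<Rightarrow> 'k" and c :: "nat \<Rightarrow> complex"
  assumes e0: "e 0 \<in> F k" "e 0 \<noteq> \<zero>" and e_in: "\<And>i. i \<le> k \<Longrightarrow> e i \<in> carrier K"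
    and r: "\<And>i. i < k \<Longrightarrow> r i \<in> copiece (k - i)"
    and step: "\<And>i. i < k \<Longrightarrow> N (e (Suc i)) = c i \<odot> e i \<oplus> r i"
    and c: "\<And>i. i < k \<Longrightarrow> c i \<noteq> 0"
  obtains x where "x 0 = e 0" "\<And>i. i \<le> k \<Longrightarrow> x i \<in> piece (k - i)" "\<And>i. i \<le> k \<Longrightarrow> x i \<noteq> \<zero>"
    "\<And>i. i < k \<Longrightarrow> N (x (Suc i)) = c i \<odot> x i"
proof -
  \<comment> \<open>Index 0 is treated apart so that \<open>x 0\<close> is \<open>e 0\<close>
    itself, which already lies in its piece. The guard \<open>i \<le> k\<close> makes the choice
    total.\<close>
  have "\<exists>z m. (i \<le> k \<longrightarrow> z \<in> copiece (k - i) \<and> m \<in> piece (k - i) \<and> e i = z \<oplus> m) \<and> (i = 0 \<longrightarrow> m = e 0)" for i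
  proof (cases "i = 0")
    case True
    have "\<zero> \<in> copiece k" using pow_zero F_in by (auto simp: copiece_def cinner_zero_left)
    then show ?thesis using True F_piece[OF e0(1)] e_in[of 0] by (intro exI[of _ \<zero>] exI[of _ "e 0"]) auto
  next
    case False
    then show ?thesis using piece_decomposition[OF e_in, of i "k - i"] by (cases "i \<le> k") blast+
  qed
  then obtain z x where zx: "\<And>i. i \<le> k \<Longrightarrow> z i \<in> copiece (k - i)" "\<And>i. i \<le> k \<Longrightarrow> x i \<in> piece (k - i)"
    "\<And>i. i \<le> k \<Longrightarrow> e i = z i \<oplus> x i" "x 0 = e 0" by metis
  have exact: "N (x (Suc i)) = c i \<odot> x i" if i: "i < k" for i
  proof -
    \<comment> \<open>The error \<open>?w\<close> lies in the piece, since \<open>N\<close> raises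
      degrees, and in the copiece, being also a combination of the discarded components. So it is
      orthogonal to itself.\<close>
    let ?w = "N (x (Suc i)) \<ominus> c i \<odot> x i"
    have deg: "Suc (k - Suc i) = k - i" using i by simp
    have in': "x i \<in> carrier K" "z i \<in> carrier K" "x (Suc i) \<in> carrier K" "z (Suc i) \<in> carrier K" "r i \<in> carrier K"
      using piece_in[OF zx(2)[of i]] piece_in[OF zx(2)[of "Suc i"]] copiece_in[OF zx(1)[of i]]
        copiece_in[OF zx(1)[of "Suc i"]] copiece_in[OF r[OF i]] i by simp_all
    have w_piece: "?w \<in> piece (k - i)"
      using N_piece[OF zx(2)[of "Suc i"]] zx(2)[of i] i deg by (auto intro: piece_minus piece_smult)
    have eq: "?w = (c i \<odot> z i \<oplus> r i) \<ominus> N (z (Suc i))"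
    proof (rule eqI_inner)
      fix t assume t: "t \<in> carrier K"
      have "cinner K (N (e (Suc i))) t = cinner K (c i \<odot> e i \<oplus> r i) t" using step[OF i] by simp
      then show "cinner K ?w t = cinner K ((c i \<odot> z i \<oplus> r i) \<ominus> N (z (Suc i))) t"
        using zx(3)[of i] zx(3)[of "Suc i"] i t in' by (simp add: N_add cinner_simps algebra_simps)
    qed (use in' in auto)
    have "N (z (Suc i)) \<in> copiece (k - i)" using N_copiece[OF zx(1)[of "Suc i"]] i deg by simp
    then have "?w \<in> copiece (k - i)"
      unfolding eq using zx(1)[of i] r[OF i] i by (auto intro: copiece_add copiece_minus copiece_smult)
    then have "cinner K ?w ?w = 0" by (rule piece_orth_copiece[OF w_piece])
    then have "hnorm K ?w = 0" by (simp add: hnorm_def)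
    then show ?thesis using in' by (simp add: hnorm_eq_0_iff minus_eq_zero_iff)
  qed
  have nz: "x i \<noteq> \<zero>" if "i \<le> k" for i
    using that
  proof (induction i)
    case 0 show ?case using e0(2) zx(4) by simp
  next
    case (Suc i)
    then have x: "x i \<in> carrier K" "x i \<noteq> \<zero>" using zx(2)[of i] piece_in by auto
    have "hnorm K (c i \<odot> x i) \<noteq> 0" using x c[of i] Suc by (simp add: hnorm_smult hnorm_eq_0_iff)
    then have "N (x (Suc i)) \<noteq> \<zero>" using exact[of i] Suc hnorm_zero by auto
    then show ?case using pow_zero[of 1] by auto
  qed
  show ?thesis using zx(2,4) exact nz by (intro that[of x]) auto
qed

end

primrec comb :: "'h inner_space \<Rightarrow> (nat \<Rightarrow> complex) \<Rightarrow> (nat \<Rightarrow> 'h) \<Rightarrow> nat \<Rightarrow> 'h" where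
  "comb H c y 0 = \<zero>\<^bsub>H\<^esub>"
| "comb H c y (Suc n) = comb H c y n \<oplus>\<^bsub>H\<^esub> c n \<odot>\<^bsub>H\<^esub> y n"

lemma (in complex_hilbert_space) comb_in:
  "(\<And>i. i < n \<Longrightarrow> y i \<in> carrier H) \<Longrightarrow> comb H c y n \<in> carrier H"
  by (induction n) auto

lemma (in complex_hilbert_space) cinner_comb:
  "(\<And>i. i < n \<Longrightarrow> y i \<in> carrier H) \<Longrightarrow> z \<in> carrier H
    \<Longrightarrow> cinner H (comb H c y n) z = (\<Sum>i<n. c i * cinner H (y i) z)"
  by (induction n) (auto simp: cinner_simps comb_in)

lemma (in complex_hilbert_space) cinner_comb_orthonormal:
  assumes y: "\<And>i. i < n \<Longrightarrow> y i \<in> carrier H"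
    and orth: "\<And>i j. i < n \<Longrightarrow> j < n \<Longrightarrow> cinner H (y i) (y j) = (if i = j then 1 else 0)"
  shows "cinner H (comb H c y n) (comb H d y n) = (\<Sum>i<n. c i * cnj (d i))"
proof -
  have "cinner H (y i) (comb H d y n) = cnj (d i)" if i: "i < n" for i
  proof -
    have "cinner H (comb H d y n) (y i) = (\<Sum>j<n. d j * (if j = i then 1 else 0))"
      using y i orth by (simp add: cinner_comb)
    also have "\<dots> = d i" using i by (simp add: sum.delta mult_delta_right)
    finally show ?thesis using cinner_commute[of "comb H d y n" "y i"] comb_in[of n y d] y i by simp
  qed
  then show ?thesis using y by (simp add: cinner_comb comb_in)
qed

lemma (in normal_pair) cinner_N_comb:
  "(\<And>i. i < n \<Longrightarrow> y i \<in> carrier K) \<Longrightarrow> z \<in> carrier K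
    \<Longrightarrow> cinner K (N (comb K c y n)) z = (\<Sum>i<n. c i * cinner K (N (y i)) z)"
  by (simp add: cinner_N cinner_comb comb_in)

section \<open>Backward extensions of subtrees\<close>

lemma mem_backward_verts [simp]:
  "Inl u \<in> backward_verts k D \<longleftrightarrow> u \<in> D" "Inr j \<in> backward_verts k D \<longleftrightarrow> 1 \<le> j \<and> j \<le> k"
  by (auto simp: backward_verts_def)

lemma summable_on_backward_verts:
  fixes f :: "'v + nat \<Rightarrow> real"
  shows "f summable_on backward_verts k D \<longleftrightarrow> (\<lambda>u. f (Inl u)) summable_on D"
proof -
  have "f summable_on backward_verts k D \<longleftrightarrow> f summable_on Inl ` D"
  proof
    assume "f summable_on backward_verts k D"
    then show "f summable_on Inl ` D"
      by (rule summable_on_subset_banach) (auto simp: backward_verts_def)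
  next
    assume "f summable_on Inl ` D"
    then show "f summable_on backward_verts k D"
      unfolding backward_verts_def by (intro summable_on_Un_disjoint) auto
  qed
  then show ?thesis by (simp add: summable_on_reindex o_def)
qed

lemma ell2_backward_iff:
  "g \<in> carrier (ell2 (backward_verts k D)) \<longleftrightarrow>
    (\<lambda>u. g (Inl u)) \<in> carrier (ell2 D) \<and> (\<forall>j. \<not> (1 \<le> j \<and> j \<le> k) \<longrightarrow> g (Inr j) = 0)"
  unfolding ell2_carrier_iff summable_on_backward_verts
  by (auto simp: split_sum_all)

lemma cinner_ell2_backward:
  assumes g: "g \<in> carrier (ell2 (backward_verts k D))" and h: "h \<in> carrier (ell2 (backward_verts k D))"
  shows "cinner (ell2 (backward_verts k D)) g h =
    cinner (ell2 D) (\<lambda>u. g (Inl u)) (\<lambda>u. h (Inl u)) + (\<Sum>j<k. g (Inr (Suc j)) * cnj (h (Inr (Suc j))))"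
proof -
  let ?f = "\<lambda>x. g x * cnj (h x)"
  have "?f summable_on backward_verts k D" by (rule abs_summable_summable[OF ell2_abs_summable[OF g h]])
  then have "?f summable_on Inl ` D" by (rule summable_on_subset_banach) (auto simp: backward_verts_def)
  then have "infsum ?f (backward_verts k D) = infsum ?f (Inl ` D) + infsum ?f (Inr ` {1..k})"
    unfolding backward_verts_def by (intro infsum_Un_disjoint) auto
  moreover have "infsum ?f (Inl ` D) = cinner (ell2 D) (\<lambda>u. g (Inl u)) (\<lambda>u. h (Inl u))"
    by (simp add: infsum_reindex o_def ell2_sel)
  moreover have "infsum ?f (Inr ` {1..k}) = (\<Sum>j<k. g (Inr (Suc j)) * cnj (h (Inr (Suc j))))"
    by (simp add: sum.reindex sum.atLeast1_atMost_eq)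
  ultimately show ?thesis by (simp add: ell2_sel)
qed

lemma weighted_shift_linear:
  "weighted_shift V p lam (f \<oplus>\<^bsub>ell2 W\<^esub> g) = weighted_shift V p lam f \<oplus>\<^bsub>ell2 W'\<^esub> weighted_shift V p lam g"
  "weighted_shift V p lam (c \<odot>\<^bsub>ell2 W\<^esub> f) = c \<odot>\<^bsub>ell2 W'\<^esub> weighted_shift V p lam f"
  by (auto simp: weighted_shift_def ell2_sel algebra_simps)

lemma weighted_shift_boundedI:
  assumes "\<And>f. f \<in> carrier (ell2 V) \<Longrightarrow> weighted_shift V p lam f \<in> carrier (ell2 V)"
    and "\<And>f. f \<in> carrier (ell2 V) \<Longrightarrow> hnorm (ell2 V) (weighted_shift V p lam f) \<le> C * hnorm (ell2 V) f"
  shows "bounded_operator (ell2 V) (weighted_shift V p lam)"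
  using assms unfolding bounded_operator_def clinear_map_def
  by (auto simp: weighted_shift_linear[where W'=V])

locale subtree_extension = rooted_tree V p \<omega> + normal_pair K N N'
  for V :: "'v set" and p and \<omega> and K :: "'k inner_space" and N N' +
  fixes lam :: "'v \<Rightarrow> complex" and J :: "('v \<Rightarrow> complex) \<Rightarrow> 'k" and v :: 'v and k :: nat
  assumes proper: "\<And>u. u \<in> V \<Longrightarrow> u \<noteq> \<omega> \<Longrightarrow> lam u \<noteq> 0" and lam_root: "lam \<omega> = 0"
    and bounded_S: "bounded_operator (ell2 V) (weighted_shift V p lam)"
    and isometric_J: "isometric_embedding (ell2 V) K J"
    and N_J: "f \<in> carrier (ell2 V) \<Longrightarrow> N (J f) = J (weighted_shift V p lam f)"
    and v: "v \<in> V" and depth_v: "depth v = k" and k: "1 \<le> k"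
begin

abbreviation "S \<equiv> weighted_shift V p lam"
abbreviation "D \<equiv> Des V p v"

lemma v_ne: "v \<noteq> \<omega>" using depth_v k by auto

lemma D_sub: "D \<subseteq> V" by (rule Des_subset[OF v])

lemma linear_S: "clinear_map (ell2 V) (ell2 V) S"
  using bounded_S by (simp add: bounded_operator_def)

lemmas S_in = clinear_mapD(1)[OF linear_S]

lemma S_pow_in: "f \<in> carrier (ell2 V) \<Longrightarrow> (S ^^ n) f \<in> carrier (ell2 V)"
  by (induction n) (auto intro: S_in)

lemma ell2_D: "f \<in> carrier (ell2 D) \<longleftrightarrow> f \<in> carrier (ell2 V) \<and> (\<forall>u. u \<notin> D \<longrightarrow> f u = 0)"
  by (rule ell2_subset[OF D_sub])

lemma S_support: "f \<in> carrier (ell2 V) \<Longrightarrow> (S ^^ n) f u \<noteq> 0 \<Longrightarrow> u \<in> V \<and> n \<le> depth u \<and> f ((p ^^ n) u) \<noteq> 0"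
  using weighted_shift_pow_support[where lam=lam, OF lam_root, of f n u] ell2_zero_outside[of f V] by blast

lemma S_in_D: assumes f: "f \<in> carrier (ell2 D)" shows "S f \<in> carrier (ell2 D)"
proof -
  have fV: "f \<in> carrier (ell2 V)" using f by (simp add: ell2_D)
  have "u \<in> D" if nz: "S f u \<noteq> 0" for u
  proof -
    have u: "u \<in> V" "f (p u) \<noteq> 0" using S_support[OF fV, of 1 u] nz by auto
    then have "p u \<in> D" using ell2_zero_outside[OF f] by blast
    then show ?thesis using p_mem_Des_iff[OF v v_ne u(1)] Des_self[OF v] by (cases "u = v") auto
  qed
  then show ?thesis using S_in[OF fV] by (auto simp: ell2_D)
qed

lemma linear_J: "clinear_map (ell2 V) K J"
  using isometric_J by (simp add: isometric_embedding_def)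

lemmas J_in = clinear_mapD(1)[OF linear_J]

lemma J_add: "f \<in> carrier (ell2 V) \<Longrightarrow> g \<in> carrier (ell2 V) \<Longrightarrow> J (\<lambda>u. f u + g u) = J f \<oplus>\<^bsub>K\<^esub> J g"
  using clinear_mapD(2)[OF linear_J, of f g] by (simp add: ell2_sel)

lemma J_smult: "f \<in> carrier (ell2 V) \<Longrightarrow> J (\<lambda>u. c * f u) = c \<odot>\<^bsub>K\<^esub> J f"
  using clinear_mapD(3)[OF linear_J, of f c] by (simp add: ell2_sel)

lemma cinner_J: "f \<in> carrier (ell2 V) \<Longrightarrow> g \<in> carrier (ell2 V) \<Longrightarrow> cinner K (J f) (J g) = cinner (ell2 V) f g"
  using isometric_J by (simp add: isometric_embedding_def)

lemma N_pow_J: "f \<in> carrier (ell2 V) \<Longrightarrow> (N ^^ n) (J f) = J ((S ^^ n) f)"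
  by (induction n) (auto simp: N_J S_pow_in)

definition level :: "nat \<Rightarrow> ('v \<Rightarrow> complex) set" where
  "level m = {f \<in> carrier (ell2 D). \<forall>u. f u \<noteq> 0 \<longrightarrow> depth u = m}"

sublocale graded_normal K N N' "\<lambda>m. J ` level m"
proof (unfold_locales, goal_cases)
  case (1 y m) then show ?case by (auto simp: level_def ell2_D J_in)
next
  case (2 y m)
  then obtain f where f: "f \<in> level m" "y = J f" by auto
  then have fV: "f \<in> carrier (ell2 V)" "f \<in> carrier (ell2 D)" by (auto simp: level_def ell2_D)
  have "depth u = Suc m" if nz: "S f u \<noteq> 0" for u
  proof -
    have u: "u \<in> V" "1 \<le> depth u" "f (p u) \<noteq> 0" using S_support[OF fV(1), of 1 u] nz by auto
    then show ?thesis using f(1) depth_p[OF u(1)] by (fastforce simp: level_def)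
  qed
  then have "S f \<in> level (Suc m)" using S_in_D[OF fV(2)] by (simp add: level_def)
  then show ?case using f N_J[OF fV(1)] by simp
next
  case (3 y m y' m')
  then obtain f g where f: "f \<in> level m" "y = J f" and g: "g \<in> level m'" "y' = J g" by auto
  have "cinner (ell2 V) f g = 0"
    by (rule cinner_ell2_disjoint) (use f g 3 in \<open>auto simp: level_def\<close>)
  then show ?case using f g by (simp add: level_def ell2_D cinner_J)
qed

text \<open>\<open>(S ^^ j) f\<close> at \<open>u\<close> depends only on \<open>f\<close> at
  \<open>(p ^^ j) u\<close>. The premise therefore makes \<open>(S ^^ j) f\<close> vanish on level
  \<open>d + j\<close> of the branch, against which \<open>copiece d\<close> tests.\<close>

lemma J_copieceI:
  assumes f: "f \<in> carrier (ell2 V)"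
    and disj: "\<And>j u. u \<in> D \<Longrightarrow> depth u = d + j \<Longrightarrow> j \<le> depth u \<Longrightarrow> f ((p ^^ j) u) = 0"
  shows "J f \<in> copiece d"
proof -
  have "cinner K ((N ^^ i) (J f)) (J g) = 0" if g: "g \<in> level (d + i)" for i g
  proof -
    have gV: "g \<in> carrier (ell2 V)" using g by (simp add: level_def ell2_D)
    have "cinner (ell2 V) ((S ^^ i) f) g = 0"
    proof (rule cinner_ell2_disjoint, rule ccontr)
      fix u assume "\<not> ((S ^^ i) f u = 0 \<or> g u = 0)"
      then have "(S ^^ i) f u \<noteq> 0" "g u \<noteq> 0" by auto
      moreover from this have "u \<in> D" "depth u = d + i"
        using g ell2_zero_outside[of g D u] by (auto simp: level_def)
      ultimately show False using S_support[OF f, of i u] disj[of u i] by auto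
    qed
    then show ?thesis using f gV by (simp add: N_pow_J cinner_J S_pow_in)
  qed
  then show ?thesis using J_in[OF f] by (auto simp: copiece_def)
qed

text \<open>An ancestor at depth \<open>d < k\<close> lies above the top of the branch. This makes
  every vector of degree below \<open>k\<close> orthogonal to the branch.\<close>

lemma J_D_copiece:
  assumes f: "f \<in> carrier (ell2 D)" and d: "d < k"
  shows "J f \<in> copiece d"
proof (rule J_copieceI)
  show "f \<in> carrier (ell2 V)" using f by (simp add: ell2_D)
  fix j u assume u: "u \<in> D" "depth u = d + j"
  have "depth ((p ^^ j) u) = d" using u depth_pow[of u j] D_sub by auto
  then have "(p ^^ j) u \<notin> D" using d depth_v v by (auto simp: mem_Des_iff)
  then show "f ((p ^^ j) u) = 0" using ell2_zero_outside[OF f] by blast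
qed

definition sibling_part :: "nat \<Rightarrow> 'v \<Rightarrow> complex" where
  "sibling_part i = (\<lambda>u. if u \<in> - {(p ^^ i) v} then S (ket ((p ^^ Suc i) v)) u else 0)"

lemma ancestor_in: "(p ^^ i) v \<in> V" using v by simp

lemma ancestor_ne: "i < k \<Longrightarrow> (p ^^ i) v \<noteq> \<omega>"
  using pow_eq_root_iff[OF v, of i] depth_v by simp

lemma sibling_part_in: "sibling_part i \<in> carrier (ell2 V)"
  unfolding sibling_part_def by (intro ell2_restrict_in S_in ket_in ancestor_in)

lemma S_ket_ancestor:
  "S (ket ((p ^^ Suc i) v)) = (\<lambda>u. lam ((p ^^ i) v) * ket ((p ^^ i) v) u + sibling_part i u)"
  using ancestor_in[of i] by (auto simp: sibling_part_def ket_def weighted_shift_def)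

lemma N_J_ket_ancestor:
  "N (J (ket ((p ^^ Suc i) v))) = lam ((p ^^ i) v) \<odot>\<^bsub>K\<^esub> J (ket ((p ^^ i) v)) \<oplus>\<^bsub>K\<^esub> J (sibling_part i)"
proof -
  have "N (J (ket ((p ^^ Suc i) v))) = J (S (ket ((p ^^ Suc i) v)))"
    by (rule N_J[OF ket_in[OF ancestor_in]])
  then show ?thesis unfolding S_ket_ancestor
    by (simp only: J_add J_smult ket_in ancestor_in ell2_smult_in sibling_part_in)
qed

text \<open>Every vertex of the branch has \<open>(p ^^ i) v\<close> as its ancestor at depth
  \<open>k - i\<close>, and exactly there the sibling part was set to zero.\<close>

lemma sibling_part_copiece:
  assumes i: "i < k" shows "J (sibling_part i) \<in> copiece (k - i)"
proof (rule J_copieceI[OF sibling_part_in], rule ccontr)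
  fix j u assume u: "u \<in> D" "depth u = k - i + j" and nz: "sibling_part i ((p ^^ j) u) \<noteq> 0"
  have Du: "k \<le> depth u" "(p ^^ (depth u - k)) u = v" using u(1) v depth_v by (auto simp: mem_Des_iff)
  then have "i \<le> j" "depth u - k = j - i" using u(2) i by auto
  then have "(p ^^ j) u = (p ^^ i) v" 
    using Du funpow_add[of i "j - i" p] by (simp add: o_def)
  then show False using nz by (simp add: sibling_part_def)
qed

lemma J_ket_level: "J (ket v) \<in> J ` level k"
proof -
  have "ket v \<in> level k"
    unfolding level_def using ket_in[OF Des_self[OF v]] depth_v by (auto simp: ket_def split: if_splits)
  then show ?thesis by blast
qed

lemma hnorm_J_ket: "u \<in> V \<Longrightarrow> cinner K (J (ket u)) (J (ket u)) = 1"
proof -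
  assume u: "u \<in> V"
  have "cinner (ell2 V) (ket u) (ket u) = (\<Sum>\<^sub>\<infinity>w\<in>{u}. ket u w * cnj (ket u w))"
    unfolding ell2_sel by (rule infsum_cong_neutral) (use u in \<open>auto simp: ket_def\<close>)
  then show ?thesis using u by (simp add: cinner_J ket_in) (simp add: ket_def)
qed

text \<open>\<open>N\<close> on \<open>K\<close> is kept; only the embedding changes. Old vertices
  go where \<open>J\<close> sends them, new ones to the normalised vectors of the descending chain
  that starts at the basis vector of \<open>v\<close>.\<close>

lemma subtree_backward_extension:
  assumes L: "\<And>u. u \<in> V \<Longrightarrow> k < depth u \<Longrightarrow> L u = lam u"
  shows "admits_subnormal_backward_extension k D (subtree_parent p v) v (subtree_weights L v)"
proof -
  define e where "e i = J (ket ((p ^^ i) v))" for i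
  define c where "c i = lam ((p ^^ i) v)" for i
  have e_in: "e i \<in> carrier K" for i unfolding e_def by (intro J_in ket_in ancestor_in)
  have e_unit: "cinner K (e i) (e i) = 1" for i unfolding e_def by (intro hnorm_J_ket ancestor_in)
  have e0_nz: "e 0 \<noteq> \<zero>\<^bsub>K\<^esub>"
  proof
    assume "e 0 = \<zero>\<^bsub>K\<^esub>"
    then show False using e_unit[of 0] cinner_zero_left[of "\<zero>\<^bsub>K\<^esub>"] e_in[of 0] by simp
  qed
  have e0_level: "e 0 \<in> J ` level k" using J_ket_level by (simp add: e_def)
  have step: "N (e (Suc i)) = c i \<odot>\<^bsub>K\<^esub> e i \<oplus>\<^bsub>K\<^esub> J (sibling_part i)" for i
    unfolding e_def c_def by (rule N_J_ket_ancestor)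
  have c_nz: "c i \<noteq> 0" if "i < k" for i
    unfolding c_def by (rule proper[OF ancestor_in ancestor_ne[OF that]])
  obtain x where x: "x 0 = e 0" "\<And>i. i \<le> k \<Longrightarrow> x i \<in> piece (k - i)"
      "\<And>i. i \<le> k \<Longrightarrow> x i \<noteq> \<zero>\<^bsub>K\<^esub>" "\<And>i. i < k \<Longrightarrow> N (x (Suc i)) = c i \<odot>\<^bsub>K\<^esub> x i"
    by (rule descending_chain[of e k "\<lambda>i. J (sibling_part i)" c,
          OF e0_level e0_nz e_in sibling_part_copiece step c_nz]) blast+
  have x_in: "x i \<in> carrier K" if "i \<le> k" for i using piece_in[OF x(2)[OF that]] .
  have x_pos: "hnorm K (x i) > 0" if "i \<le> k" for i using hnorm_pos[OF x_in x(3)] that by blast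
  \<comment> \<open>\<open>y i\<close> represents the new vertex \<open>Inr (Suc i)\<close>;
    \<open>x 0\<close> is left out because it represents \<open>v\<close>.\<close>
  define y where "y i = of_real (1 / hnorm K (x (Suc i))) \<odot>\<^bsub>K\<^esub> x (Suc i)" for i
  \<comment> \<open>Normalising turns the chain weight \<open>c j\<close> into \<open>c j\<close>
    times a ratio of norms. The default 0 provides the weight of the new root at
    \<open>j = k\<close>.\<close>
  define \<mu> where "\<mu> j = (if j < k then c j * of_real (hnorm K (x j) / hnorm K (x (Suc j))) else 0)" for j
  have y_in: "y i \<in> carrier K" if "i < k" for i unfolding y_def using x_in that by simp
  have y_orth: "cinner K (y i) (y j) = (if i = j then 1 else 0)" if "i < k" "j < k" for i j
  proof (cases "i = j")
    case True
    then show ?thesis using that x_in[of "Suc i"] x_pos[of "Suc i"]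
      by (simp add: y_def cinner_self hnorm_smult norm_divide)
  next
    case False
    then have "cinner K (x (Suc i)) (x (Suc j)) = 0"
      using that by (intro pieces_orth[OF x(2) x(2)]) auto
    then show ?thesis using that x_in[of "Suc i"] x_in[of "Suc j"] False by (simp add: y_def cinner_simps)
  qed
  have y_J: "cinner K (y i) (J f) = 0" if "i < k" "f \<in> carrier (ell2 D)" for i f
  proof -
    have "cinner K (x (Suc i)) (J f) = 0"
      using that by (intro piece_orth_copiece[OF x(2)] J_D_copiece) auto
    then show ?thesis using that x_in[of "Suc i"] by (simp add: y_def cinner_simps J_in ell2_D)
  qed
  have norm_e: "hnorm K (x 0) = 1" using e_unit[of 0] x(1) by (simp add: hnorm_def)
  have N_y0: "N (y 0) = \<mu> 0 \<odot>\<^bsub>K\<^esub> J (ket v)"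
  proof (rule eqI_inner)
    fix z assume z: "z \<in> carrier K"
    have "x 0 = J (ket v)" using x(1) by (simp add: e_def)
    then show "cinner K (N (y 0)) z = cinner K (\<mu> 0 \<odot>\<^bsub>K\<^esub> J (ket v)) z"
      using k z x_in[of 0] x_in[of 1] x(4)[of 0] norm_e
      by (simp add: y_def \<mu>_def N_smult cinner_simps)
  qed (use y_in[of 0] k J_in[OF ket_in[OF v]] in auto)
  have N_y: "N (y (Suc i)) = \<mu> (Suc i) \<odot>\<^bsub>K\<^esub> y i" if i: "Suc i < k" for i
  proof (rule eqI_inner)
    fix z assume z: "z \<in> carrier K"
    show "cinner K (N (y (Suc i))) z = cinner K (\<mu> (Suc i) \<odot>\<^bsub>K\<^esub> y i) z"
      using i z x_in[of "Suc i"] x_in[of "Suc (Suc i)"] x(4)[of "Suc i"] x_pos[of "Suc i"]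
      by (simp add: y_def \<mu>_def N_smult cinner_simps)
  qed (use y_in[of "Suc i"] y_in[of i] i in auto)

  define E where "E = ell2 (backward_verts k D)"
  define B where "B = weighted_shift (backward_verts k D) (backward_parent k (subtree_parent p v) v)
    (backward_weights v (subtree_weights L v) \<mu>)"
  define J' where "J' g = J (\<lambda>u. g (Inl u)) \<oplus>\<^bsub>K\<^esub> comb K (\<lambda>i. g (Inr (Suc i))) y k" for g :: "'v + nat \<Rightarrow> complex"
  have E_iff: "g \<in> carrier E \<longleftrightarrow> (\<lambda>u. g (Inl u)) \<in> carrier (ell2 D) \<and> (\<forall>j. \<not> (1 \<le> j \<and> j \<le> k) \<longrightarrow> g (Inr j) = 0)" for g
    unfolding E_def by (rule ell2_backward_iff)
  have E_V: "(\<lambda>u. g (Inl u)) \<in> carrier (ell2 V)" "(\<lambda>u. g (Inl u)) \<in> carrier (ell2 D)" if "g \<in> carrier E" for g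
    using that by (auto simp: E_iff ell2_D)
  have J'_in: "J' g \<in> carrier K" if "g \<in> carrier E" for g
    unfolding J'_def using that y_in by (auto intro!: J_in E_V comb_in)
  have cinner_J': "cinner K (J' g) z = cinner K (J (\<lambda>u. g (Inl u))) z + (\<Sum>i<k. g (Inr (Suc i)) * cinner K (y i) z)"
    if "g \<in> carrier E" "z \<in> carrier K" for g z
    unfolding J'_def using that y_in by (simp add: cinner_simps J_in E_V comb_in cinner_comb)
  have iso: "cinner K (J' g) (J' h) = cinner E g h" if g: "g \<in> carrier E" and h: "h \<in> carrier E" for g h
  proof -
    let ?a = "J (\<lambda>u. g (Inl u))" and ?b = "J (\<lambda>u. h (Inl u))"
      and ?s = "comb K (\<lambda>i. g (Inr (Suc i))) y k" and ?t = "comb K (\<lambda>i. h (Inr (Suc i))) y k"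
    have ins: "?a \<in> carrier K" "?b \<in> carrier K" "?s \<in> carrier K" "?t \<in> carrier K"
      using g h y_in by (auto intro!: J_in E_V comb_in)
    have sb: "cinner K ?s ?b = 0" and ta: "cinner K ?t ?a = 0"
      using y_in ins y_J E_V(2)[OF g] E_V(2)[OF h] by (simp_all add: cinner_comb)
    have "cinner K ?a ?t = 0" using ta cinner_commute[of ?t ?a] ins by simp
    moreover have "cinner K ?s ?t = (\<Sum>i<k. g (Inr (Suc i)) * cnj (h (Inr (Suc i))))"
      using y_in y_orth by (rule cinner_comb_orthonormal)
    moreover have "cinner K ?a ?b = cinner (ell2 D) (\<lambda>u. g (Inl u)) (\<lambda>u. h (Inl u))"
      using E_V[OF g] E_V[OF h] by (simp add: cinner_J cinner_ell2_subset[OF D_sub])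
    ultimately show ?thesis
      unfolding J'_def E_def using sb ins g h by (simp add: cinner_simps cinner_ell2_backward E_def)
  qed
  \<comment> \<open>Over the old vertices the extended shift adds only what reaches \<open>v\<close>
    from its new parent \<open>Inr 1\<close>.\<close>
  have B_Inl: "(\<lambda>u. B g (Inl u)) = (\<lambda>u. S (\<lambda>u. g (Inl u)) u + \<mu> 0 * g (Inr 1) * ket v u)" if g: "g \<in> carrier E" for g
  proof
    fix u
    have sub: "weighted_shift D (subtree_parent p v) (subtree_weights L v) (\<lambda>u. g (Inl u)) = S (\<lambda>u. g (Inl u))"
      by (rule weighted_shift_subtree[OF v v_ne]) (use E_V(2)[OF g] L depth_v in \<open>auto simp: ell2_D\<close>)
    have "B g (Inl u) = weighted_shift D (subtree_parent p v) (subtree_weights L v) (\<lambda>u. g (Inl u)) u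
        + \<mu> 0 * g (Inr 1) * ket v u"
      using k Des_self[OF v]
      by (auto simp: B_def weighted_shift_def backward_parent_def backward_weights_def subtree_parent_def
          subtree_weights_def ket_def)
    then show "B g (Inl u) = S (\<lambda>u. g (Inl u)) u + \<mu> 0 * g (Inr 1) * ket v u" unfolding sub .
  qed
  have B_Inr: "B g (Inr (Suc j)) = (if Suc j < k then \<mu> (Suc j) * g (Inr (Suc (Suc j))) else 0)" for g j
    by (auto simp: B_def weighted_shift_def backward_parent_def backward_weights_def \<mu>_def)
  have B_in: "B g \<in> carrier E" if g: "g \<in> carrier E" for g
    unfolding E_iff
  proof
    show "(\<lambda>u. B g (Inl u)) \<in> carrier (ell2 D)"
      unfolding B_Inl[OF g] by (intro ell2_add_in ell2_smult_in S_in_D E_V(2)[OF g] ket_in Des_self v)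
    show "\<forall>j. \<not> (1 \<le> j \<and> j \<le> k) \<longrightarrow> B g (Inr j) = 0" by (auto simp: B_def weighted_shift_def)
  qed
  have NJ': "N (J' g) = J' (B g)" if g: "g \<in> carrier E" for g
  proof (rule eqI_inner)
    fix z assume z: "z \<in> carrier K"
    \<comment> \<open>Splitting off index 0: \<open>N (y 0)\<close> falls on the basis vector at
      \<open>v\<close>, while each \<open>N (y (Suc i))\<close> is a multiple of
      \<open>y i\<close>.\<close>
    obtain n where n: "k = Suc n" using k by (cases k) auto
    have J_B: "J (\<lambda>u. B g (Inl u)) = J (S (\<lambda>u. g (Inl u))) \<oplus>\<^bsub>K\<^esub> (\<mu> 0 * g (Inr 1)) \<odot>\<^bsub>K\<^esub> J (ket v)"
      unfolding B_Inl[OF g] using E_V[OF g] v by (simp add: J_add J_smult S_in ket_in ell2_smult_in)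
    have "cinner K (N (J' g)) z = cinner K (J (S (\<lambda>u. g (Inl u)))) z
        + (\<Sum>i<k. g (Inr (Suc i)) * cinner K (N (y i)) z)"
      unfolding J'_def using E_V[OF g] y_in z
      by (simp add: N_add J_in comb_in cinner_simps cinner_N_comb N_J S_in)
    also have "(\<Sum>i<k. g (Inr (Suc i)) * cinner K (N (y i)) z)
        = g (Inr 1) * (\<mu> 0 * cinner K (J (ket v)) z)
          + (\<Sum>i<n. g (Inr (Suc (Suc i))) * (\<mu> (Suc i) * cinner K (y i) z))"
      unfolding n sum.lessThan_Suc_shift using z y_in n
      by (simp add: N_y0 N_y cinner_simps J_in ket_in v)
    also have "(\<Sum>i<n. g (Inr (Suc (Suc i))) * (\<mu> (Suc i) * cinner K (y i) z))
        = (\<Sum>i<k. B g (Inr (Suc i)) * cinner K (y i) z)"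
      by (simp add: n B_Inr mult_ac)
    finally show "cinner K (N (J' g)) z = cinner K (J' (B g)) z"
      using g z v E_V[OF g] by (simp add: cinner_J' B_in J_B cinner_simps J_in S_in ket_in)
  qed (use J'_in B_in g in auto)
  obtain C where C: "\<And>x. x \<in> carrier K \<Longrightarrow> hnorm K (N x) \<le> C * hnorm K x"
    using bounded_N by (auto simp: bounded_operator_def)
  have norm_J': "hnorm K (J' g) = hnorm E g" if "g \<in> carrier E" for g
    using iso[OF that that] by (simp add: hnorm_def)
  have bounded_B: "bounded_operator E B"
    unfolding E_def B_def
  proof (rule weighted_shift_boundedI[where C=C], fold E_def B_def)
    fix g assume g: "g \<in> carrier E"
    show "B g \<in> carrier E" by (rule B_in[OF g])
    show "hnorm E (B g) \<le> C * hnorm E g"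
      using C[OF J'_in[OF g]] norm_J'[OF g] norm_J'[OF B_in[OF g]] NJ'[OF g] by simp
  qed
  have hilb: "complex_hilbert_space K" by unfold_locales
  have normal: "normal_operator K N"
    unfolding normal_operator_def using bounded_N bounded_N' adjoint commute by blast
  have "clinear_map E K J'"
    unfolding clinear_map_def
  proof (intro conjI funcsetI ballI allI)
    fix g h a assume g: "g \<in> carrier E"
    show "J' g \<in> carrier K" by (rule J'_in[OF g])
    have "a \<odot>\<^bsub>E\<^esub> g \<in> carrier E" unfolding E_def ell2_sel by (rule ell2_smult_in) (use g E_def in simp)
    then show "J' (a \<odot>\<^bsub>E\<^esub> g) = a \<odot>\<^bsub>K\<^esub> J' g"
      using g J'_in
      by (intro eqI_inner) (auto simp: cinner_J' cinner_simps E_def ell2_sel J_smult[OF E_V(1)[OF g]]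
          J_in[OF E_V(1)[OF g]] sum_distrib_left algebra_simps)
    assume h: "h \<in> carrier E"
    have "g \<oplus>\<^bsub>E\<^esub> h \<in> carrier E" unfolding E_def ell2_sel by (rule ell2_add_in) (use g h E_def in simp_all)
    then show "J' (g \<oplus>\<^bsub>E\<^esub> h) = J' g \<oplus>\<^bsub>K\<^esub> J' h"
      using g h J'_in
      by (intro eqI_inner) (auto simp: cinner_J' cinner_simps E_def ell2_sel J_add[OF E_V(1)[OF g] E_V(1)[OF h]]
          J_in[OF E_V(1)[OF g]] J_in[OF E_V(1)[OF h]] sum.distrib algebra_simps)
  qed
  then have "normal_extension E B K N J'"
    using hilb normal iso NJ' by (simp add: normal_extension_def isometric_embedding_def)
  then have sub_B: "subnormal E B" by (rule subnormalI[OF bounded_B])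

  \<comment> \<open>The same \<open>N\<close> and \<open>J\<close> also extend the shift on the
    branch without new vertices, which is \<open>S\<close> restricted to functions on
    \<open>D\<close>.\<close>
  let ?T = "weighted_shift D (subtree_parent p v) (subtree_weights L v)"
  have T: "?T f = S f" if "f \<in> carrier (ell2 D)" for f
    by (rule weighted_shift_subtree[OF v v_ne]) (use that L depth_v in \<open>auto simp: ell2_D\<close>)
  have norm_D: "hnorm (ell2 D) f = hnorm K (J f)" if "f \<in> carrier (ell2 D)" for f
    using that by (simp add: hnorm_def cinner_J ell2_D cinner_ell2_subset[OF D_sub])
  have "bounded_operator (ell2 D) ?T"
  proof (rule weighted_shift_boundedI[where C=C])
    fix f assume f: "f \<in> carrier (ell2 D)"
    show "?T f \<in> carrier (ell2 D)" unfolding T[OF f] by (rule S_in_D[OF f])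
    have fV: "f \<in> carrier (ell2 V)" using f by (simp add: ell2_D)
    show "hnorm (ell2 D) (?T f) \<le> C * hnorm (ell2 D) f"
      unfolding T[OF f] using C[OF J_in[OF fV]] f fV by (simp add: norm_D S_in_D N_J)
  qed
  moreover have "normal_extension (ell2 D) ?T K N J"
    unfolding normal_extension_def isometric_embedding_def clinear_map_def
    using hilb normal T
    by (auto simp: ell2_D J_in cinner_J cinner_ell2_subset[OF D_sub] N_J J_add J_smult ell2_sel(2,3))
  ultimately have "subnormal (ell2 D) ?T" by (rule subnormalI)
  moreover have "\<mu> j \<noteq> 0" if "j < k" for j
    using that c_nz[OF that] x_pos[of j] x_pos[of "Suc j"] by (simp add: \<mu>_def)
  moreover have "\<mu> k = 0" by (simp add: \<mu>_def)
  ultimately show ?thesis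
    using sub_B unfolding admits_subnormal_backward_extension_def E_def B_def by blast
qed

end

section \<open>Fibre sums and a uniform bound for the backward extensions\<close>

text \<open>The sum over \<open>Q\<close> is grouped by the fibres of \<pi>: on the fibre over
  \<open>u\<close> the factor \<open>F u\<close> is constant and the weights add up to 1. Working
  with absolute values makes the regrouping of summability an equivalence.\<close>

lemma weighted_fibre:
  fixes w :: "'a \<Rightarrow> real" and \<pi> :: "'a \<Rightarrow> 'b" and F :: "'b \<Rightarrow> complex"
  assumes \<pi>: "\<And>x. x \<in> Q \<Longrightarrow> \<pi> x \<in> V" and w: "\<And>x. x \<in> Q \<Longrightarrow> 0 \<le> w x"
    and fibre: "\<And>u. u \<in> V \<Longrightarrow> (w has_sum 1) {x \<in> Q. \<pi> x = u}"
  shows "(\<lambda>x. of_real (w x) * F (\<pi> x)) abs_summable_on Q \<longleftrightarrow> F abs_summable_on V"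
    and "F abs_summable_on V \<Longrightarrow> (\<Sum>\<^sub>\<infinity>x\<in>Q. of_real (w x) * F (\<pi> x)) = (\<Sum>\<^sub>\<infinity>u\<in>V. F u)"
proof -
  let ?P = "\<lambda>u. {x \<in> Q. \<pi> x = u}" and ?g = "\<lambda>x. of_real (w x) * F (\<pi> x)"
  have bij: "bij_betw snd (Sigma V ?P) Q"
    using \<pi> by (auto simp: bij_betw_def inj_on_def image_iff)
  have norm_sum: "((\<lambda>x. norm (?g x)) has_sum norm (F u)) (?P u)" if u: "u \<in> V" for u
  proof -
    have "((\<lambda>x. w x * norm (F u)) has_sum 1 * norm (F u)) (?P u)"
      by (rule has_sum_cmult_left[OF fibre[OF u]])
    then have "((\<lambda>x. w x * norm (F u)) has_sum norm (F u)) (?P u)" by simp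
    then show ?thesis by (rule has_sum_cong[THEN iffD1, rotated]) (use w in \<open>auto simp: norm_mult\<close>)
  qed
  have g_sum: "(?g has_sum F u) (?P u)" if u: "u \<in> V" for u
  proof -
    have "((\<lambda>x. of_real (w x) * F u) has_sum of_real 1 * F u) (?P u)"
      by (intro has_sum_cmult_left has_sum_of_real fibre[OF u])
    then have "((\<lambda>x. of_real (w x) * F u) has_sum F u) (?P u)" by simp
    then show ?thesis by (rule has_sum_cong[THEN iffD1, rotated]) auto
  qed
  have "(\<lambda>x. ?g (snd x)) abs_summable_on Sigma V ?P \<longleftrightarrow>
      (\<lambda>u. infsum (\<lambda>x. norm (?g x)) (?P u)) abs_summable_on V"
    unfolding abs_summable_on_Sigma_iff using norm_sum by (auto simp: summable_on_def)
  also have "\<dots> \<longleftrightarrow> F abs_summable_on V"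
    by (rule summable_on_cong) (use infsumI[OF norm_sum] in auto)
  finally have iff: "(\<lambda>x. ?g (snd x)) abs_summable_on Sigma V ?P \<longleftrightarrow> F abs_summable_on V" .
  then show "?g abs_summable_on Q \<longleftrightarrow> F abs_summable_on V"
    using summable_on_reindex_bij_betw[OF bij, of "\<lambda>x. norm (?g x)"] by simp
  assume F: "F abs_summable_on V"
  have "(\<lambda>x. ?g (snd x)) summable_on Sigma V ?P" by (rule abs_summable_summable) (use iff F in blast)
  then have "(\<Sum>\<^sub>\<infinity>u\<in>V. infsum ?g (?P u)) = infsum (\<lambda>x. ?g (snd x)) (Sigma V ?P)"
    using infsum_Sigma_banach[of "\<lambda>x. ?g (snd x)" V ?P] by simp
  also have "\<dots> = infsum ?g Q" by (rule infsum_reindex_bij_betw[OF bij])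
  finally show "infsum ?g Q = (\<Sum>\<^sub>\<infinity>u\<in>V. F u)"
    using infsum_cong[of V "\<lambda>u. infsum ?g (?P u)" F] infsumI[OF g_sum] by simp
qed

text \<open>Nothing is known about the size of the given normal extension or of the new weights. On
  the old vertices the powers of the shift grow at most like \<open>M ^ n\<close>; from a new vertex
  finitely many applications of \<open>N\<close> lead there, and \<open>moderate_N_iff\<close>
  transfers the growth back. Restriction to \<open>moderate M\<close> then gives the bound.\<close>

lemma backward_extension_bound:
  fixes D :: "'v set" and \<mu> :: "nat \<Rightarrow> complex"
  assumes k: "1 \<le> k" and lam_v: "lam v = 0" and \<mu>: "\<mu> k = 0" and M: "0 < M"
    and T: "bounded_operator (ell2 D) (weighted_shift D p lam)" "op_norm (ell2 D) (weighted_shift D p lam) \<le> M"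
    and sub: "subnormal (ell2 (backward_verts k D))
      (weighted_shift (backward_verts k D) (backward_parent k p v) (backward_weights v lam \<mu>))"
  shows "\<exists>(L :: (nat \<Rightarrow> ('v + nat \<Rightarrow> complex) \<Rightarrow> complex) inner_space) N J.
    normal_extension (ell2 (backward_verts k D))
      (weighted_shift (backward_verts k D) (backward_parent k p v) (backward_weights v lam \<mu>)) L N J
    \<and> (\<forall>x\<in>carrier L. hnorm L (N x) \<le> M * hnorm L x)"
proof -
  define E where "E = ell2 (backward_verts k D)"
  define B where "B = weighted_shift (backward_verts k D) (backward_parent k p v) (backward_weights v lam \<mu>)"
  let ?T = "weighted_shift D p lam"
  obtain K :: "(nat \<Rightarrow> ('v + nat \<Rightarrow> complex) \<Rightarrow> complex) inner_space" and N J
    where ext: "normal_extension E B K N J" and bounded_B: "bounded_operator E B"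
    using sub unfolding E_def B_def subnormal_def by blast
  obtain N' where "normal_pair K N N'" using ext by (rule normal_extension_pair)
  then interpret normal_pair K N N' .
  have J_in: "J g \<in> carrier K" if "g \<in> carrier E" for g
    using ext that by (auto simp: normal_extension_def isometric_embedding_def clinear_map_def)
  have norm_J: "hnorm K (J g) = hnorm E g" if "g \<in> carrier E" for g
    using ext that by (simp add: normal_extension_def isometric_embedding_def hnorm_def)
  have N_J: "N (J g) = J (B g)" if "g \<in> carrier E" for g
    using ext that by (simp add: normal_extension_def)
  have B_in: "B g \<in> carrier E" if "g \<in> carrier E" for g
    using bounded_B that by (auto simp: bounded_operator_def clinear_map_def)
  have E_Inl: "(\<lambda>u. g (Inl u)) \<in> carrier (ell2 D)" if "g \<in> carrier E" for g
    using that by (simp add: E_def ell2_backward_iff)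
  have B_Inl: "(\<lambda>u. B g (Inl u)) = ?T (\<lambda>u. g (Inl u))" if "g (Inr 1) = 0" for g
    using that k lam_v by (auto simp: B_def weighted_shift_def backward_parent_def backward_weights_def)
  have B_Inr: "B g (Inr i) = 0" if "g (Inr (Suc i)) = 0" for g i
    using that \<mu> by (auto simp: B_def weighted_shift_def backward_parent_def backward_weights_def)
  have old: "J g \<in> moderate M" if g: "g \<in> carrier E" and g0: "\<And>i. g (Inr i) = 0" for g
  proof -
    have norm_old: "hnorm E h = hnorm (ell2 D) (\<lambda>u. h (Inl u))" if "h \<in> carrier E" "\<And>i. h (Inr i) = 0" for h
      using that by (simp add: hnorm_def E_def cinner_ell2_backward)
    have pow: "(B ^^ n) g \<in> carrier E \<and> (\<forall>i. (B ^^ n) g (Inr i) = 0) \<and> (N ^^ n) (J g) = J ((B ^^ n) g)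
        \<and> hnorm E ((B ^^ n) g) \<le> hnorm E g * M ^ n" for n
    proof (induction n)
      case 0 then show ?case using g g0 by simp
    next
      case (Suc n)
      let ?h = "(B ^^ n) g"
      have h: "?h \<in> carrier E" "\<And>i. ?h (Inr i) = 0" using Suc by auto
      have Bh: "B ?h \<in> carrier E" "\<And>i. B ?h (Inr i) = 0" using B_in[OF h(1)] B_Inr h(2) by auto
      have "hnorm E (B ?h) = hnorm (ell2 D) (?T (\<lambda>u. ?h (Inl u)))"
        using norm_old[OF Bh] B_Inl[of ?h] h(2) by simp
      also have "\<dots> \<le> op_norm (ell2 D) ?T * hnorm (ell2 D) (\<lambda>u. ?h (Inl u))"
        by (rule hnorm_le_op_norm[OF T(1) E_Inl[OF h(1)]])
      also have "\<dots> \<le> M * hnorm (ell2 D) (\<lambda>u. ?h (Inl u))"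
        by (rule mult_right_mono[OF T(2) hnorm_ell2_nonneg[OF E_Inl[OF h(1)]]])
      also have "\<dots> \<le> M * (hnorm E g * M ^ n)"
        using Suc norm_old[OF h] M by (intro mult_left_mono) auto
      finally show ?case using Suc Bh N_J[OF h(1)] by (simp add: mult_ac)
    qed
    have "hnorm K ((N ^^ n) (J g)) \<le> hnorm E g * M ^ n" for n using pow[of n] norm_J by simp
    then show ?thesis using J_in[OF g] by (auto simp: moderate_def)
  qed
  have all: "J g \<in> moderate M" if "g \<in> carrier E" "\<And>i. m < i \<Longrightarrow> g (Inr i) = 0" for g m
    using that
  proof (induction m arbitrary: g)
    case 0
    \<comment> \<open>\<open>Inr 0\<close> is not a vertex of the extension, so the value there
      vanishes by membership in \<open>E\<close>.\<close>
    have "g (Inr i) = 0" for i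
      using 0 by (cases "i = 0") (auto simp: E_def ell2_backward_iff)
    then show ?case using old 0 by blast
  next
    case (Suc m)
    \<comment> \<open>\<open>B\<close> lowers the highest new vertex in the support by one, so the
      induction hypothesis covers \<open>B g\<close>; as \<open>J (B g)\<close> is
      \<open>N (J g)\<close>, the claim for \<open>g\<close> follows.\<close>
    have "J (B g) \<in> moderate M"
      by (rule Suc.IH[OF B_in[OF Suc.prems(1)]]) (use Suc.prems(2) B_Inr in auto)
    then show ?case using moderate_N_iff[OF M J_in[OF Suc.prems(1)]] N_J[OF Suc.prems(1)] by simp
  qed
  have "\<exists>C. \<forall>n. hnorm K ((N ^^ n) (J g)) \<le> C * M ^ n" if g: "g \<in> carrier E" for g
  proof -
    have "J g \<in> moderate M" using g by (rule all[of g k]) (use g in \<open>auto simp: E_def ell2_backward_iff\<close>)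
    then show ?thesis by (simp add: moderate_def)
  qed
  then obtain L where "normal_extension E B (L :: (nat \<Rightarrow> ('v + nat \<Rightarrow> complex) \<Rightarrow> complex) inner_space) N J"
    "\<And>x. x \<in> carrier L \<Longrightarrow> hnorm L (N x) \<le> M * hnorm L x"
    using normal_extension_bound[OF ext M] by blast
  then show ?thesis unfolding E_def B_def by blast
qed

section \<open>The tree with a single vertex\<close>

definition line :: "complex inner_space" where
  "line = \<lparr>carrier = UNIV, mult = undefined, one = undefined, zero = 0, add = (+), smult = (*),
     cinner = (\<lambda>x y. x * cnj y)\<rparr>"

lemma hilbert_line: "complex_hilbert_space line"
proof -
  have ag: "abelian_group line"
    by (rule abelian_groupI) (auto simp: line_def algebra_simps intro: exI[of _ "- x" for x] add.left_inverse)
  have mod: "module complex_ring line"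
    by (intro moduleI cring_complex_ring ag) (auto simp: line_def complex_ring_def algebra_simps)
  interpret module complex_ring line by (rule mod)
  have minus: "x \<ominus>\<^bsub>line\<^esub> y = x - y" for x y
  proof -
    have "\<ominus>\<^bsub>line\<^esub> y = - y" by (rule M.minus_equality) (auto simp: line_def)
    then show ?thesis by (simp add: a_minus_def) (simp add: line_def)
  qed
  have norm: "hnorm line x = cmod x" for x
    by (simp add: hnorm_def line_def cmod_def power2_eq_square)
  show ?thesis
  proof (rule complex_hilbert_space.intro[OF mod], unfold_locales)
    fix X :: "nat \<Rightarrow> complex"
    assume "\<And>e. 0 < e \<Longrightarrow> \<exists>M. \<forall>m\<ge>M. \<forall>n\<ge>M. hnorm line (X m \<ominus>\<^bsub>line\<^esub> X n) < e"
    then have "Cauchy X" by (simp add: Cauchy_def norm minus dist_norm)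
    then obtain l where "X \<longlonglongrightarrow> l" using Cauchy_convergent_iff convergent_def by blast
    then have "(\<lambda>n. cmod (X n - l)) \<longlonglongrightarrow> 0" by (simp add: LIM_zero tendsto_norm_zero)
    then show "\<exists>l\<in>carrier line. (\<lambda>n. hnorm line (X n \<ominus>\<^bsub>line\<^esub> l)) \<longlonglongrightarrow> 0"
      by (auto simp: norm minus) (auto simp: line_def)
  next
    fix x assume "x \<noteq> \<zero>\<^bsub>line\<^esub>"
    then show "0 < Re (cinner line x x)"
      by (simp add: line_def complex_eq_iff) (metis not_sum_squares_lt_zero linorder_neqE sum_squares_eq_zero_iff)
  qed (auto simp: line_def algebra_simps)
qed

text \<open>The one-vertex tree is leafless and has no vertices of depth \<open>k\<close>, so (b)
  holds vacuously and there are no branches to glue. Evaluation at the root embeds its space into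
  \<open>line\<close>, where zero is normal.\<close>

lemma subnormal_zero_singleton:
  "bounded_operator (ell2 {\<omega>}) (weighted_shift {\<omega>} p (\<lambda>_. 0))"
  "subnormal (ell2 {\<omega>}) (weighted_shift {\<omega>} p (\<lambda>_. 0))"
proof -
  have T: "weighted_shift {\<omega>} p (\<lambda>_. 0) f = (\<lambda>_. 0)" for f by (auto simp: weighted_shift_def)
  show bdd: "bounded_operator (ell2 {\<omega>}) (weighted_shift {\<omega>} p (\<lambda>_. 0))"
    by (rule weighted_shift_boundedI[where C=0]) (auto simp: T ell2_zero_in hnorm_def ell2_sel)
  have zero: "bounded_operator line (\<lambda>_. 0)"
    by (auto simp: bounded_operator_def clinear_map_def line_def hnorm_def intro: exI[of _ 0])
  have "normal_operator line (\<lambda>_. 0)"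
    unfolding normal_operator_def using zero
    by (intro conjI exI[of _ "\<lambda>_. 0"]) (auto simp: adjoint_pair_def line_def)
  then have "normal_extension (ell2 {\<omega>}) (weighted_shift {\<omega>} p (\<lambda>_. 0)) line (\<lambda>_. 0) (\<lambda>f. f \<omega>)"
    unfolding normal_extension_def isometric_embedding_def clinear_map_def
    using hilbert_line by (auto simp: T ell2_sel) (auto simp: line_def)
  then show "subnormal (ell2 {\<omega>}) (weighted_shift {\<omega>} p (\<lambda>_. 0))" by (rule subnormalI[OF bdd])
qed

section \<open>From the whole tree to its branches, and descendants in leafless trees\<close>

context rooted_tree begin

text \<open>The image of \<open>ket u\<close> is square summable, hence has countable support. Since
  the weights do not vanish, this support is the set of children of \<open>u\<close>.\<close>

lemma countable_level:
  assumes proper: "\<And>u. u \<in> V \<Longrightarrow> u \<noteq> \<omega> \<Longrightarrow> lam u \<noteq> 0"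
    and S: "bounded_operator (ell2 V) (weighted_shift V p lam)"
  shows "countable {u \<in> V. depth u = n}"
proof (induction n)
  case 0
  have "{u \<in> V. depth u = 0} \<subseteq> {\<omega>}" using depth_0_iff by auto
  then show ?case by (rule countable_subset) simp
next
  case (Suc n)
  have "countable {w \<in> V. p w = u \<and> w \<noteq> \<omega>}" if u: "u \<in> V" for u
  proof -
    have "weighted_shift V p lam (ket u) \<in> carrier (ell2 V)"
      using S ket_in[OF u] by (auto simp: bounded_operator_def clinear_map_def)
    then have "countable {w \<in> V. (cmod (weighted_shift V p lam (ket u) w))\<^sup>2 \<noteq> 0}"
      by (intro summable_countable_real ell2_summable)
    then show ?thesis
      by (rule countable_subset[rotated]) (use proper in \<open>auto simp: weighted_shift_def ket_def\<close>)
  qed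
  then have "countable (\<Union>u\<in>{u \<in> V. depth u = n}. {w \<in> V. p w = u \<and> w \<noteq> \<omega>})"
    using Suc by auto
  then show ?case
    by (rule countable_subset[rotated]) (auto simp: depth_p)
qed

lemma proper_subtree:
  assumes v: "v \<in> V" and nz: "\<And>u. u \<in> V \<Longrightarrow> depth v < depth u \<Longrightarrow> lam u \<noteq> 0"
  shows "proper_weights (Des V p v) (subtree_parent p v) (subtree_weights lam v)"
  using nz depth_Des[OF v] Des_subset[OF v] Des_self[OF v]
  by (auto simp: proper_weights_def subtree_weights_def subtree_parent_def is_root_def)

lemma op_norm_subtree_le:
  assumes v: "v \<in> V" "v \<noteq> \<omega>" and agree: "\<And>u. u \<in> V \<Longrightarrow> depth v < depth u \<Longrightarrow> lam' u = lam u"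
    and C: "0 \<le> C" "\<And>f. f \<in> carrier (ell2 V) \<Longrightarrow> weighted_shift V p lam' f \<in> carrier (ell2 V)"
      "\<And>f. f \<in> carrier (ell2 V) \<Longrightarrow> hnorm (ell2 V) (weighted_shift V p lam' f) \<le> C * hnorm (ell2 V) f"
  shows "op_norm (ell2 (Des V p v)) (weighted_shift (Des V p v) (subtree_parent p v) (subtree_weights lam v)) \<le> C"
proof (rule op_norm_ell2_le[OF C(1)])
  fix f assume f: "f \<in> carrier (ell2 (Des V p v))"
  let ?T = "weighted_shift (Des V p v) (subtree_parent p v) (subtree_weights lam v)"
  note sub = ell2_subset[OF Des_subset[OF v(1)]] hnorm_ell2_subset[OF Des_subset[OF v(1)]]
  have T: "?T f = weighted_shift V p lam' f"
    by (rule weighted_shift_subtree[OF v _ agree]) (use f in \<open>auto simp: sub(1)\<close>)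
  have fV: "f \<in> carrier (ell2 V)" using f by (simp add: sub(1))
  have "?T f \<in> carrier (ell2 (Des V p v))"
    unfolding sub(1) using C(2)[OF fV] by (auto simp: T simp flip: T) (auto simp: weighted_shift_def)
  then show "hnorm (ell2 (Des V p v)) (?T f) \<le> C * hnorm (ell2 (Des V p v)) f"
    using C(3)[OF fV] f by (simp add: sub(2) T)
qed

lemma subnormal_imp_subtree_extensions:
  assumes k: "1 \<le> k" and agree: "\<And>u. u \<in> V \<Longrightarrow> k < depth u \<Longrightarrow> lam' u = lam u"
    and lam': "lam' \<omega> = 0" "\<And>u. u \<in> V \<Longrightarrow> u \<noteq> \<omega> \<Longrightarrow> lam' u \<noteq> 0"
    and bdd: "bounded_operator (ell2 V) (weighted_shift V p lam')"
    and sub: "subnormal (ell2 V) (weighted_shift V p lam')"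
  shows "countable (Chi V p k \<omega>)"
    and "v \<in> Chi V p k \<omega> \<Longrightarrow>
      admits_subnormal_backward_extension k (Des V p v) (subtree_parent p v) v (subtree_weights lam v)"
    and "bdd_above ((\<lambda>v. op_norm (ell2 (Des V p v))
      (weighted_shift (Des V p v) (subtree_parent p v) (subtree_weights lam v))) ` Chi V p k \<omega>)"
proof -
  show "countable (Chi V p k \<omega>)" unfolding Chi_root[OF k] by (rule countable_level[OF lam'(2) bdd])
  obtain K :: "(nat \<Rightarrow> ('v \<Rightarrow> complex) \<Rightarrow> complex) inner_space" and N J
    where ext: "normal_extension (ell2 V) (weighted_shift V p lam') K N J"
    using sub unfolding subnormal_def by blast
  obtain N' where pair: "normal_pair K N N'" using ext by (rule normal_extension_pair)
  show "admits_subnormal_backward_extension k (Des V p v) (subtree_parent p v) v (subtree_weights lam v)"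
    if "v \<in> Chi V p k \<omega>"
  proof -
    have v: "v \<in> V" "depth v = k" using that Chi_root[OF k] by auto
    interpret normal_pair K N N' by (rule pair)
    interpret subtree_extension V p \<omega> K N N' lam' J v k
      by unfold_locales (use lam' bdd ext v k in \<open>auto simp: normal_extension_def\<close>)
    show ?thesis by (rule subtree_backward_extension) (simp add: agree)
  qed
  obtain C where C: "\<And>f. f \<in> carrier (ell2 V) \<Longrightarrow> hnorm (ell2 V) (weighted_shift V p lam' f) \<le> C * hnorm (ell2 V) f"
    and lin: "clinear_map (ell2 V) (ell2 V) (weighted_shift V p lam')"
    using bdd by (auto simp: bounded_operator_def)
  show "bdd_above ((\<lambda>v. op_norm (ell2 (Des V p v))
      (weighted_shift (Des V p v) (subtree_parent p v) (subtree_weights lam v))) ` Chi V p k \<omega>)"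
  proof (rule bdd_aboveI2)
    fix v assume "v \<in> Chi V p k \<omega>"
    then have v: "v \<in> V" "depth v = k" using Chi_root[OF k] by auto
    show "op_norm (ell2 (Des V p v)) (weighted_shift (Des V p v) (subtree_parent p v) (subtree_weights lam v)) \<le> \<bar>C\<bar>"
    proof (rule op_norm_subtree_le[where lam'=lam'])
      fix f assume f: "f \<in> carrier (ell2 V)"
      show "weighted_shift V p lam' f \<in> carrier (ell2 V)" by (rule clinear_mapD(1)[OF lin f])
      have "C * hnorm (ell2 V) f \<le> \<bar>C\<bar> * hnorm (ell2 V) f"
        using hnorm_ell2_nonneg[OF f] by (intro mult_right_mono) auto
      then show "hnorm (ell2 V) (weighted_shift V p lam' f) \<le> \<bar>C\<bar> * hnorm (ell2 V) f" using C[OF f] by linarith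
    qed (use v k agree in auto)
  qed
qed

text \<open>The root is its own preimage under \<open>p\<close>, so leaflessness yields a proper
  child only at other vertices.\<close>

lemma leafless_child:
  assumes "leafless V p" "u \<in> V" "u \<noteq> \<omega>"
  obtains w where "w \<in> V" "p w = u" "depth w = Suc (depth u)"
proof -
  have "u \<in> p ` V" using assms by (simp add: leafless_def)
  then obtain w where w: "w \<in> V" "p w = u" by auto
  then have "w \<noteq> \<omega>" using assms(3) by auto
  then have "depth w = Suc (depth u)" using w depth_p[OF w(1)] depth_0_iff[OF w(1)] by simp
  then show ?thesis using that w by blast
qed

lemma leafless_descendant:
  assumes leafless: "leafless V p" and u: "u \<in> V" "u \<noteq> \<omega>"
  shows "\<exists>w\<in>V. (p ^^ n) w = u \<and> depth w = depth u + n"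
proof (induction n)
  case 0 then show ?case using u by auto
next
  case (Suc n)
  then obtain w where w: "w \<in> V" "(p ^^ n) w = u" "depth w = depth u + n" by auto
  have "w \<noteq> \<omega>" using w(2) u by auto
  then obtain w' where "w' \<in> V" "p w' = w" "depth w' = Suc (depth w)"
    using leafless_child[OF leafless w(1)] by blast
  then show ?case using w by (auto simp: funpow_swap1 intro!: bexI[of _ w'])
qed

text \<open>For \<open>u = \<omega>\<close> leaflessness alone does not start the descent: the
  ancestor at depth 1 of any other vertex is taken, and \<open>k - 1\<close> generations are added
  below it.\<close>

lemma level_descendant:
  assumes leafless: "leafless V p" and V: "V \<noteq> {\<omega>}" and k: "1 \<le> k" and u: "u \<in> V" "depth u \<le> k"
  shows "\<exists>w\<in>V. (p ^^ (k - depth u)) w = u \<and> depth w = k"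
proof (cases "u = \<omega>")
  case False
  then show ?thesis using leafless_descendant[OF leafless u(1) False, of "k - depth u"] u(2) by simp
next
  case True
  obtain t where t: "t \<in> V" "t \<noteq> \<omega>" using V root_in by blast
  let ?c = "(p ^^ (depth t - 1)) t"
  have "depth t \<noteq> 0" using t depth_0_iff by simp
  then have c: "?c \<in> V" "depth ?c = 1" using t depth_pow[OF t(1), of "depth t - 1"] by auto
  then have "?c \<noteq> \<omega>" by auto
  then obtain w where w: "w \<in> V" "depth w = 1 + (k - 1)"
    using leafless_descendant[OF leafless c(1), of "k - 1"] c(2) by auto
  then have "(p ^^ k) w = \<omega>" using pow_eq_root_iff[OF w(1)] k by simp
  then show ?thesis using w True k by auto
qed

end

section \<open>Gluing branches\<close>

locale branch_gluing = rooted_tree V p \<omega> for V :: "'v set" and p and \<omega> +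
  fixes k :: nat and lam :: "'v \<Rightarrow> complex" and \<mu> :: "'v \<Rightarrow> nat \<Rightarrow> complex" and \<beta> :: "'v \<Rightarrow> real"
  assumes k: "1 \<le> k" and leafless: "leafless V p" and nontrivial: "V \<noteq> {\<omega>}"
    and \<mu>_nz: "\<And>v j. v \<in> V \<Longrightarrow> depth v = k \<Longrightarrow> j < k \<Longrightarrow> \<mu> v j \<noteq> 0"
    and \<mu>_k: "\<And>v. v \<in> V \<Longrightarrow> depth v = k \<Longrightarrow> \<mu> v k = 0"
    and \<beta>_pos: "\<And>v. v \<in> V \<Longrightarrow> depth v = k \<Longrightarrow> \<beta> v > 0"
    and summable_\<beta>: "(\<lambda>x. (\<beta> (fst x) / cmod (\<Prod>j<snd x. \<mu> (fst x) j))\<^sup>2) summable_on {u \<in> V. depth u = k} \<times> {..k}"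
begin

text \<open>
  In the \<open>i\<close>-step backward extension of the branch at \<open>v\<close>, let \<open>z\<^bsub>v,i\<^esub>\<close> be the multiple of the basis
  vector at \<open>\<omega>\<^sub>i\<close> that the \<open>i\<close>-th power of the shift sends to the basis vector at \<open>v\<close>; its norm is
  \<open>1 / \<bar>m v i\<bar>\<close>. A vertex \<open>u\<close> of depth less than \<open>k\<close> is represented in the sum of all branches by the
  normalisation of \<open>\<Sum> \<beta> v \<cdot> z\<^bsub>v,i\<^esub>\<close>, taken over all \<open>v\<close> with \<open>p\<^sup>i v = u\<close>. The norm of this sum is \<open>A u\<close>.
  Since the shift maps the sum at \<open>u\<close> to the total of the sums at the children of \<open>u\<close>, the
  weight at \<open>u\<close> has to be \<open>A u / A (p u)\<close>.
\<close>

definition C :: "'v set" where "C = {u \<in> V. depth u = k}"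

definition m :: "'v \<Rightarrow> nat \<Rightarrow> complex" where "m v i = (\<Prod>j<i. \<mu> v j)"

definition s :: "'v \<times> nat \<Rightarrow> real" where "s x = (\<beta> (fst x) / cmod (m (fst x) (snd x)))\<^sup>2"

definition fib :: "'v \<Rightarrow> ('v \<times> nat) set" where
  "fib u = {x \<in> C \<times> {..k}. (p ^^ snd x) (fst x) = u}"

definition A :: "'v \<Rightarrow> real" where "A u = sqrt (\<Sum>\<^sub>\<infinity>x\<in>fib u. s x)"

definition lam' :: "'v \<Rightarrow> complex" where
  "lam' u = (if u = \<omega> then 0 else if depth u \<le> k then of_real (A u / A (p u)) else lam u)"

text \<open>The coordinate at the \<open>i\<close>-th new vertex of the branch at \<open>v\<close>,
  for the unit vector that represents \<open>(p ^^ i) v\<close>.\<close>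

definition d :: "'v \<Rightarrow> nat \<Rightarrow> complex" where
  "d v i = of_real (\<beta> v) / (m v i * of_real (A ((p ^^ i) v)))"

text \<open>Component at \<open>v\<close> of the embedding of \<open>ell2 V\<close> into the sum of
  all extended branches.\<close>

definition G :: "'v \<Rightarrow> ('v \<Rightarrow> complex) \<Rightarrow> 'v + nat \<Rightarrow> complex" where
  "G v f x = (case x of Inl w \<Rightarrow> if w \<in> Des V p v then f w else 0
    | Inr i \<Rightarrow> if 1 \<le> i \<and> i \<le> k then d v i * f ((p ^^ i) v) else 0)"

abbreviation "BV v \<equiv> backward_verts k (Des V p v)"

abbreviation "B v \<equiv> weighted_shift (BV v) (backward_parent k (subtree_parent p v) v)
  (backward_weights v (subtree_weights lam v) (\<mu> v))"

abbreviation "S \<equiv> weighted_shift V p lam'"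

lemma C_D: "v \<in> C \<Longrightarrow> v \<in> V" "v \<in> C \<Longrightarrow> depth v = k"
  by (simp_all add: C_def)

lemma m_nz: "v \<in> C \<Longrightarrow> i \<le> k \<Longrightarrow> m v i \<noteq> 0"
  using \<mu>_nz by (auto simp: m_def C_def)

lemma s_pos: "v \<in> C \<Longrightarrow> i \<le> k \<Longrightarrow> s (v, i) > 0"
  using m_nz[of v i] \<beta>_pos[of v] by (simp add: s_def C_def)

lemma depth_ancestor: "v \<in> C \<Longrightarrow> depth ((p ^^ i) v) = k - i"
  by (simp add: depth_pow C_def)

lemma s_summable_fib: "s summable_on fib u"
proof -
  have "s summable_on C \<times> {..k}" using summable_\<beta> unfolding C_def s_def m_def .
  then show ?thesis by (rule summable_on_subset_banach) (auto simp: fib_def)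
qed

text \<open>By leaflessness some vertex of depth \<open>k\<close> lies at or below \<open>u\<close>,
  so the sum has a positive term. This justifies every division by \<open>A\<close>.\<close>

lemma A_pos: assumes u: "u \<in> V" "depth u \<le> k" shows "A u > 0"
proof -
  obtain w where w: "w \<in> V" "(p ^^ (k - depth u)) w = u" "depth w = k"
    using level_descendant[OF leafless nontrivial k u] by blast
  then have x: "(w, k - depth u) \<in> fib u" by (simp add: fib_def C_def)
  have nonneg: "0 \<le> s x" for x by (simp add: s_def)
  have "0 < s (w, k - depth u)" using w by (intro s_pos) (auto simp: C_def)
  also have "\<dots> \<le> (\<Sum>\<^sub>\<infinity>x\<in>fib u. s x)"
    using finite_sum_le_infsum[OF s_summable_fib[of u], of "{(w, k - depth u)}"] x nonneg by simp
  finally show ?thesis by (simp add: A_def)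
qed

lemma fib_shallow: "depth u < k \<Longrightarrow> x \<in> fib u \<Longrightarrow> 1 \<le> snd x"
  using C_D by (cases "snd x") (auto simp: fib_def)

text \<open>Iterates with \<open>i > 0\<close> have depth below \<open>k\<close>, so only
  \<open>(v, 0)\<close> lies over \<open>v\<close>. The new weights thereby fit the old branch at
  its top.\<close>

lemma A_level: assumes v: "v \<in> C" shows "A v = \<beta> v"
proof -
  have "x = (v, 0)" if "x \<in> fib v" for x
  proof -
    obtain w i where x: "x = (w, i)" by (cases x)
    then have w: "w \<in> C" "i \<le> k" "(p ^^ i) w = v" using that by (simp_all add: fib_def)
    then have "i = 0" using depth_ancestor[of w i] C_D(2)[OF v] k by simp
    then show ?thesis using x w by simp
  qed
  moreover have "(v, 0) \<in> fib v" using v by (simp add: fib_def)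
  ultimately have "fib v = {(v, 0)}" by blast
  then show ?thesis using \<beta>_pos[of v] v by (simp add: A_def s_def m_def C_def)
qed

lemma d_step:
  assumes v: "v \<in> C" and j: "j < k"
  shows "\<mu> v j * d v (Suc j) = of_real (\<beta> v) / (m v j * of_real (A ((p ^^ Suc j) v)))"
  using \<mu>_nz[of v j] C_D[OF v] j by (simp add: d_def m_def)

lemma lam'_ancestor:
  assumes v: "v \<in> C" and j: "j < k"
  shows "lam' ((p ^^ j) v) = of_real (A ((p ^^ j) v) / A ((p ^^ Suc j) v))"
proof -
  have "depth ((p ^^ j) v) \<noteq> 0" using depth_ancestor[OF v] j by simp
  then have "(p ^^ j) v \<noteq> \<omega>" by (metis depth_root)
  then show ?thesis using depth_ancestor[OF v, of j] by (simp add: lam'_def)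
qed

text \<open>Coordinatewise. Inside the branch the weights agree; at \<open>v\<close> the identity is
  \<open>A v = \<beta> v\<close>; at new vertices below the last, \<open>\<mu> v j\<close> cancels
  the last factor of \<open>m v (Suc j)\<close> and the quotient of the \<open>A\<close> is
  \<open>lam'\<close>. At the last one both sides vanish, as the weights at both roots are
  zero.\<close>

lemma intertwine: assumes v: "v \<in> C" shows "B v (G v f) = G v (S f)"
proof
  fix x
  note vV = C_D(1)[OF v] and dv = C_D(2)[OF v]
  have v_ne: "v \<noteq> \<omega>" using dv k by auto
  show "B v (G v f) x = G v (S f) x"
  proof (cases x)
    case (Inl w)
    consider "w \<notin> Des V p v" | "w = v" | "w \<in> Des V p v" "w \<noteq> v" by blast
    then show ?thesis
    proof cases
      case 1 then show ?thesis using Inl by (simp add: weighted_shift_def G_def)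
    next
      case 2
      have "\<mu> v 0 * d v 1 = lam' v"
        using d_step[OF v, of 0] lam'_ancestor[OF v, of 0] k A_level[OF v] by (simp add: m_def)
      then show ?thesis using Inl 2 k Des_self[OF vV] vV
        by (simp add: weighted_shift_def G_def backward_parent_def backward_weights_def)
    next
      case 3
      have w: "w \<in> V" "k < depth w" using 3 Des_subset[OF vV] depth_Des[OF vV] dv by auto
      have "p w \<in> Des V p v" using p_mem_Des_iff[OF vV v_ne w(1)] 3 by simp
      moreover have "lam' w = lam w" using w by (auto simp: lam'_def)
      ultimately show ?thesis using Inl 3 w
        by (simp add: weighted_shift_def G_def backward_parent_def backward_weights_def
            subtree_parent_def subtree_weights_def)
    qed
  next
    case (Inr j)
    consider "\<not> (1 \<le> j \<and> j \<le> k)" | "j = k" | "1 \<le> j" "j < k" by linarith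
    then show ?thesis
    proof cases
      case 1 then show ?thesis using Inr by (auto simp: weighted_shift_def G_def)
    next
      case 2
      have "(p ^^ k) v = \<omega>" using pow_eq_root_iff[OF vV] dv by simp
      then show ?thesis using Inr 2 k \<mu>_k[OF vV dv]
        by (simp add: weighted_shift_def G_def backward_parent_def backward_weights_def lam'_def)
    next
      case 3
      have Apos: "A ((p ^^ j) v) \<noteq> 0"
        using A_pos[of "(p ^^ j) v"] vV depth_ancestor[OF v, of j] by simp
      have "d v j * lam' ((p ^^ j) v) = of_real (\<beta> v) / (m v j * of_real (A ((p ^^ Suc j) v)))"
        unfolding lam'_ancestor[OF v 3(2)] d_def using Apos by simp
      then have "\<mu> v j * d v (Suc j) = d v j * lam' ((p ^^ j) v)" by (simp only: d_step[OF v 3(2)])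
      then show ?thesis using Inr 3 vV
        by (simp add: weighted_shift_def G_def backward_parent_def backward_weights_def mult.assoc[symmetric])
    qed
  qed
qed

abbreviation "Q \<equiv> Sigma C BV"

text \<open>The vertex of the original tree in whose representation a vertex of an extended branch
  takes part.\<close>

definition \<pi> :: "'v \<times> ('v + nat) \<Rightarrow> 'v" where
  "\<pi> q = (case snd q of Inl w \<Rightarrow> w | Inr i \<Rightarrow> (p ^^ i) (fst q))"

text \<open>The squared modulus of the coefficient in \<open>G\<close>: 1 at old vertices and that
  of \<open>d\<close> at new ones.\<close>

definition wt :: "'v \<times> ('v + nat) \<Rightarrow> real" where
  "wt q = (case snd q of Inl w \<Rightarrow> 1 | Inr i \<Rightarrow> s (fst q, i) / (A ((p ^^ i) (fst q)))\<^sup>2)"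

lemma \<pi>_in: "q \<in> Q \<Longrightarrow> \<pi> q \<in> V"
  by (auto simp: \<pi>_def backward_verts_def mem_Des_iff C_D)

lemma wt_nonneg: "0 \<le> wt q"
  by (simp add: wt_def s_def split: sum.split)

text \<open>From depth \<open>k\<close> on, the fibre is one old vertex in one branch. Above, it is
  a copy of \<open>fib u\<close>, and \<open>A u\<close> was defined to normalise the sum.\<close>

lemma wt_has_sum: assumes u: "u \<in> V" shows "(wt has_sum 1) {q \<in> Q. \<pi> q = u}"
proof (cases "depth u < k")
  case False
  let ?v = "(p ^^ (depth u - k)) u"
  have v: "?v \<in> C" using u False by (simp add: C_def depth_pow)
  have "{q \<in> Q. \<pi> q = u} = {(?v, Inl u)}"
  proof (intro equalityI subsetI)
    fix q assume q: "q \<in> {q \<in> Q. \<pi> q = u}"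
    obtain v' x where qx: "q = (v', x)" by (cases q)
    then have v': "v' \<in> C" "x \<in> BV v'" "\<pi> (v', x) = u" using q by auto
    show "q \<in> {(?v, Inl u)}"
    proof (cases x)
      case (Inl w)
      then show ?thesis using v' qx C_D[OF v'(1)] by (auto simp: \<pi>_def mem_Des_iff)
    next
      case (Inr i)
      then have "depth u = k - i" "1 \<le> i" using v' depth_ancestor[OF v'(1), of i] by (auto simp: \<pi>_def)
      then show ?thesis using False k by auto
    qed
  next
    fix q :: "'v \<times> ('v + nat)" assume "q \<in> {(?v, Inl u)}"
    moreover have "u \<in> Des V p ?v" using u False C_D[OF v] by (simp add: mem_Des_iff)
    ultimately show "q \<in> {q \<in> Q. \<pi> q = u}" using v by (auto simp: \<pi>_def)
  qed
  then show ?thesis using has_sum_finite[of "{(?v, Inl u)}" wt] by (simp add: wt_def)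
next
  case True
  let ?h = "\<lambda>x :: 'v \<times> nat. (fst x, Inr (snd x) :: 'v + nat)"
  have "{q \<in> Q. \<pi> q = u} = ?h ` fib u"
  proof (intro equalityI subsetI)
    fix q assume q: "q \<in> {q \<in> Q. \<pi> q = u}"
    obtain v' x where qx: "q = (v', x)" by (cases q)
    then have v': "v' \<in> C" "x \<in> BV v'" "\<pi> (v', x) = u" using q by auto
    show "q \<in> ?h ` fib u"
    proof (cases x)
      case (Inl w)
      then have "k \<le> depth u" using v' C_D[OF v'(1)] by (auto simp: \<pi>_def mem_Des_iff)
      then show ?thesis using True by simp
    next
      case (Inr i)
      then have "(v', i) \<in> fib u" using v' by (auto simp: \<pi>_def fib_def)
      then show ?thesis using qx Inr by force
    qed
  next
    fix q assume "q \<in> ?h ` fib u"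
    then obtain x where "x \<in> fib u" "q = ?h x" by blast
    then show "q \<in> {q \<in> Q. \<pi> q = u}" using fib_shallow[OF True, of x] by (auto simp: fib_def \<pi>_def)
  qed
  moreover have "inj_on ?h (fib u)" by (auto simp: inj_on_def)
  moreover have "((wt \<circ> ?h) has_sum 1) (fib u)"
  proof -
    have A: "A u > 0" using A_pos[OF u] True by simp
    have "(A u)\<^sup>2 = (\<Sum>\<^sub>\<infinity>x\<in>fib u. s x)" by (simp add: A_def infsum_nonneg s_def)
    then have "(s has_sum (A u)\<^sup>2) (fib u)" using has_sum_infsum[OF s_summable_fib] by simp
    then have "((\<lambda>x. s x * inverse ((A u)\<^sup>2)) has_sum (A u)\<^sup>2 * inverse ((A u)\<^sup>2)) (fib u)"
      by (rule has_sum_cmult_left)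
    then have "((\<lambda>x. s x / (A u)\<^sup>2) has_sum 1) (fib u)" using A by (simp add: field_simps)
    then show ?thesis
      by (rule has_sum_cong[THEN iffD1, rotated]) (auto simp: wt_def fib_def)
  qed
  ultimately show ?thesis by (simp add: has_sum_reindex)
qed

lemma G_product:
  assumes q: "q \<in> Q"
  shows "G (fst q) f (snd q) * cnj (G (fst q) g (snd q)) = of_real (wt q) * (f (\<pi> q) * cnj (g (\<pi> q)))"
proof -
  obtain v x where qx: "q = (v, x)" by (cases q)
  then have v: "v \<in> C" "x \<in> BV v" using q by auto
  show ?thesis
  proof (cases x)
    case (Inl w) then show ?thesis using v qx by (simp add: G_def wt_def \<pi>_def)
  next
    case (Inr i)
    then have i: "1 \<le> i" "i \<le> k" using v by auto
    have "A ((p ^^ i) v) > 0" using A_pos[of "(p ^^ i) v"] C_D(1)[OF v(1)] depth_ancestor[OF v(1), of i] by simp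
    then have "cmod (d v i) = \<beta> v / cmod (m v i) / A ((p ^^ i) v)"
      using \<beta>_pos[OF C_D[OF v(1)]] by (simp add: d_def norm_divide norm_mult)
    then have "d v i * cnj (d v i) = of_real (wt q)"
      using Inr qx by (simp add: wt_def s_def power_divide power_mult_distrib flip: complex_norm_square)
    then show ?thesis using Inr qx i by (simp add: G_def \<pi>_def mult_ac flip: mult.assoc[of "d v i" "cnj (d v i)"])
  qed
qed

lemma abs_summable_G:
  "(\<lambda>q. G (fst q) f (snd q) * cnj (G (fst q) g (snd q))) abs_summable_on Q
    \<longleftrightarrow> (\<lambda>u. f u * cnj (g u)) abs_summable_on V"
proof -
  have "(\<lambda>q. G (fst q) f (snd q) * cnj (G (fst q) g (snd q))) abs_summable_on Q
      \<longleftrightarrow> (\<lambda>q. of_real (wt q) * (f (\<pi> q) * cnj (g (\<pi> q)))) abs_summable_on Q"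
    by (rule summable_on_cong) (simp only: G_product)
  also have "\<dots> \<longleftrightarrow> (\<lambda>u. f u * cnj (g u)) abs_summable_on V"
    by (rule weighted_fibre(1)[where V=V and F="\<lambda>u. f u * cnj (g u)", OF \<pi>_in wt_nonneg wt_has_sum])
  finally show ?thesis .
qed

lemma norm_mult_cnj: "norm (z * cnj z) = (cmod z)\<^sup>2"
  by (simp add: norm_mult power2_eq_square)

lemma G_carrier_iff: "G v f \<in> carrier (ell2 (BV v)) \<longleftrightarrow> (\<lambda>x. G v f x * cnj (G v f x)) abs_summable_on BV v"
  unfolding ell2_carrier_iff norm_mult_cnj by (auto simp: G_def split: sum.split)

text \<open>The implication from right to left is what later places \<open>S f\<close> in
  \<open>ell2 V\<close>, once its components are known to be square summable.\<close>

lemma ell2_glue: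
  assumes f: "\<And>u. u \<notin> V \<Longrightarrow> f u = 0"
  shows "f \<in> carrier (ell2 V) \<longleftrightarrow> (\<forall>v\<in>C. G v f \<in> carrier (ell2 (BV v)))
    \<and> (\<lambda>v. (hnorm (ell2 (BV v)) (G v f))\<^sup>2) summable_on C"
proof -
  have "f \<in> carrier (ell2 V) \<longleftrightarrow> (\<lambda>u. f u * cnj (f u)) abs_summable_on V"
    unfolding norm_mult_cnj using f by (simp add: ell2_carrier_iff)
  also have "\<dots> \<longleftrightarrow> (\<forall>v\<in>C. (\<lambda>x. G v f x * cnj (G v f x)) abs_summable_on BV v) \<and>
      (\<lambda>v. \<Sum>\<^sub>\<infinity>x\<in>BV v. norm (G v f x * cnj (G v f x))) abs_summable_on C"
    unfolding abs_summable_G[symmetric] abs_summable_on_Sigma_iff by simp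
  also have "\<dots> \<longleftrightarrow> (\<forall>v\<in>C. G v f \<in> carrier (ell2 (BV v))) \<and>
      (\<lambda>v. \<Sum>\<^sub>\<infinity>x\<in>BV v. (cmod (G v f x))\<^sup>2) summable_on C"
    unfolding G_carrier_iff norm_mult_cnj by (simp add: infsum_nonneg)
  also have "\<dots> \<longleftrightarrow> (\<forall>v\<in>C. G v f \<in> carrier (ell2 (BV v))) \<and>
      (\<lambda>v. (hnorm (ell2 (BV v)) (G v f))\<^sup>2) summable_on C"
    by (rule conj_cong[OF refl summable_on_cong]) (simp add: hnorm_ell2_square)
  finally show ?thesis .
qed

lemma cinner_glue:
  assumes f: "f \<in> carrier (ell2 V)" and g: "g \<in> carrier (ell2 V)"
  shows "(\<Sum>\<^sub>\<infinity>v\<in>C. cinner (ell2 (BV v)) (G v f) (G v g)) = cinner (ell2 V) f g"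
proof -
  let ?h = "\<lambda>q. G (fst q) f (snd q) * cnj (G (fst q) g (snd q))"
  have abs: "(\<lambda>u. f u * cnj (g u)) abs_summable_on V" by (rule ell2_abs_summable[OF f g])
  have "?h summable_on Q" by (rule abs_summable_summable[OF abs_summable_G[THEN iffD2, OF abs]])
  then have "(\<Sum>\<^sub>\<infinity>v\<in>C. cinner (ell2 (BV v)) (G v f) (G v g)) = infsum ?h Q"
    using infsum_Sigma_banach[of ?h C BV] by (simp add: ell2_sel)
  also have "\<dots> = (\<Sum>\<^sub>\<infinity>q\<in>Q. of_real (wt q) * (f (\<pi> q) * cnj (g (\<pi> q))))"
    by (rule infsum_cong) (simp only: G_product)
  also have "\<dots> = cinner (ell2 V) f g"
    unfolding ell2_sel by (rule weighted_fibre(2)[where V=V and F="\<lambda>u. f u * cnj (g u)", OF \<pi>_in wt_nonneg wt_has_sum abs])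
  finally show ?thesis .
qed

lemma hnorm_glue:
  assumes f: "f \<in> carrier (ell2 V)"
  shows "(hnorm (ell2 V) f)\<^sup>2 = (\<Sum>\<^sub>\<infinity>v\<in>C. (hnorm (ell2 (BV v)) (G v f))\<^sup>2)"
proof -
  have G: "\<And>v. v \<in> C \<Longrightarrow> G v f \<in> carrier (ell2 (BV v))"
    and s: "(\<lambda>v. (hnorm (ell2 (BV v)) (G v f))\<^sup>2) summable_on C"
    using ell2_glue[of f] f ell2_zero_outside[OF f] by auto
  have "of_real ((hnorm (ell2 V) f)\<^sup>2) = cinner (ell2 V) f f"
    using f by (simp add: cinner_ell2_self hnorm_ell2_square)
  also have "\<dots> = (\<Sum>\<^sub>\<infinity>v\<in>C. of_real ((hnorm (ell2 (BV v)) (G v f))\<^sup>2))"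
    unfolding cinner_glue[OF f f, symmetric]
    by (rule infsum_cong) (simp add: G cinner_ell2_self hnorm_ell2_square)
  also have "\<dots> = of_real (\<Sum>\<^sub>\<infinity>v\<in>C. (hnorm (ell2 (BV v)) (G v f))\<^sup>2)"
    by (rule infsumI has_sum_of_real has_sum_infsum s)+
  finally show ?thesis by (simp only: of_real_eq_iff)
qed

text \<open>Each \<open>B v\<close> is bounded by \<open>M\<close> because \<open>J v\<close> is
  isometric. Through \<open>G\<close> these bounds add up to boundedness of \<open>S\<close>, after
  which the direct sum of the normal extensions applies.\<close>

lemma glued_shift:
  fixes K :: "'v \<Rightarrow> 'k inner_space"
  assumes ext: "\<And>v. v \<in> C \<Longrightarrow> normal_extension (ell2 (BV v)) (B v) (K v) (N v) (J v)"
    and M: "0 \<le> M" "\<And>v x. v \<in> C \<Longrightarrow> x \<in> carrier (K v) \<Longrightarrow> hnorm (K v) (N v x) \<le> M * hnorm (K v) x"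
    and bdd: "\<And>v. v \<in> C \<Longrightarrow> bounded_operator (ell2 (BV v)) (B v)"
  shows "bounded_operator (ell2 V) S" and "subnormal (ell2 V) S"
proof -
  have G_in: "G v f \<in> carrier (ell2 (BV v))" if "f \<in> carrier (ell2 V)" "v \<in> C" for v f
    using ell2_glue[of f] that ell2_zero_outside[OF that(1)] by auto
  have G_summable: "(\<lambda>v. (hnorm (ell2 (BV v)) (G v f))\<^sup>2) summable_on C" if "f \<in> carrier (ell2 V)" for f
    using ell2_glue[of f] that ell2_zero_outside[OF that(1)] by auto
  have B_le: "hnorm (ell2 (BV v)) (B v g) \<le> M * hnorm (ell2 (BV v)) g"
    if v: "v \<in> C" and g: "g \<in> carrier (ell2 (BV v))" for v g
  proof -
    have Bg: "B v g \<in> carrier (ell2 (BV v))"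
      using bdd[OF v] g by (auto simp: bounded_operator_def clinear_map_def)
    have norm_J: "hnorm (K v) (J v h) = hnorm (ell2 (BV v)) h" if "h \<in> carrier (ell2 (BV v))" for h
      using ext[OF v] that by (simp add: normal_extension_def isometric_embedding_def hnorm_def)
    have "J v g \<in> carrier (K v)" "N v (J v g) = J v (B v g)"
      using ext[OF v] g by (auto simp: normal_extension_def isometric_embedding_def clinear_map_def)
    then show ?thesis using M(2)[OF v, of "J v g"] norm_J[OF g] norm_J[OF Bg] by simp
  qed
  have sq_le: "(hnorm (ell2 (BV v)) (G v (S f)))\<^sup>2 \<le> M\<^sup>2 * (hnorm (ell2 (BV v)) (G v f))\<^sup>2"
    and GS_in: "G v (S f) \<in> carrier (ell2 (BV v))"
    if f: "f \<in> carrier (ell2 V)" and v: "v \<in> C" for f v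
  proof -
    show *: "G v (S f) \<in> carrier (ell2 (BV v))"
      using bdd[OF v] G_in[OF f v] by (auto simp: bounded_operator_def clinear_map_def simp flip: intertwine[OF v])
    have "hnorm (ell2 (BV v)) (G v (S f)) \<le> M * hnorm (ell2 (BV v)) (G v f)"
      using B_le[OF v G_in[OF f v]] by (simp add: intertwine[OF v])
    then have "(hnorm (ell2 (BV v)) (G v (S f)))\<^sup>2 \<le> (M * hnorm (ell2 (BV v)) (G v f))\<^sup>2"
      by (rule power_mono) (rule hnorm_ell2_nonneg[OF *])
    then show "(hnorm (ell2 (BV v)) (G v (S f)))\<^sup>2 \<le> M\<^sup>2 * (hnorm (ell2 (BV v)) (G v f))\<^sup>2"
      by (simp add: power_mult_distrib)
  qed
  have S_in: "S f \<in> carrier (ell2 V)" if f: "f \<in> carrier (ell2 V)" for f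
  proof (rule ell2_glue[THEN iffD2])
    show "u \<notin> V \<Longrightarrow> S f u = 0" for u by (simp add: weighted_shift_def)
    have "(\<lambda>v. (hnorm (ell2 (BV v)) (G v (S f)))\<^sup>2) summable_on C"
      by (rule summable_on_real_comparison[OF summable_on_cmult_right[OF G_summable[OF f], of "M\<^sup>2"]])
         (use sq_le[OF f] in auto)
    then show "(\<forall>v\<in>C. G v (S f) \<in> carrier (ell2 (BV v)))
        \<and> (\<lambda>v. (hnorm (ell2 (BV v)) (G v (S f)))\<^sup>2) summable_on C" using GS_in[OF f] by blast
  qed
  have S_le: "hnorm (ell2 V) (S f) \<le> M * hnorm (ell2 V) f" if f: "f \<in> carrier (ell2 V)" for f
  proof (rule power2_le_imp_le)
    have "(hnorm (ell2 V) (S f))\<^sup>2 \<le> (\<Sum>\<^sub>\<infinity>v\<in>C. M\<^sup>2 * (hnorm (ell2 (BV v)) (G v f))\<^sup>2)"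
      unfolding hnorm_glue[OF S_in[OF f]]
      by (rule infsum_mono[OF G_summable[OF S_in[OF f]] summable_on_cmult_right[OF G_summable[OF f]] sq_le[OF f]])
    also have "\<dots> = (M * hnorm (ell2 V) f)\<^sup>2"
      by (simp add: hnorm_glue[OF f] power_mult_distrib infsum_cmult_right')
    finally show "(hnorm (ell2 V) (S f))\<^sup>2 \<le> (M * hnorm (ell2 V) f)\<^sup>2" .
  qed (use M(1) hnorm_ell2_nonneg[OF f] in simp)
  show bS: "bounded_operator (ell2 V) S" by (rule weighted_shift_boundedI[OF S_in S_le])
  have lin: "clinear_map (ell2 V) (ell2 (BV v)) (G v)" if v: "v \<in> C" for v
    unfolding clinear_map_def
    by (intro conjI funcsetI ballI allI G_in v)
       (auto simp: ell2_sel G_def fun_eq_iff algebra_simps split: sum.split)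
  show "subnormal (ell2 V) S"
    by (rule subnormal_by_components[where I=C and E="\<lambda>v. ell2 (BV v)" and B=B and K=K and N=N and J=J and G=G,
          OF bS ext M(2) lin G_summable cinner_glue intertwine])
qed

lemma lam'_root: "lam' \<omega> = 0"
  by (simp add: lam'_def)

lemma lam'_deep: "k < depth u \<Longrightarrow> lam' u = lam u"
  by (auto simp: lam'_def)

lemma lam'_shallow:
  assumes "u \<in> V" "u \<noteq> \<omega>" "depth u \<le> k" shows "lam' u \<noteq> 0"
proof -
  have "A u > 0" "A (p u) > 0" using A_pos[of u] A_pos[of "p u"] assms by (simp_all add: depth_p)
  then show ?thesis using assms by (simp add: lam'_def)
qed

end

section \<open>Choice of the scalars and conclusion\<close>

lemma summable_geometric_countable:
  assumes "countable C" shows "(\<lambda>v. (1/2 :: real) ^ to_nat_on C v) summable_on C"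
proof -
  have "(\<lambda>n. (1/2 :: real) ^ n) summable_on UNIV"
    by (rule summable_nonneg_imp_summable_on) (auto intro: summable_geometric)
  then have "(\<lambda>n. (1/2 :: real) ^ n) summable_on to_nat_on C ` C"
    by (rule summable_on_subset_banach) simp
  then show ?thesis unfolding summable_on_reindex[OF inj_on_to_nat_on[OF assms]] by (simp add: o_def)
qed

text \<open>An enumeration of \<open>C\<close> provides a geometric series; \<beta> is chosen so
  small that the \<open>k + 1\<close> terms at \<open>v\<close> together stay below the term of this
  series belonging to \<open>v\<close>.\<close>

lemma summable_positive_scaling:
  fixes c :: "'v \<Rightarrow> nat \<Rightarrow> real"
  assumes C: "countable C"
  obtains \<beta> :: "'v \<Rightarrow> real" where "\<And>v. \<beta> v > 0" "(\<lambda>x. (\<beta> (fst x) / c (fst x) (snd x))\<^sup>2) summable_on C \<times> {..k}"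
proof -
  \<comment> \<open>The summand 1 keeps \<open>t v\<close> positive even if all quotients
    vanish.\<close>
  define t where "t v = 1 + (\<Sum>i\<le>k. (1 / c v i)\<^sup>2)" for v
  have t: "t v > 0" "(\<Sum>i\<le>k. (1 / c v i)\<^sup>2) \<le> t v" for v
    using sum_nonneg[of "{..k}" "\<lambda>i. (1 / c v i)\<^sup>2"] by (simp_all add: t_def add_pos_nonneg)
  define b where "b v = sqrt ((1/2) ^ to_nat_on C v / t v)" for v
  have b: "(b v)\<^sup>2 = (1/2) ^ to_nat_on C v / t v" for v using t(1)[of v] by (simp add: b_def)
  have le: "(\<Sum>i\<le>k. (b v / c v i)\<^sup>2) \<le> (1/2) ^ to_nat_on C v" for v
  proof -
    have "(\<Sum>i\<le>k. (b v / c v i)\<^sup>2) = (b v)\<^sup>2 * (\<Sum>i\<le>k. (1 / c v i)\<^sup>2)"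
      by (simp add: sum_distrib_left power_divide)
    also have "\<dots> \<le> (b v)\<^sup>2 * t v" by (rule mult_left_mono[OF t(2)]) simp
    also have "\<dots> = (1/2) ^ to_nat_on C v" using t(1)[of v] by (simp add: b)
    finally show ?thesis .
  qed
  have "(\<lambda>v. \<Sum>i\<le>k. (b v / c v i)\<^sup>2) summable_on C"
    by (rule summable_on_real_comparison[OF summable_geometric_countable[OF C]]) (auto intro: le sum_nonneg)
  then have "(\<lambda>x. (b (fst x) / c (fst x) (snd x))\<^sup>2) abs_summable_on C \<times> {..k}"
    unfolding abs_summable_on_Sigma_iff by (simp add: sum_nonneg)
  then have "(\<lambda>x. (b (fst x) / c (fst x) (snd x))\<^sup>2) summable_on C \<times> {..k}"
    by (rule abs_summable_summable)
  moreover have "b v > 0" for v using t(1)[of v] by (simp add: b_def)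
  ultimately show ?thesis by (rule that[rotated])
qed

lemma (in rooted_tree) subtree_extensions_imp_subnormal:
  assumes k: "1 \<le> k" and leafless: "leafless V p"
    and nz: "\<And>u. u \<in> V \<Longrightarrow> k < depth u \<Longrightarrow> lam u \<noteq> 0"
    and countable: "countable (Chi V p k \<omega>)"
    and ext: "\<And>v. v \<in> Chi V p k \<omega> \<Longrightarrow>
      admits_subnormal_backward_extension k (Des V p v) (subtree_parent p v) v (subtree_weights lam v)"
    and bdd: "bdd_above ((\<lambda>v. op_norm (ell2 (Des V p v))
      (weighted_shift (Des V p v) (subtree_parent p v) (subtree_weights lam v))) ` Chi V p k \<omega>)"
  shows "\<exists>lam'. lam' \<omega> = 0 \<and> (\<forall>u\<in>V. k < depth u \<longrightarrow> lam' u = lam u) \<and> (\<forall>u\<in>V. u \<noteq> \<omega> \<longrightarrow> lam' u \<noteq> 0)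
    \<and> bounded_operator (ell2 V) (weighted_shift V p lam') \<and> subnormal (ell2 V) (weighted_shift V p lam')"
proof (cases "V = {\<omega>}")
  case True
  then show ?thesis using subnormal_zero_singleton[of \<omega> p] by (intro exI[of _ "\<lambda>_. 0"]) auto
next
  case nontrivial: False
  let ?C = "{u \<in> V. depth u = k}"
  let ?T = "\<lambda>v. weighted_shift (Des V p v) (subtree_parent p v) (subtree_weights lam v)"
  let ?B = "\<lambda>v \<mu>. weighted_shift (backward_verts k (Des V p v)) (backward_parent k (subtree_parent p v) v)
      (backward_weights v (subtree_weights lam v) \<mu>)"
  note Chi = Chi_root[OF k]
  obtain M0 where M0: "\<And>v. v \<in> ?C \<Longrightarrow> op_norm (ell2 (Des V p v)) (?T v) \<le> M0"
    using bdd unfolding Chi bdd_above_def by blast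
  \<comment> \<open>The growth argument needs a positive bound, while \<open>M0\<close> may be zero,
    or arbitrary if there are no branches.\<close>
  define M where "M = max 1 M0"
  have "\<forall>v. \<exists>\<mu>. v \<in> ?C \<longrightarrow> (\<forall>j<k. \<mu> j \<noteq> 0) \<and> \<mu> k = 0 \<and> subnormal (ell2 (backward_verts k (Des V p v))) (?B v \<mu>)"
    using ext unfolding Chi admits_subnormal_backward_extension_def by blast
  from choice[OF this] obtain \<mu> where \<mu>: "\<And>v. v \<in> ?C \<Longrightarrow> (\<forall>j<k. \<mu> v j \<noteq> 0) \<and> \<mu> v k = 0
      \<and> subnormal (ell2 (backward_verts k (Des V p v))) (?B v (\<mu> v))" by blast
  obtain \<beta> :: "'v \<Rightarrow> real" where \<beta>: "\<And>v. \<beta> v > 0"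
    "(\<lambda>x. (\<beta> (fst x) / cmod (\<Prod>j<snd x. \<mu> (fst x) j))\<^sup>2) summable_on ?C \<times> {..k}"
    by (rule summable_positive_scaling[OF countable[unfolded Chi], of "\<lambda>v i. cmod (\<Prod>j<i. \<mu> v j)" k], rule that)
  interpret branch_gluing V p \<omega> k lam \<mu> \<beta>
    by unfold_locales (use k leafless nontrivial \<mu> \<beta> in auto)
  have "\<forall>v. \<exists>(L :: (nat \<Rightarrow> ('v + nat \<Rightarrow> complex) \<Rightarrow> complex) inner_space) N J. v \<in> ?C \<longrightarrow>
      normal_extension (ell2 (BV v)) (B v) L N J \<and> (\<forall>x\<in>carrier L. hnorm L (N x) \<le> M * hnorm L x)"
  proof
    fix v
    show "\<exists>(L :: (nat \<Rightarrow> ('v + nat \<Rightarrow> complex) \<Rightarrow> complex) inner_space) N J. v \<in> ?C \<longrightarrow>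
      normal_extension (ell2 (BV v)) (B v) L N J \<and> (\<forall>x\<in>carrier L. hnorm L (N x) \<le> M * hnorm L x)"
    proof (cases "v \<in> ?C")
      case True
      have "bounded_operator (ell2 (Des V p v)) (?T v)"
        using ext True unfolding Chi admits_subnormal_backward_extension_def subnormal_def by blast
      then show ?thesis
        using backward_extension_bound[OF k, where lam="subtree_weights lam v" and \<mu>="\<mu> v" and M=M
            and p="subtree_parent p v" and v=v and D="Des V p v"] \<mu>[OF True] M0[OF True]
        by (simp add: subtree_weights_def M_def max.coboundedI2)
    qed blast
  qed
  from choice[OF this] obtain K :: "'v \<Rightarrow> (nat \<Rightarrow> ('v + nat \<Rightarrow> complex) \<Rightarrow> complex) inner_space"
    where "\<forall>v. \<exists>N J. v \<in> ?C \<longrightarrow> normal_extension (ell2 (BV v)) (B v) (K v) N J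
      \<and> (\<forall>x\<in>carrier (K v). hnorm (K v) (N x) \<le> M * hnorm (K v) x)" by blast
  from choice[OF this] obtain N where "\<forall>v. \<exists>J. v \<in> ?C \<longrightarrow> normal_extension (ell2 (BV v)) (B v) (K v) (N v) J
      \<and> (\<forall>x\<in>carrier (K v). hnorm (K v) (N v x) \<le> M * hnorm (K v) x)" by blast
  from choice[OF this] obtain J where KNJ: "\<And>v. v \<in> ?C \<Longrightarrow> normal_extension (ell2 (BV v)) (B v) (K v) (N v) (J v)
      \<and> (\<forall>x\<in>carrier (K v). hnorm (K v) (N v x) \<le> M * hnorm (K v) x)" by blast
  have "bounded_operator (ell2 (BV v)) (B v)" if "v \<in> C" for v
    using \<mu>[of v] that unfolding C_def subnormal_def by blast
  moreover have "0 \<le> M" by (simp add: M_def)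
  ultimately have "bounded_operator (ell2 V) S" "subnormal (ell2 V) S"
    using glued_shift[of K N J M] KNJ unfolding C_def by blast+
  moreover have "lam' u \<noteq> 0" if "u \<in> V" "u \<noteq> \<omega>" for u
    using lam'_shallow[OF that] lam'_deep[of u] nz[OF that(1)] by (cases "depth u \<le> k") auto
  ultimately show ?thesis using lam'_root lam'_deep by blast
qed

theorem theorem5p7:
  fixes V :: "'v set" and p :: "'v \<Rightarrow> 'v" and \<omega> :: 'v and k :: nat
    and lam :: "'v \<Rightarrow> complex"
  assumes tree: "directed_tree V p"
    and root: "is_root V p \<omega>"
    and leafless: "leafless V p"
    and k: "k \<ge> 1"
    and nonzero: "\<forall>v\<in>{v \<in> V. (p ^^ k) v \<noteq> \<omega>}. lam v \<noteq> 0"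
  shows
    "(\<exists>lam'. (\<forall>v\<in>{v \<in> V. (p ^^ k) v \<noteq> \<omega>}. lam' v = lam v)
        \<and> is_weights V p lam'
        \<and> proper_weights V p lam'
        \<and> bounded_operator (ell2 V) (weighted_shift V p lam')
        \<and> subnormal (ell2 V) (weighted_shift V p lam'))
     \<longleftrightarrow>
     (countable (Chi V p k \<omega>)
        \<and> (\<forall>v\<in>Chi V p k \<omega>.
             proper_weights (Des V p v) (subtree_parent p v) (subtree_weights lam v)
             \<and> admits_subnormal_backward_extension k (Des V p v) (subtree_parent p v) v
                 (subtree_weights lam v))
        \<and> bdd_above ((\<lambda>v. op_norm (ell2 (Des V p v))
             (weighted_shift (Des V p v) (subtree_parent p v) (subtree_weights lam v)))
             ` Chi V p k \<omega>))"
proof -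
  interpret rooted_tree V p \<omega> using tree root by unfold_locales
  \<comment> \<open>As \<open>p\<close> fixes the root, \<open>k\<close> steps reach it exactly from
    depth at most \<open>k\<close>; the prescribed weights are those strictly inside the
    branches.\<close>
  have W: "{v \<in> V. (p ^^ k) v \<noteq> \<omega>} = {v \<in> V. k < depth v}"
    by (rule Collect_cong) (use pow_eq_root_iff in \<open>metis not_le\<close>)
  have Chi: "v \<in> V" "depth v = k" if "v \<in> Chi V p k \<omega>" for v
    using that Chi_root[OF k] by auto
  have nz: "lam u \<noteq> 0" if "u \<in> V" "k < depth u" for u using nonzero that unfolding W by blast
  have proper: "proper_weights (Des V p v) (subtree_parent p v) (subtree_weights lam v)"
    if "v \<in> Chi V p k \<omega>" for v
    using proper_subtree[OF Chi(1)[OF that]] nz Chi(2)[OF that] by simp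
  show ?thesis (is "?lhs \<longleftrightarrow> ?rhs")
  proof
    assume ?lhs
    then obtain lam' where lam': "\<forall>v\<in>V. k < depth v \<longrightarrow> lam' v = lam v" "lam' \<omega> = 0"
        "\<forall>v\<in>V. v \<noteq> \<omega> \<longrightarrow> lam' v \<noteq> 0"
        "bounded_operator (ell2 V) (weighted_shift V p lam')" "subnormal (ell2 V) (weighted_shift V p lam')"
      unfolding W is_weights_iff proper_weights_iff by blast
    note ext = subnormal_imp_subtree_extensions[OF k lam'(1)[rule_format] lam'(2) lam'(3)[rule_format] lam'(4,5)]
    show ?rhs by (intro conjI ballI ext proper)
  next
    assume rhs: ?rhs
    have "\<exists>lam'. lam' \<omega> = 0 \<and> (\<forall>u\<in>V. k < depth u \<longrightarrow> lam' u = lam u) \<and> (\<forall>u\<in>V. u \<noteq> \<omega> \<longrightarrow> lam' u \<noteq> 0)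
        \<and> bounded_operator (ell2 V) (weighted_shift V p lam') \<and> subnormal (ell2 V) (weighted_shift V p lam')"
    proof (rule subtree_extensions_imp_subnormal[OF k leafless nz])
      show "countable (Chi V p k \<omega>)" by (rule conjunct1[OF rhs])
      show "admits_subnormal_backward_extension k (Des V p v) (subtree_parent p v) v (subtree_weights lam v)"
        if "v \<in> Chi V p k \<omega>" for v using rhs that by blast
      show "bdd_above ((\<lambda>v. op_norm (ell2 (Des V p v))
          (weighted_shift (Des V p v) (subtree_parent p v) (subtree_weights lam v))) ` Chi V p k \<omega>)"
        by (rule conjunct2[OF conjunct2[OF rhs]])
    qed
    then show ?lhs unfolding W is_weights_iff proper_weights_iff by blast
  qed
qed

end
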